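(* Let $\mathcal{A}\subset\mathbb{Z}^{n+1}$ be a finite set, $Q$ an integral symmetric matrix indexed by $\mathcal{A}$, $x=(x_1,\dots,x_{n+1})$, $x^\alpha=\prod_i x_i^{\alpha_i}$, and $$h_{\mathcal{A},Q}(x)=\sum_{\alpha\in\mathcal{A}}(-1)^{Q_{\alpha\alpha}}x^\alpha\in\mathbb{Z}[x^{\pm1}].$$ Then the series $$f_{\mathcal{A},Q}(x,\lambda,q)=\sum_{k\in\mathbb{Z}_{\ge0}^{\mathcal{A}}}(-1)^{\mathrm{diag}(Q)k}\,q^{\frac12k^tQk+\frac12\mathrm{diag}(Q)k}\,\frac{(q;q)_{\sum_\alpha k_\alpha}}{\prod_\alpha(q;q)_{k_\alpha}}\,x^{\sum_\alpha k_\alpha\alpha}\,\lambda^{\sum_\alpha k_\alpha}\in\mathbb{Z}[q,q^{-1},x^{\pm1}][\![\lambda]\!]$$ is an element of the Habiro ring $\mathcal{H}_{R/\mathbb{Z}[x^{\pm1},\lambda]}$ of the étale $\mathbb{Z}[x^{\pm1},\lambda]$-algebra $R=\mathbb{Z}[x^{\pm1},\lambda]\big[\tfrac{1}{1-\lambda h_{\mathcal{A},Q}(x)}\big]$.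
   Context: Notation: $(q;q)_k=\prod_{i=1}^k(1-q^i)$, $\mathrm{diag}(Q)k=\sum_\alpha Q_{\alpha\alpha}k_\alpha$. Fix primitive $m$-th roots of unity $\zeta_m$ ($m\ge1$) with $\zeta_{mm'}=\zeta_m\zeta_{m'}$ for coprime $m,m'$ and $(\zeta_{p^r})^p=\zeta_{p^{r-1}}$ for primes $p$, $r\ge1$. Habiro ring: let $A=\mathbb{Z}[x^{\pm1},\lambda]$ with Frobenius lifts $x_i\mapsto x_i^p$, $\lambda\mapsto\lambda^p$. For an étale $A$-algebra $R$, put $R_m=R[x^{1/m},\lambda^{1/m},\zeta_m]$ (adjoining $m$-th roots of all variables and $\zeta_m$). The Frobenius lift extends to $R^\wedge_p$ and to $\varphi_p$ on $(R_{pm})^\wedge_p$ with $x_i^{1/(pm)}\mapsto x_i^{1/m}$, $\lambda^{1/(pm)}\mapsto\lambda^{1/m}$, fixing $\zeta_{pm}$. $\mathcal{H}_{R/A}$ is the set of collections $(f_m(q-\zeta_m))_{m\ge1}\in\prod_mR_m[\![q-\zeta_m]\!]$ such that for all $m\ge1$ and all primes $p$ $$f_m(q-\zeta_{pm}+(\zeta_{pm}-\zeta_m))=\varphi_pf_{pm}(q-\zeta_{pm})\in(R_{pm})^\wedge_p[\![q-\zeta_{pm}]\!].$$ A series $f(x,\lambda,q)\in\mathbb{Z}[q^{\pm1},x^{\pm1}][\![\lambda]\!]$ is regarded as an element of $\mathcal{H}_{R/A}$ when the collection whose $m$-th member is the expansion of $f(x^{1/m},\lambda^{1/m},q)$ in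 powers of $q-\zeta_m$, a priori with coefficients in $\mathbb{Z}[\zeta_m,x^{\pm1/m}][\![\lambda^{1/m}]\!]$, lies in it. *)

theory Defs
  imports
    "HOL-Analysis.Finite_Cartesian_Product"
    "HOL-Library.Poly_Mapping"
    "HOL-Computational_Algebra.Formal_Power_Series"
    "HOL-Computational_Algebra.Polynomial"
    "HOL-Computational_Algebra.Primes"
    "HOL-Algebra.QuotRing"
    "HOL-Algebra.Generated_Rings"
begin

section \<open>p-adic completion of a commutative ring\<close>

definition prime_power_ideal :: "('a, 'b) ring_scheme \<Rightarrow> nat \<Rightarrow> nat \<Rightarrow> 'a set" where
  "prime_power_ideal R p N = PIdl\<^bsub>R\<^esub> ([(p ^ N)] \<cdot>\<^bsub>R\<^esub> \<one>\<^bsub>R\<^esub>)"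

text \<open>The inverse limit of the rings \<open>R / p^N R\<close>: an element is a sequence of cosets, the
  \<open>N\<close>-th one modulo \<open>p^N\<close>, and compatibility under the projections is inclusion of cosets.\<close>

definition padic_completion :: "('a, 'b) ring_scheme \<Rightarrow> nat \<Rightarrow> (nat \<Rightarrow> 'a set) ring" where
  "padic_completion R p =
    \<lparr>carrier = {c. \<forall>N. c N \<in> carrier (R Quot prime_power_ideal R p N) \<and> c (Suc N) \<subseteq> c N},
     mult = (\<lambda>c d N. c N \<otimes>\<^bsub>R Quot prime_power_ideal R p N\<^esub> d N),
     one = (\<lambda>N. \<one>\<^bsub>R Quot prime_power_ideal R p N\<^esub>),
     zero = (\<lambda>N. \<zero>\<^bsub>R Quot prime_power_ideal R p N\<^esub>),
     add = (\<lambda>c d N. c N \<oplus>\<^bsub>R Quot prime_power_ideal R p N\<^esub> d N)\<rparr>"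

definition to_completion :: "('a, 'b) ring_scheme \<Rightarrow> nat \<Rightarrow> 'a \<Rightarrow> (nat \<Rightarrow> 'a set)" where
  "to_completion R p a = (\<lambda>N. prime_power_ideal R p N +>\<^bsub>R\<^esub> a)"

text \<open>Convergence in the p-adic (that is, inverse limit) topology of the completion.\<close>

definition padic_tendsto :: "(nat \<Rightarrow> (nat \<Rightarrow> 'a set)) \<Rightarrow> (nat \<Rightarrow> 'a set) \<Rightarrow> bool" where
  "padic_tendsto s c \<longleftrightarrow> (\<forall>N. \<forall>\<^sub>F K in sequentially. s K N = c N)"


section \<open>The rings \<open>A\<close>, \<open>R\<close> and \<open>R_m\<close>\<close>

type_synonym 'n xlaurent = "(rat ^ 'n) \<Rightarrow>\<^sub>0 complex"

text \<open>Laurent polynomials in fractional powers of the variables \<open>x_i\<close> (\<open>i :: 'n\<close>): the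
  monomial \<open>x^a\<close>, for a rational vector \<open>a\<close>, is \<^term>\<open>Poly_Mapping.single a 1\<close>.
  At level \<open>m\<close> the series in \<open>\<lambda>^(1/m)\<close> live in \<^typ>\<open>'n::finite xlaurent fps\<close>, where
  \<^term>\<open>fps_X\<close> stands for \<open>\<lambda>^(1/m)\<close>. Hence the embedding of level 1 into level \<open>m\<close> is
  substitution of \<open>fps_X ^ m\<close>, and that of level \<open>m\<close> into level \<open>p * m\<close> is substitution
  of \<open>fps_X ^ p\<close>.\<close>

definition full_ring :: "'a::comm_ring_1 ring" where
  "full_ring = \<lparr>carrier = UNIV, mult = (*), one = 1, zero = 0, add = (+)\<rparr>"

definition subring_on :: "'a::comm_ring_1 set \<Rightarrow> 'a ring" where
  "subring_on S = full_ring\<lparr>carrier := S\<rparr>"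

definition scalar :: "complex \<Rightarrow> 'n::finite xlaurent fps" where
  "scalar z = fps_const (Poly_Mapping.single 0 z)"

definition xpow :: "'n::finite \<Rightarrow> rat \<Rightarrow> 'n xlaurent fps" where
  "xpow i r = fps_const (Poly_Mapping.single (axis i r) 1)"

text \<open>\<open>A = \<int>[x\<^sup>\<plusminus>\<^sup>1, \<lambda>]\<close>, at level 1.\<close>

definition base_ring :: "'n::finite xlaurent fps set" where
  "base_ring = generate_ring full_ring
     (range (\<lambda>i. xpow i 1) \<union> range (\<lambda>i. xpow i (-1)) \<union> {fps_X})"

text \<open>\<open>A[1/g]\<close> as the ring of all fractions \<open>a / g^k\<close>. This is the localisation whenever \<open>g\<close> is
  a unit of the ambient ring, for instance a power series with constant term 1.\<close>

definition localisation :: "'a::comm_ring_1 set \<Rightarrow> 'a \<Rightarrow> 'a set" where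
  "localisation A g = {F. \<exists>k. g ^ k * F \<in> A}"

definition root_ring ::
  "(nat \<Rightarrow> complex) \<Rightarrow> 'n::finite xlaurent fps set \<Rightarrow> nat \<Rightarrow> 'n xlaurent fps set" where
  "root_ring \<zeta> R m = generate_ring full_ring
     ((\<lambda>F. F oo fps_X ^ m) ` R \<union> range (\<lambda>i. xpow i (1 / of_nat m)) \<union> {fps_X, scalar (\<zeta> m)})"


section \<open>The Habiro ring\<close>

definition primitive_root_of_unity :: "nat \<Rightarrow> complex \<Rightarrow> bool" where
  "primitive_root_of_unity m z \<longleftrightarrow> z ^ m = 1 \<and> (\<forall>k. 0 < k \<and> k < m \<longrightarrow> z ^ k \<noteq> 1)"

definition compatible_roots :: "(nat \<Rightarrow> complex) \<Rightarrow> bool" where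
  "compatible_roots \<zeta> \<longleftrightarrow>
     (\<forall>m\<ge>1. primitive_root_of_unity m (\<zeta> m)) \<and>
     (\<forall>m\<ge>1. \<forall>m'\<ge>1. coprime m m' \<longrightarrow> \<zeta> (m * m') = \<zeta> m * \<zeta> m') \<and>
     (\<forall>p r. prime p \<and> r \<ge> 1 \<longrightarrow> \<zeta> (p ^ r) ^ p = \<zeta> (p ^ (r - 1)))"

text \<open>The properties of \<open>\<phi>_p\<close> on the p-adic completion of \<open>R_{pm}\<close>. At level \<open>p * m\<close> the
  element \<open>\<lambda>^(1/m)\<close> is \<open>fps_X ^ p\<close>. The last clause says that \<open>\<phi>_p\<close> restricts to a lift of
  Frobenius on \<open>R\<close>: the component with index 1 is the class modulo \<open>p\<close>.\<close>

definition is_frobenius ::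
  "(nat \<Rightarrow> complex) \<Rightarrow> 'n::finite xlaurent fps set \<Rightarrow> nat \<Rightarrow> nat \<Rightarrow>
   ((nat \<Rightarrow> 'n xlaurent fps set) \<Rightarrow> (nat \<Rightarrow> 'n xlaurent fps set)) \<Rightarrow> bool" where
  "is_frobenius \<zeta> R p m \<phi> \<longleftrightarrow>
    (let S = subring_on (root_ring \<zeta> R (p * m));
         C = padic_completion S p;
         \<iota> = to_completion S p
     in \<phi> \<in> ring_hom C C \<and>
        (\<forall>i. \<phi> (\<iota> (xpow i (1 / of_nat (p * m)))) = \<iota> (xpow i (1 / of_nat m))) \<and>
        \<phi> (\<iota> fps_X) = \<iota> (fps_X ^ p) \<and>
        \<phi> (\<iota> (scalar (\<zeta> (p * m)))) = \<iota> (scalar (\<zeta> (p * m))) \<and>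
        (\<forall>F\<in>R. \<phi> (\<iota> (F oo fps_X ^ (p * m))) 1 = \<iota> ((F oo fps_X ^ (p * m)) ^ p) 1))"

text \<open>For a localisation \<open>R = A[1/(1 - \<lambda> h)]\<close> with \<open>h\<close> an integral Laurent polynomial such a map
  exists, and it is unique on the completion.\<close>

definition frobenius ::
  "(nat \<Rightarrow> complex) \<Rightarrow> 'n::finite xlaurent fps set \<Rightarrow> nat \<Rightarrow> nat \<Rightarrow>
   (nat \<Rightarrow> 'n xlaurent fps set) \<Rightarrow> (nat \<Rightarrow> 'n xlaurent fps set)" where
  "frobenius \<zeta> R p m = (SOME \<phi>. is_frobenius \<zeta> R p m \<phi>)"

text \<open>The \<open>K\<close>-th partial sum of the coefficient of \<open>(q - \<zeta>_{pm})^j\<close> in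
  \<open>F((q - \<zeta>_{pm}) + (\<zeta>_{pm} - \<zeta>_m))\<close>, for a series \<open>F\<close> over \<open>R_m\<close>, computed in \<open>R_{pm}\<close>.\<close>

definition recentre_partial ::
  "(nat \<Rightarrow> complex) \<Rightarrow> nat \<Rightarrow> nat \<Rightarrow> 'n::finite xlaurent fps fps \<Rightarrow> nat \<Rightarrow> nat \<Rightarrow> 'n xlaurent fps" where
  "recentre_partial \<zeta> p m F j K =
     (\<Sum>k<K. of_nat ((j + k) choose j) * scalar (\<zeta> (p * m) - \<zeta> m) ^ k
              * (fps_nth F (j + k) oo fps_X ^ p))"

text \<open>Elements are collections \<open>(f_m)\<close> indexed by \<open>m \<ge> 1\<close>; the value at index 0 is irrelevant.
  The outer formal variable of \<open>f m\<close> is \<open>q - \<zeta>_m\<close>.\<close>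

definition habiro_ring ::
  "(nat \<Rightarrow> complex) \<Rightarrow> 'n::finite xlaurent fps set \<Rightarrow> (nat \<Rightarrow> 'n xlaurent fps fps) set" where
  "habiro_ring \<zeta> R = {f.
     (\<forall>m\<ge>1. \<forall>j. fps_nth (f m) j \<in> root_ring \<zeta> R m) \<and>
     (\<forall>m\<ge>1. \<forall>p. prime p \<longrightarrow>
       (let \<iota> = to_completion (subring_on (root_ring \<zeta> R (p * m))) p
        in \<forall>j. padic_tendsto (\<lambda>K. \<iota> (recentre_partial \<zeta> p m (f m) j K))
                 (frobenius \<zeta> R p m (\<iota> (fps_nth (f (p * m)) j)))))}"


section \<open>Expansions of elements of \<open>\<int>[q\<^sup>\<plusminus>\<^sup>1, x\<^sup>\<plusminus>\<^sup>1][[\<lambda>]]\<close> at roots of unity\<close>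

type_synonym qlaurent = "int \<Rightarrow>\<^sub>0 int"

type_synonym 'n qx_series = "((int ^ 'n) \<Rightarrow>\<^sub>0 qlaurent) fps"

definition expand_q :: "complex \<Rightarrow> qlaurent \<Rightarrow> complex fps" where
  "expand_q z c = (\<Sum>e\<in>Poly_Mapping.keys c.
     of_int (Poly_Mapping.lookup c e) * (fps_const z + fps_X) powi e)"

definition expansion ::
  "(nat \<Rightarrow> complex) \<Rightarrow> 'n::finite qx_series \<Rightarrow> nat \<Rightarrow> 'n xlaurent fps fps" where
  "expansion \<zeta> f m = Abs_fps (\<lambda>j. Abs_fps (\<lambda>N.
     \<Sum>a\<in>Poly_Mapping.keys (fps_nth f N).
       Poly_Mapping.single (\<chi> i. of_int (a $ i) / of_nat m)
         (fps_nth (expand_q (\<zeta> m) (Poly_Mapping.lookup (fps_nth f N) a)) j)))"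


section \<open>The series \<open>f_{A,Q}\<close>\<close>

definition minus_one_pow :: "int \<Rightarrow> 'a::comm_ring_1" where
  "minus_one_pow e = (if even e then 1 else - 1)"

definition q_pochhammer :: "nat \<Rightarrow> int poly" where
  "q_pochhammer n = (\<Prod>i = 1..n. 1 - Polynomial.monom 1 i)"

text \<open>The division is exact, see \<open>prod_q_pochhammer_dvd\<close> below.\<close>

definition q_multinomial :: "'a set \<Rightarrow> ('a \<Rightarrow> nat) \<Rightarrow> int poly" where
  "q_multinomial \<A> k = q_pochhammer (\<Sum>\<alpha>\<in>\<A>. k \<alpha>) div (\<Prod>\<alpha>\<in>\<A>. q_pochhammer (k \<alpha>))"

lemma q_pochhammer_Suc: "q_pochhammer (Suc n) = q_pochhammer n * (1 - Polynomial.monom 1 (Suc n))"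
  by (simp add: q_pochhammer_def)

lemma q_pochhammer_mult_dvd: "q_pochhammer a * q_pochhammer b dvd q_pochhammer (a + b)"
proof (induction "a + b" arbitrary: a b)
  case 0
  then show ?case by (simp add: q_pochhammer_def)
next
  case (Suc n)
  show ?case
  proof (cases "a = 0 \<or> b = 0")
    case True
    then show ?thesis by (auto simp: q_pochhammer_def)
  next
    case False
    then obtain a' b' where ab: "a = Suc a'" "b = Suc b'"
      by (metis not0_implies_Suc)
    have n: "n = a' + b" "n = a + b'" using Suc.hyps(2) ab by auto
    have 1: "q_pochhammer a * q_pochhammer b dvd q_pochhammer n * (1 - Polynomial.monom 1 a)"
      using mult_dvd_mono[OF Suc.hyps(1)[OF n(1)] dvd_refl, of "1 - Polynomial.monom 1 a"] n(1)
      by (simp add: ab q_pochhammer_Suc mult_ac)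
    have 2: "q_pochhammer a * q_pochhammer b dvd q_pochhammer n * (1 - Polynomial.monom 1 b)"
      using mult_dvd_mono[OF Suc.hyps(1)[OF n(2)] dvd_refl, of "1 - Polynomial.monom 1 b"] n(2)
      by (simp add: ab q_pochhammer_Suc mult_ac)
    have eq: "q_pochhammer (a + b) = q_pochhammer n * (1 - Polynomial.monom 1 a)
                + Polynomial.monom 1 a * (q_pochhammer n * (1 - Polynomial.monom 1 b))"
      by (simp add: Suc.hyps(2)[symmetric] q_pochhammer_Suc algebra_simps)
        (simp add: Suc.hyps(2) mult_monom flip: mult.assoc)
    show ?thesis
      unfolding eq by (rule dvd_add[OF 1 dvd_mult[OF 2]])
  qed
qed

lemma prod_q_pochhammer_dvd:
  "finite \<A> \<Longrightarrow> (\<Prod>\<alpha>\<in>\<A>. q_pochhammer (k \<alpha>)) dvd q_pochhammer (\<Sum>\<alpha>\<in>\<A>. k \<alpha>)"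
proof (induction \<A> rule: finite_induct)
  case (insert \<alpha> \<A>)
  then show ?case
    using dvd_trans[OF mult_dvd_mono[OF dvd_refl insert.IH] q_pochhammer_mult_dvd] by simp
qed (simp add: q_pochhammer_def)

definition qlaurent_of_poly :: "int poly \<Rightarrow> qlaurent" where
  "qlaurent_of_poly P = (\<Sum>i\<le>Polynomial.degree P. Poly_Mapping.single (int i) (Polynomial.coeff P i))"

definition quadratic_form :: "'a set \<Rightarrow> ('a \<Rightarrow> 'a \<Rightarrow> int) \<Rightarrow> ('a \<Rightarrow> nat) \<Rightarrow> int" where
  "quadratic_form \<A> Q k = (\<Sum>\<alpha>\<in>\<A>. \<Sum>\<beta>\<in>\<A>. int (k \<alpha>) * Q \<alpha> \<beta> * int (k \<beta>))"

definition diag_form :: "'a set \<Rightarrow> ('a \<Rightarrow> 'a \<Rightarrow> int) \<Rightarrow> ('a \<Rightarrow> nat) \<Rightarrow> int" where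
  "diag_form \<A> Q k = (\<Sum>\<alpha>\<in>\<A>. Q \<alpha> \<alpha> * int (k \<alpha>))"

text \<open>For symmetric \<open>Q\<close> the division by 2 in the exponent of \<open>q\<close> is exact. A vector indexed by
  \<open>\<A>\<close> is a function that vanishes outside \<open>\<A>\<close>.\<close>

definition f_series :: "(int ^ 'n) set \<Rightarrow> (int ^ 'n \<Rightarrow> int ^ 'n \<Rightarrow> int) \<Rightarrow> 'n::finite qx_series" where
  "f_series \<A> Q = Abs_fps (\<lambda>N.
     \<Sum>k | (\<forall>\<alpha>. \<alpha> \<notin> \<A> \<longrightarrow> k \<alpha> = 0) \<and> (\<Sum>\<alpha>\<in>\<A>. k \<alpha>) = N.
       Poly_Mapping.single (\<chi> i. \<Sum>\<alpha>\<in>\<A>. int (k \<alpha>) * \<alpha> $ i)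
         (Poly_Mapping.single ((quadratic_form \<A> Q k + diag_form \<A> Q k) div 2)
            (minus_one_pow (diag_form \<A> Q k))
          * qlaurent_of_poly (q_multinomial \<A> k)))"

definition h_poly :: "(int ^ 'n) set \<Rightarrow> (int ^ 'n \<Rightarrow> int ^ 'n \<Rightarrow> int) \<Rightarrow> 'n::finite xlaurent" where
  "h_poly \<A> Q = (\<Sum>\<alpha>\<in>\<A>. Poly_Mapping.single (\<chi> i. of_int (\<alpha> $ i)) (minus_one_pow (Q \<alpha> \<alpha>)))"

end

theory Submission
  imports Defs "HOL-Library.Function_Algebras"
begin

text \<open>There are two things to prove. The expansions of \<open>f_{A,Q}\<close> at the roots of unity must be
  compatible with the Frobenius lifts, and their coefficients must lie in the rings \<open>R_m\<close>, that is,
  be rational functions whose only denominators are powers of \<open>1 - \<lambda>h\<close>.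

  The compatibility holds for every series in \<open>\<int>[q\<^sup>\<plusminus>\<^sup>1, x\<^sup>\<plusminus>\<^sup>1][[\<lambda>]]\<close>, because it can be checked
  one monomial at a time. The ring \<open>R_m\<close> lies in the ring of power series in \<open>\<lambda>^(1/m)\<close> whose
  coefficients are Laurent polynomials in the \<open>x_i^(1/m)\<close> over \<open>\<int>[\<zeta>_m]\<close>, and an element of \<open>R_m\<close> that is divisible by \<open>p\<^sup>N\<close> as a power series is
  divisible by \<open>p\<^sup>N\<close> in \<open>R_m\<close> (\<open>level_pure\<close>). So equalities in the p-adic completion of \<open>R_m\<close> are
  congruences between power series. On power series the Frobenius lift is the substitution
  \<open>x_i \<mapsto> x_i^p\<close>, \<open>\<lambda> \<mapsto> \<lambda>^p\<close> with constants fixed. In general it does not preserve \<open>R_{pm}\<close>, but it maps elements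
  of \<open>R_{pm}\<close> to p-adic limits of such elements, since it sends \<open>1 - \<lambda>h\<close> to its p-th power modulo
  \<open>p\<close>. Hence \<open>\<phi>_p\<close> exists, and every map with the prescribed values on generators is this
  substitution (\<open>is_frobenius_lift\<close>, \<open>frobenius_tracks\<close>). What remains is Taylor's formula for
  \<open>q^e\<close>, moved from \<open>\<zeta>_m\<close> to \<open>\<zeta>_{pm}\<close>; it converges because \<open>\<zeta>_{pm} - \<zeta>_m\<close> is nilpotent modulo
  \<open>p\<close>, with a rate that does not depend on \<open>e\<close> (\<open>recentre_expand_q\<close>, \<open>recentre_expansion\<close>).

  The rationality uses the shape of the coefficients \<open>c(k)\<close> of \<open>f_{A,Q}\<close>. Pascal's recursion for
  q-multinomial coefficients and the symmetry of \<open>Q\<close> give a bilinear form \<open>B\<close> with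
  \<open>c(k) = \<Sum> q^B(k-\<beta>,\<beta>) c(\<beta>) c(k-\<beta>)\<close>, the sum being over all \<open>\<beta> \<le> k\<close> with \<open>|\<beta>| = m\<close>,
  if \<open>|k| \<ge> m\<close> (\<open>coefficient_convolution\<close>). Let \<open>F = \<Sum> c(k) y^k\<close> in independent variables \<open>y_\<alpha>\<close>. At \<open>q = \<zeta>_m\<close> all
  \<open>c(\<beta>)\<close> with \<open>|\<beta>| = m\<close> vanish except for \<open>c(m e_\<alpha>) = (-1)^Q_\<alpha>\<alpha>\<close>, and then the power of \<open>q\<close> is
  \<open>1\<close>. So \<open>F\<close> times \<open>g = 1 - \<Sum> (-1)^Q_\<alpha>\<alpha> y_\<alpha>^m\<close> is a polynomial. For the coefficient \<open>F_j\<close> of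
  \<open>(q - \<zeta>_m)^j\<close> the same identity expresses \<open>g F_j\<close>, up to a polynomial, through the \<open>F_i\<close> with \<open>i < j\<close>, on which it acts
  by multiplying the coefficient of \<open>y^k\<close> by polynomials in \<open>k\<close> and by m-th roots of unity that depend
  linearly on \<open>k\<close>. Such operators preserve the rational functions with denominator a power of \<open>g\<close>
  (\<open>rational_w\<close>), and the substitution \<open>y_\<alpha> = x^(\<alpha>/m) \<lambda>^(1/m)\<close> turns \<open>g\<close> into \<open>1 - \<lambda>h\<close>. The argument
  runs over the complex numbers: the numerators are integral because the series \<open>F_j\<close> are.\<close>

section \<open>Subrings and congruences\<close>

text \<open>Subrings are plain sets, so that one and the same element can be regarded as an element of several
  subrings of an ambient ring.\<close>

definition subring_set :: "'a::comm_ring_1 set \<Rightarrow> bool" where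
  "subring_set S \<longleftrightarrow> 1 \<in> S \<and> (\<forall>a\<in>S. \<forall>b\<in>S. a - b \<in> S \<and> a * b \<in> S)"

lemma
  assumes "subring_set S"
  shows subring_set_one: "1 \<in> S"
    and subring_set_zero: "0 \<in> S"
    and subring_set_diff: "a \<in> S \<Longrightarrow> b \<in> S \<Longrightarrow> a - b \<in> S"
    and subring_set_mult: "a \<in> S \<Longrightarrow> b \<in> S \<Longrightarrow> a * b \<in> S"
    and subring_set_uminus: "a \<in> S \<Longrightarrow> - a \<in> S"
    and subring_set_add: "a \<in> S \<Longrightarrow> b \<in> S \<Longrightarrow> a + b \<in> S"
proof -
  show 1: "1 \<in> S" and d: "\<And>a b. a \<in> S \<Longrightarrow> b \<in> S \<Longrightarrow> a - b \<in> S"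
    and "a \<in> S \<Longrightarrow> b \<in> S \<Longrightarrow> a * b \<in> S"
    using assms by (auto simp: subring_set_def)
  show 0: "0 \<in> S"
    using d[OF 1 1] by simp
  show u: "- a \<in> S" if "a \<in> S" for a
    using d[OF 0 that] by simp
  show "a + b \<in> S" if "a \<in> S" "b \<in> S"
    using d[OF that(1) u[OF that(2)]] by simp
qed

lemma subring_set_power: "subring_set S \<Longrightarrow> a \<in> S \<Longrightarrow> a ^ n \<in> S"
  by (induction n) (auto simp: subring_set_one subring_set_mult)

lemma subring_set_sum: "subring_set S \<Longrightarrow> (\<And>i. i \<in> I \<Longrightarrow> f i \<in> S) \<Longrightarrow> sum f I \<in> S"
  by (induction I rule: infinite_finite_induct) (auto simp: subring_set_zero subring_set_add)

lemma subring_set_prod: "subring_set S \<Longrightarrow> (\<And>i. i \<in> I \<Longrightarrow> f i \<in> S) \<Longrightarrow> prod f I \<in> S"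
  by (induction I rule: infinite_finite_induct) (auto simp: subring_set_one subring_set_mult)

lemma subring_set_of_nat: "subring_set S \<Longrightarrow> of_nat n \<in> S"
  by (induction n) (auto simp: subring_set_zero subring_set_one subring_set_add)

lemma subring_set_of_int: "subring_set S \<Longrightarrow> of_int n \<in> S"
  by (cases n rule: int_cases2) (auto simp: subring_set_of_nat subring_set_uminus)

lemmas subring_set_intros = subring_set_one subring_set_zero subring_set_diff subring_set_mult
  subring_set_uminus subring_set_add subring_set_power subring_set_sum subring_set_prod
  subring_set_of_nat subring_set_of_int

lemma cring_subring_on:
  assumes "subring_set S"
  shows "cring (subring_on S)"
proof (rule cringI)
  show "abelian_group (subring_on S)"
  proof (rule abelian_groupI)
    fix x assume "x \<in> carrier (subring_on S)"
    then show "\<exists>y\<in>carrier (subring_on S). y \<oplus>\<^bsub>subring_on S\<^esub> x = \<zero>\<^bsub>subring_on S\<^esub>"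
      using assms by (auto simp: subring_on_def full_ring_def subring_set_intros intro!: bexI[of _ "- x"])
  qed (use assms in \<open>auto simp: subring_on_def full_ring_def add_ac subring_set_intros\<close>)
  show "Group.comm_monoid (subring_on S)"
    by (rule Group.comm_monoidI)
      (use assms in \<open>auto simp: subring_on_def full_ring_def mult_ac subring_set_intros\<close>)
qed (auto simp: subring_on_def full_ring_def algebra_simps)

lemma subring_on_UNIV: "subring_on UNIV = full_ring"
  by (simp add: subring_on_def full_ring_def)

lemma subring_set_UNIV: "subring_set UNIV"
  by (simp add: subring_set_def)

lemma full_ring_simps:
  fixes x y :: "'a::comm_ring_1"
  shows "\<one>\<^bsub>full_ring\<^esub> = (1::'a)" "x \<otimes>\<^bsub>full_ring\<^esub> y = x * y" "x \<oplus>\<^bsub>full_ring\<^esub> y = x + y" "\<ominus>\<^bsub>full_ring\<^esub> x = - x"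
proof -
  interpret cring "full_ring :: 'a ring"
    using cring_subring_on[OF subring_set_UNIV] by (simp add: subring_on_UNIV)
  show "\<one>\<^bsub>full_ring\<^esub> = (1::'a)" "x \<otimes>\<^bsub>full_ring\<^esub> y = x * y" "x \<oplus>\<^bsub>full_ring\<^esub> y = x + y"
    by (simp_all add: full_ring_def)
  show "\<ominus>\<^bsub>full_ring\<^esub> x = - x"
    by (rule minus_equality) (simp_all add: full_ring_def)
qed

abbreviation generated :: "'a::comm_ring_1 set \<Rightarrow> 'a set" where
  "generated \<equiv> generate_ring full_ring"

lemma generated_incl: "h \<in> H \<Longrightarrow> h \<in> generated H"
  by (rule generate_ring.incl)

lemma subring_set_generated: "subring_set (generated H)"
proof -
  have "a - b \<in> generated H" if "a \<in> generated H" "b \<in> generated H" for a b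
    using generate_ring.eng_add[OF that(1) generate_ring.a_inv[OF that(2)]]
    by (simp add: full_ring_simps)
  moreover have "1 \<in> generated H"
    using generate_ring.one[of full_ring H] by (simp add: full_ring_simps)
  moreover have "a * b \<in> generated H" if "a \<in> generated H" "b \<in> generated H" for a b
    using generate_ring.eng_mult[OF that] by (simp add: full_ring_simps)
  ultimately show ?thesis
    by (auto simp: subring_set_def)
qed

lemma generated_subset:
  assumes "subring_set T" "H \<subseteq> T"
  shows "generated H \<subseteq> T"
proof
  fix x assume "x \<in> generated H"
  then show "x \<in> T"
    by induction (use assms in \<open>auto simp: full_ring_simps subring_set_intros\<close>)
qed

text \<open>The quotient of \<open>a - b\<close> by \<open>c\<close> has to lie in \<open>T\<close>. The p-adic arguments below compare this
  relation for \<open>T = R_m\<close> and for \<open>T\<close> a ring of power series.\<close>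

definition cong_in :: "'a::comm_ring_1 set \<Rightarrow> 'a \<Rightarrow> 'a \<Rightarrow> 'a \<Rightarrow> bool" where
  "cong_in T c a b \<longleftrightarrow> (\<exists>s\<in>T. a - b = c * s)"

lemma cong_in_refl: "subring_set T \<Longrightarrow> cong_in T c a a"
  by (auto simp: cong_in_def subring_set_intros intro!: bexI[of _ 0])

lemma cong_in_sym:
  assumes "subring_set T" "cong_in T c a b" shows "cong_in T c b a"
proof -
  obtain s where "s \<in> T" "a - b = c * s" using assms by (auto simp: cong_in_def)
  then have "- s \<in> T" "b - a = c * (- s)"
    using assms by (auto simp: subring_set_intros algebra_simps)
  then show ?thesis unfolding cong_in_def by blast
qed

lemma cong_in_add:
  assumes "subring_set T" "cong_in T c a b" "cong_in T c a' b'"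
  shows "cong_in T c (a + a') (b + b')"
proof -
  obtain s s' where "s \<in> T" "a - b = c * s" "s' \<in> T" "a' - b' = c * s'"
    using assms by (auto simp: cong_in_def)
  then have "s + s' \<in> T" "(a + a') - (b + b') = c * (s + s')"
    using assms by (auto simp: subring_set_intros algebra_simps)
  then show ?thesis unfolding cong_in_def by blast
qed

lemma cong_in_uminus:
  assumes "subring_set T" "cong_in T c a b" shows "cong_in T c (- a) (- b)"
proof -
  obtain s where "s \<in> T" "a - b = c * s" using assms by (auto simp: cong_in_def)
  then have "- s \<in> T" "- a - (- b) = c * (- s)"
    using assms by (auto simp: subring_set_intros algebra_simps)
  then show ?thesis unfolding cong_in_def by blast
qed

lemma cong_in_diff:
  "subring_set T \<Longrightarrow> cong_in T c a b \<Longrightarrow> cong_in T c a' b' \<Longrightarrow> cong_in T c (a - a') (b - b')"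
  using cong_in_add[of T c a b "- a'" "- b'"] cong_in_uminus[of T c a' b'] by simp

lemma cong_in_trans:
  assumes "subring_set T" "cong_in T c a b" "cong_in T c b d" shows "cong_in T c a d"
  using cong_in_add[OF assms] cong_in_diff[OF assms(1) _ cong_in_refl[OF assms(1)], of c "a + b" "b + d" b]
  by (simp add: algebra_simps)

lemma cong_in_mult_left:
  assumes "subring_set T" "cong_in T c a b" "x \<in> T" shows "cong_in T c (x * a) (x * b)"
proof -
  obtain s where "s \<in> T" "a - b = c * s" using assms by (auto simp: cong_in_def)
  then have "x * s \<in> T" "x * a - x * b = c * (x * s)"
    using assms by (auto simp: subring_set_intros right_diff_distrib[symmetric] mult.left_commute)
  then show ?thesis unfolding cong_in_def by blast
qed

lemma cong_in_mult:
  assumes "subring_set T" "cong_in T c a b" "cong_in T c a' b'" "a' \<in> T" "b \<in> T"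
  shows "cong_in T c (a * a') (b * b')"
proof -
  have "cong_in T c (a * a') (b * a')"
    using cong_in_mult_left[OF assms(1,2,4)] by (simp add: mult.commute)
  then show ?thesis
    by (rule cong_in_trans[OF assms(1) _ cong_in_mult_left[OF assms(1,3,5)]])
qed

lemma cong_in_sum:
  "subring_set T \<Longrightarrow> (\<And>i. i \<in> I \<Longrightarrow> cong_in T c (f i) (g i)) \<Longrightarrow> cong_in T c (sum f I) (sum g I)"
  by (induction I rule: infinite_finite_induct) (auto simp: cong_in_refl cong_in_add)

lemma cong_in_coarser:
  assumes "subring_set T" "cong_in T (c * d) a b" "d \<in> T" shows "cong_in T c a b"
  using assms unfolding cong_in_def by (metis mult.assoc subring_set_mult)

text \<open>The freshman's dream: the binomial coefficients strictly between the ends are divisible by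
  \<open>p\<close>.\<close>

lemma cong_in_prime_power_add:
  assumes T: "subring_set T" and p: "prime p" and "a \<in> T" "b \<in> T"
  shows "cong_in T (of_nat p) ((a + b) ^ p) (a ^ p + b ^ p)"
proof -
  have p0: "p > 0" using p prime_gt_0_nat by blast
  have "(a + b) ^ p = (\<Sum>k\<le>p. of_nat (p choose k) * a ^ k * b ^ (p - k))"
    by (rule binomial_ring)
  also have "{..p} = insert 0 (insert p {0<..<p})" using p0 by auto
  also have "(\<Sum>k\<in>insert 0 (insert p {0<..<p}). of_nat (p choose k) * a ^ k * b ^ (p - k))
      = b ^ p + a ^ p + (\<Sum>k\<in>{0<..<p}. of_nat (p choose k) * a ^ k * b ^ (p - k))"
    using p0 by (subst sum.insert; (subst sum.insert)?) (auto simp: add_ac)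
  also have "(\<Sum>k\<in>{0<..<p}. of_nat (p choose k) * a ^ k * b ^ (p - k))
      = of_nat p * (\<Sum>k\<in>{0<..<p}. of_nat ((p choose k) div p) * a ^ k * b ^ (p - k))"
    unfolding sum_distrib_left
  proof (rule sum.cong[OF refl])
    fix k assume "k \<in> {0<..<p}"
    then have "p dvd (p choose k)"
      using p by (intro dvd_choose_prime) auto
    then have "p choose k = p * ((p choose k) div p)" by simp
    then have "(of_nat (p choose k) :: 'a) = of_nat p * of_nat ((p choose k) div p)"
      by (metis of_nat_mult)
    then show "of_nat (p choose k) * a ^ k * b ^ (p - k) =
        of_nat p * (of_nat ((p choose k) div p) * a ^ k * b ^ (p - k))"
      by (simp add: mult_ac)
  qed
  finally have "(a + b) ^ p - (a ^ p + b ^ p) =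
      of_nat p * (\<Sum>k\<in>{0<..<p}. of_nat ((p choose k) div p) * a ^ k * b ^ (p - k))"
    by simp
  moreover have "(\<Sum>k\<in>{0<..<p}. of_nat ((p choose k) div p) * a ^ k * b ^ (p - k)) \<in> T"
    using assms by (intro subring_set_sum subring_set_mult subring_set_of_nat subring_set_power)
  ultimately show ?thesis
    unfolding cong_in_def by blast
qed

lemma cong_in_power:
  assumes "subring_set T" "cong_in T c a b" "a \<in> T" "b \<in> T"
  shows "cong_in T c (a ^ n) (b ^ n)"
  by (induction n) (use assms in \<open>auto simp: cong_in_refl subring_set_intros intro!: cong_in_mult\<close>)

lemma cong_in_prime_power_power_add:
  assumes T: "subring_set T" and p: "prime p" and ab: "a \<in> T" "b \<in> T"
  shows "cong_in T (of_nat p) ((a + b) ^ p ^ r) (a ^ p ^ r + b ^ p ^ r)"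
proof (induction r)
  case 0
  then show ?case using T by (simp add: cong_in_refl)
next
  case (Suc r)
  have "cong_in T (of_nat p) (((a + b) ^ p ^ r) ^ p) ((a ^ p ^ r + b ^ p ^ r) ^ p)"
    by (rule cong_in_power[OF T Suc]) (use T ab in \<open>auto simp: subring_set_intros\<close>)
  then have "cong_in T (of_nat p) (((a + b) ^ p ^ r) ^ p) ((a ^ p ^ r) ^ p + (b ^ p ^ r) ^ p)"
    by (rule cong_in_trans[OF T _ cong_in_prime_power_add[OF T p]])
      (use T ab in \<open>auto simp: subring_set_intros\<close>)
  then show ?case
    by (simp add: power_mult[symmetric] mult.commute)
qed

section \<open>Additive and multiplicative maps out of a monoid ring\<close>

text \<open>If \<open>G\<close> is additive in its second argument, this is the additive map on the monoid ring that sends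
  the monomial with exponent \<open>a\<close> and coefficient \<open>x\<close> to \<open>G a x\<close>. All substitutions into Laurent
  polynomials have this form.\<close>

definition keysum :: "('a \<Rightarrow> 'b::zero \<Rightarrow> 'c::comm_monoid_add) \<Rightarrow> ('a \<Rightarrow>\<^sub>0 'b) \<Rightarrow> 'c" where
  "keysum G f = (\<Sum>a\<in>Poly_Mapping.keys f. G a (Poly_Mapping.lookup f a))"

lemma keysum_zero [simp]: "keysum G 0 = 0"
  by (simp add: keysum_def)

lemma keysum_single: "G a 0 = 0 \<Longrightarrow> keysum G (Poly_Mapping.single a x) = G a x"
  by (simp add: keysum_def)

definition coefficient_additive :: "('a \<Rightarrow> 'b::comm_monoid_add \<Rightarrow> 'c::comm_monoid_add) \<Rightarrow> bool" where
  "coefficient_additive G \<longleftrightarrow> (\<forall>a. G a 0 = 0 \<and> (\<forall>x y. G a (x + y) = G a x + G a y))"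

lemma keysum_add: "coefficient_additive G \<Longrightarrow> keysum G (f + g) = keysum G f + keysum G g"
  unfolding keysum_def coefficient_additive_def by (rule setsum_keys_plus_distrib) auto

lemma keysum_sum: "coefficient_additive G \<Longrightarrow> keysum G (sum f I) = (\<Sum>i\<in>I. keysum G (f i))"
  by (induction I rule: infinite_finite_induct) (auto simp: keysum_add)

lemma keysum_single_self: "keysum Poly_Mapping.single f = f"
proof (rule poly_mapping_eqI)
  fix b
  have "Poly_Mapping.lookup (keysum Poly_Mapping.single f) b =
      (\<Sum>a\<in>Poly_Mapping.keys f. if a = b then Poly_Mapping.lookup f a else 0)"
    by (simp add: keysum_def lookup_sum lookup_single when_def)
  also have "\<dots> = Poly_Mapping.lookup f b"
    by (simp add: in_keys_iff)
  finally show "Poly_Mapping.lookup (keysum Poly_Mapping.single f) b = Poly_Mapping.lookup f b" .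
qed

lemma mult_keysum:
  "f * g = (\<Sum>a\<in>Poly_Mapping.keys f. \<Sum>b\<in>Poly_Mapping.keys g.
      Poly_Mapping.single (a + b) (Poly_Mapping.lookup f a * Poly_Mapping.lookup g b))"
  using arg_cong2[OF keysum_single_self[of f, symmetric] keysum_single_self[of g, symmetric], of "(*)"]
  by (simp add: keysum_def sum_product mult_single)

lemma keysum_mult:
  fixes G :: "'a::monoid_add \<Rightarrow> 'b::semiring_0 \<Rightarrow> 'c::semiring_0"
  assumes G: "coefficient_additive G"
    and m: "\<And>a b x y. G (a + b) (x * y) = G a x * G b y"
  shows "keysum G (f * g) = keysum G f * keysum G g"
  unfolding mult_keysum
  using G by (simp add: keysum_sum keysum_single coefficient_additive_def m)
    (simp add: keysum_def sum_product)

definition coeff_ring :: "'c::comm_ring_1 set \<Rightarrow> 'a::comm_monoid_add set \<Rightarrow> ('a \<Rightarrow>\<^sub>0 'c) set" where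
  "coeff_ring \<O> L = {f. Poly_Mapping.keys f \<subseteq> L \<and> (\<forall>a. Poly_Mapping.lookup f a \<in> \<O>)}"

lemma coeff_ring_single:
  "subring_set \<O> \<Longrightarrow> c \<in> \<O> \<Longrightarrow> a \<in> L \<Longrightarrow> Poly_Mapping.single a c \<in> coeff_ring \<O> L"
  by (auto simp: coeff_ring_def lookup_single when_def subring_set_intros)

lemma coeff_ring_zero: "subring_set \<O> \<Longrightarrow> 0 \<in> coeff_ring \<O> L"
  by (auto simp: coeff_ring_def subring_set_intros)

lemma coeff_ring_add:
  assumes "subring_set \<O>" "f \<in> coeff_ring \<O> L" "g \<in> coeff_ring \<O> L"
  shows "f + g \<in> coeff_ring \<O> L"
  using assms Poly_Mapping.keys_add[of f g]
  by (auto simp: coeff_ring_def lookup_add subring_set_intros)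

lemma coeff_ring_sum:
  "subring_set \<O> \<Longrightarrow> (\<And>i. i \<in> I \<Longrightarrow> f i \<in> coeff_ring \<O> L) \<Longrightarrow> sum f I \<in> coeff_ring \<O> L"
  by (induction I rule: infinite_finite_induct) (auto simp: coeff_ring_zero coeff_ring_add)

lemma subring_set_coeff_ring:
  assumes \<O>: "subring_set \<O>" and L: "0 \<in> L" "\<And>a b. a \<in> L \<Longrightarrow> b \<in> L \<Longrightarrow> a + b \<in> L"
  shows "subring_set (coeff_ring \<O> L)"
proof -
  have "1 \<in> coeff_ring \<O> L"
    using coeff_ring_single[OF \<O> subring_set_one[OF \<O>] L(1)] by simp
  moreover have "f - g \<in> coeff_ring \<O> L" if "f \<in> coeff_ring \<O> L" "g \<in> coeff_ring \<O> L" for f g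
  proof -
    have "- g \<in> coeff_ring \<O> L"
      using that(2) \<O> by (auto simp: coeff_ring_def subring_set_intros in_keys_iff)
    from coeff_ring_add[OF \<O> that(1) this] show ?thesis by simp
  qed
  moreover have "f * g \<in> coeff_ring \<O> L" if "f \<in> coeff_ring \<O> L" "g \<in> coeff_ring \<O> L" for f g
    unfolding mult_keysum using that \<O> L
    by (intro coeff_ring_sum coeff_ring_single) (auto simp: coeff_ring_def subring_set_intros intro!: L(2))
  ultimately show ?thesis
    by (auto simp: subring_set_def)
qed

section \<open>Substitutions in power series\<close>

text \<open>The substitution of \<open>\<lambda>^m\<close> for \<open>\<lambda>\<close>. In this explicit form it is visibly a ring homomorphism over
  every commutative ring.\<close>

definition stretch :: "nat \<Rightarrow> 'a::comm_ring_1 fps \<Rightarrow> 'a fps" where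
  "stretch m F = Abs_fps (\<lambda>n. if m dvd n then fps_nth F (n div m) else 0)"

lemma stretch_nth: "fps_nth (stretch m F) n = (if m dvd n then fps_nth F (n div m) else 0)"
  by (simp add: stretch_def)

lemma compose_X_power:
  assumes "m > 0"
  shows "F oo fps_X ^ m = stretch m F"
proof (rule fps_ext)
  fix n
  have "fps_nth (F oo fps_X ^ m) n = (\<Sum>i=0..n. fps_nth F i * (if n = m * i then 1 else 0))"
    by (simp add: fps_compose_nth power_mult[symmetric])
  also have "\<dots> = (if m dvd n then fps_nth F (n div m) else 0)"
  proof (cases "m dvd n")
    case True
    have "(\<Sum>i=0..n. fps_nth F i * (if n = m * i then 1 else 0)) =
        (\<Sum>i=0..n. if i = n div m then fps_nth F i else 0)"
      using True assms by (intro sum.cong) auto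
    then show ?thesis using True by simp
  qed (auto intro!: sum.neutral)
  finally show "fps_nth (F oo fps_X ^ m) n = fps_nth (stretch m F) n"
    by (simp add: stretch_nth)
qed

lemma stretch_diff: "stretch m (F - G) = stretch m F - stretch m G"
  by (rule fps_ext) (simp add: stretch_nth)

lemma stretch_add: "stretch m (F + G) = stretch m F + stretch m G"
  by (rule fps_ext) (simp add: stretch_nth)

lemma stretch_const: "stretch m (fps_const c) = fps_const c"
  by (rule fps_ext) (auto simp: stretch_nth elim!: dvdE)

lemma stretch_one: "stretch m 1 = 1"
  using stretch_const[of m 1] by simp

lemma stretch_mult:
  assumes "m > 0"
  shows "stretch m (F * G) = stretch m F * stretch m G"
proof (rule fps_ext)
  fix n
  have *: "fps_nth (stretch m F * stretch m G) n =
      (\<Sum>i\<in>{i\<in>{0..n}. m dvd i}. fps_nth F (i div m) * fps_nth (stretch m G) (n - i))"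
    unfolding fps_mult_nth
    by (rule sum.mono_neutral_cong_right) (auto simp: stretch_nth)
  show "fps_nth (stretch m (F * G)) n = fps_nth (stretch m F * stretch m G) n"
  proof (cases "m dvd n")
    case True
    then obtain k where n: "n = m * k" by blast
    have "(\<Sum>i\<in>{i\<in>{0..n}. m dvd i}. fps_nth F (i div m) * fps_nth (stretch m G) (n - i)) =
        (\<Sum>i=0..k. fps_nth F i * fps_nth G (k - i))"
      by (rule sum.reindex_bij_witness[of _ "\<lambda>i. m * i" "\<lambda>i. i div m"])
        (use assms n in \<open>auto simp: stretch_nth right_diff_distrib'[symmetric] elim!: dvdE\<close>)
    then show ?thesis
      unfolding * using assms by (simp add: stretch_nth[of m "F * G"] n fps_mult_nth)
  next
    case False
    then have "\<not> m dvd n - i" if "i \<le> n" "m dvd i" for i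
      using that by (metis dvd_diffD1 dvd_diff_nat le_add_diff_inverse2 dvd_add)
    then show ?thesis
      using False unfolding * by (auto simp: stretch_nth intro!: sum.neutral)
  qed
qed

lemma stretch_X_power: "m > 0 \<Longrightarrow> stretch m (fps_X ^ j) = fps_X ^ (m * j)"
  by (rule fps_ext) (auto simp: stretch_nth elim!: dvdE)

lemma stretch_power: "m > 0 \<Longrightarrow> stretch m (F ^ j) = stretch m F ^ j"
  by (induction j) (simp_all add: stretch_one stretch_mult)

lemma stretch_stretch:
  assumes "k > 0" "m > 0"
  shows "stretch k (stretch m F) = stretch (k * m) F"
proof (rule fps_ext)
  fix n
  have "(k dvd n \<and> m dvd n div k) = (k * m dvd n)"
    using assms by (auto simp: dvd_div_iff_mult dvd_mult_left mult.commute)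
  then show "fps_nth (stretch k (stretch m F)) n = fps_nth (stretch (k * m) F) n"
    by (auto simp: stretch_nth div_mult2_eq)
qed

definition map_coeffs :: "('a::comm_ring_1 \<Rightarrow> 'b::comm_ring_1) \<Rightarrow> 'a fps \<Rightarrow> 'b fps" where
  "map_coeffs f F = Abs_fps (\<lambda>n. f (fps_nth F n))"

lemma map_coeffs_nth: "fps_nth (map_coeffs f F) n = f (fps_nth F n)"
  by (simp add: map_coeffs_def)

definition ring_hom_fun :: "('a::comm_ring_1 \<Rightarrow> 'b::comm_ring_1) \<Rightarrow> bool" where
  "ring_hom_fun f \<longleftrightarrow> f 1 = 1 \<and> (\<forall>x y. f (x + y) = f x + f y \<and> f (x * y) = f x * f y)"

lemma
  assumes "ring_hom_fun f"
  shows ring_hom_fun_one: "f 1 = 1"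
    and ring_hom_fun_zero: "f 0 = 0"
    and ring_hom_fun_add: "f (x + y) = f x + f y"
    and ring_hom_fun_mult: "f (x * y) = f x * f y"
    and ring_hom_fun_uminus: "f (- x) = - f x"
    and ring_hom_fun_diff: "f (x - y) = f x - f y"
proof -
  show 1: "f 1 = 1" and a: "\<And>x y. f (x + y) = f x + f y" and "f (x * y) = f x * f y"
    using assms by (auto simp: ring_hom_fun_def)
  show 0: "f 0 = 0" using a[of 0 0] by simp
  show u: "f (- x) = - f x" for x using a[of x "- x"] 0 by (simp add: eq_neg_iff_add_eq_0 add.commute)
  show "f (x - y) = f x - f y" using a[of x "- y"] u by simp
qed

lemma ring_hom_fun_sum: "ring_hom_fun f \<Longrightarrow> f (sum g I) = (\<Sum>i\<in>I. f (g i))"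
  by (induction I rule: infinite_finite_induct) (auto simp: ring_hom_fun_zero ring_hom_fun_add)

lemma ring_hom_fun_prod: "ring_hom_fun f \<Longrightarrow> f (prod g I) = (\<Prod>i\<in>I. f (g i))"
  by (induction I rule: infinite_finite_induct) (auto simp: ring_hom_fun_one ring_hom_fun_mult)

lemma ring_hom_fun_power: "ring_hom_fun f \<Longrightarrow> f (x ^ n) = f x ^ n"
  by (induction n) (auto simp: ring_hom_fun_one ring_hom_fun_mult)

lemma ring_hom_fun_of_nat: "ring_hom_fun f \<Longrightarrow> f (of_nat n) = of_nat n"
  by (induction n) (auto simp: ring_hom_fun_one ring_hom_fun_zero ring_hom_fun_add)

lemma ring_hom_fun_map_coeffs:
  assumes f: "ring_hom_fun f"
  shows "ring_hom_fun (map_coeffs f)"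
  unfolding ring_hom_fun_def fps_eq_iff
  by (auto simp: map_coeffs_nth fps_mult_nth ring_hom_fun_sum[OF f] ring_hom_fun_mult[OF f]
      ring_hom_fun_add[OF f] ring_hom_fun_one[OF f] ring_hom_fun_zero[OF f])

lemma ring_hom_fun_stretch: "m > 0 \<Longrightarrow> ring_hom_fun (stretch m)"
  by (auto simp: ring_hom_fun_def stretch_one stretch_add stretch_mult)

lemma ring_hom_fun_comp: "ring_hom_fun f \<Longrightarrow> ring_hom_fun g \<Longrightarrow> ring_hom_fun (\<lambda>x. f (g x))"
  by (auto simp: ring_hom_fun_def)

lemma ring_hom_fun_single_zero: "ring_hom_fun (Poly_Mapping.single (0::'a::comm_monoid_add))"
  by (auto simp: ring_hom_fun_def single_add mult_single)

lemma ring_hom_fun_const: "ring_hom_fun fps_const"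
  by (auto simp: ring_hom_fun_def)

text \<open>The substitution \<open>x_i \<mapsto> x_i^p\<close> in Laurent polynomials with fractional exponents, and the
  substitution \<open>x_i \<mapsto> x_i^p\<close>, \<open>\<lambda> \<mapsto> \<lambda>^p\<close> in series over them. Constants are fixed.\<close>

definition scale_exponents :: "nat \<Rightarrow> 'n::finite xlaurent \<Rightarrow> 'n xlaurent" where
  "scale_exponents p = keysum (\<lambda>a. Poly_Mapping.single (of_nat p *s a))"

definition frob_subst :: "nat \<Rightarrow> 'n::finite xlaurent fps \<Rightarrow> 'n xlaurent fps" where
  "frob_subst p F = stretch p (map_coeffs (scale_exponents p) F)"

lemma scale_exponents_single:
  "scale_exponents p (Poly_Mapping.single a c) = Poly_Mapping.single (of_nat p *s a) c"
  unfolding scale_exponents_def by (simp add: keysum_single)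

lemma coefficient_additive_single: "coefficient_additive (\<lambda>a. Poly_Mapping.single (f a))"
  by (simp add: coefficient_additive_def single_add)

lemma ring_hom_fun_scale_exponents: "ring_hom_fun (scale_exponents p)"
proof -
  have "scale_exponents p (f * g) = scale_exponents p f * scale_exponents p g" for f g :: "'n::finite xlaurent"
    unfolding scale_exponents_def
    by (rule keysum_mult[OF coefficient_additive_single]) (simp add: mult_single vector_add_ldistrib)
  moreover have "scale_exponents p 1 = (1 :: 'n::finite xlaurent)"
    using scale_exponents_single[of p "0 :: rat ^ 'n" 1] vector_smult_rzero[of "of_nat p :: rat"] by simp
  ultimately show ?thesis
    by (auto simp: ring_hom_fun_def keysum_add coefficient_additive_single scale_exponents_def)
qed

lemma ring_hom_fun_frob_subst:
  assumes "p > 0"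
  shows "ring_hom_fun (frob_subst p)"
  using ring_hom_fun_comp[OF ring_hom_fun_stretch[OF assms]
      ring_hom_fun_map_coeffs[OF ring_hom_fun_scale_exponents]]
  by (simp add: frob_subst_def[abs_def])

lemma frob_subst_const: "frob_subst p (fps_const f) = fps_const (scale_exponents p f)"
proof -
  have "map_coeffs (scale_exponents p) (fps_const f) = fps_const (scale_exponents p f)"
    by (rule fps_ext) (simp add: map_coeffs_nth ring_hom_fun_zero[OF ring_hom_fun_scale_exponents])
  then show ?thesis by (simp add: frob_subst_def stretch_const)
qed

lemma frob_subst_xpow: "frob_subst p (xpow i r) = xpow i (of_nat p * r)"
proof -
  have "(of_nat p :: rat) *s axis i r = axis i (of_nat p * r)"
    by (simp add: vec_eq_iff axis_def)
  then show ?thesis by (simp add: xpow_def frob_subst_const scale_exponents_single)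
qed

lemma frob_subst_scalar: "frob_subst p (scalar z) = scalar z"
proof -
  have "(of_nat p :: rat) *s (0 :: rat ^ 'n) = 0"
    by (simp add: vec_eq_iff)
  then show ?thesis by (simp add: scalar_def frob_subst_const scale_exponents_single)
qed

lemma frob_subst_X_power:
  assumes "p > 0" shows "frob_subst p (fps_X ^ k :: 'n::finite xlaurent fps) = fps_X ^ (p * k)"
proof -
  have "map_coeffs (scale_exponents p) (fps_X ^ k) = (fps_X ^ k :: 'n xlaurent fps)"
    by (rule fps_ext) (simp add: map_coeffs_nth ring_hom_fun_zero[OF ring_hom_fun_scale_exponents]
        ring_hom_fun_one[OF ring_hom_fun_scale_exponents])
  then show ?thesis using assms by (simp add: frob_subst_def stretch_X_power)
qed

section \<open>The rings \<open>R_m\<close> as rings of fractions\<close>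

text \<open>The exponents of \<open>x\<close> that occur in \<open>R_m\<close>.\<close>

definition fraction_lattice :: "nat \<Rightarrow> (rat ^ 'n::finite) set" where
  "fraction_lattice m = {a. \<forall>i. of_nat m * a $ i \<in> \<int>}"

text \<open>Exponents are arbitrary here: the purpose of this ring is to detect divisibility by integers.\<close>

definition integral_series :: "complex set \<Rightarrow> 'n::finite xlaurent fps set" where
  "integral_series \<O> = {F. \<forall>n. fps_nth F n \<in> coeff_ring \<O> UNIV}"

definition laurent_polys :: "complex set \<Rightarrow> nat \<Rightarrow> 'n::finite xlaurent fps set" where
  "laurent_polys \<O> m =
     {P. (\<forall>n. fps_nth P n \<in> coeff_ring \<O> (fraction_lattice m)) \<and> (\<exists>d. \<forall>n\<ge>d. fps_nth P n = 0)}"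

lemma subring_set_Ints: "subring_set (\<int> :: complex set)"
  by (auto simp: subring_set_def)

lemma subring_set_lattice: "subring_set \<O> \<Longrightarrow> subring_set (coeff_ring \<O> (fraction_lattice m))"
  by (rule subring_set_coeff_ring) (auto simp: fraction_lattice_def distrib_left)

lemma subring_set_coeff_UNIV: "subring_set \<O> \<Longrightarrow> subring_set (coeff_ring \<O> UNIV)"
  by (rule subring_set_coeff_ring) auto

lemma subring_set_series: "subring_set T \<Longrightarrow> subring_set {F. \<forall>n. fps_nth F n \<in> T}"
  by (auto simp: subring_set_def[of "{F. \<forall>n. fps_nth F n \<in> T}"] fps_mult_nth subring_set_intros)

lemma subring_set_integral_series: "subring_set \<O> \<Longrightarrow> subring_set (integral_series \<O>)"
  unfolding integral_series_def by (intro subring_set_series subring_set_coeff_UNIV)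

lemma subring_set_laurent_polys:
  assumes "subring_set \<O>"
  shows "subring_set (laurent_polys \<O> m :: 'n::finite xlaurent fps set)"
proof -
  let ?T = "{F. \<forall>n. fps_nth F n \<in> coeff_ring \<O> (fraction_lattice m)} :: 'n xlaurent fps set"
  have T: "subring_set ?T"
    by (rule subring_set_series[OF subring_set_lattice[OF assms]])
  have "\<exists>d. \<forall>n\<ge>d. fps_nth (1 :: 'n xlaurent fps) n = 0"
    by (intro exI[of _ 1]) auto
  moreover have "\<exists>d. \<forall>n\<ge>d. fps_nth (P - Q) n = 0"
    if "\<forall>n\<ge>d. fps_nth P n = 0" "\<forall>n\<ge>e. fps_nth Q n = 0" for P Q :: "'n xlaurent fps" and d e
    using that by (intro exI[of _ "max d e"]) auto
  moreover have "\<exists>d. \<forall>n\<ge>d. fps_nth (P * Q) n = 0"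
    if "\<forall>n\<ge>d. fps_nth P n = 0" "\<forall>n\<ge>e. fps_nth Q n = 0" for P Q :: "'n xlaurent fps" and d e
  proof (intro exI[of _ "d + e"] allI impI)
    fix n assume "d + e \<le> n"
    then have "i \<ge> d \<or> n - i \<ge> e" if "i \<le> n" for i using that by linarith
    then show "fps_nth (P * Q) n = 0"
      using that unfolding fps_mult_nth by (intro sum.neutral) fastforce
  qed
  ultimately show ?thesis
    using T unfolding subring_set_def laurent_polys_def by blast
qed

lemma laurent_polys_integral: "laurent_polys \<O> m \<subseteq> integral_series \<O>"
  by (auto simp: laurent_polys_def integral_series_def coeff_ring_def)

lemma const_in_laurent_polys:
  "subring_set \<O> \<Longrightarrow> f \<in> coeff_ring \<O> (fraction_lattice m) \<Longrightarrow> fps_const f \<in> laurent_polys \<O> m"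
  by (auto simp: laurent_polys_def coeff_ring_zero intro!: exI[of _ 1])

lemma X_in_laurent_polys:
  assumes "subring_set \<O>"
  shows "fps_X \<in> laurent_polys \<O> m"
proof -
  have "1 \<in> coeff_ring \<O> (fraction_lattice m)"
    using subring_set_lattice[OF assms] by (rule subring_set_one)
  then show ?thesis
    using assms by (auto simp: laurent_polys_def coeff_ring_zero fps_X_def intro!: exI[of _ 2])
qed

lemma ring_hom_fun_scalar: "ring_hom_fun (scalar :: complex \<Rightarrow> 'n::finite xlaurent fps)"
  using ring_hom_fun_comp[OF ring_hom_fun_const ring_hom_fun_single_zero]
  by (simp add: scalar_def[abs_def])

lemma xpow_mult:
  fixes i :: "'n::finite"
  shows "xpow i r * xpow i s = xpow i (r + s)"
proof -
  have "axis i r + axis i s = (axis i (r + s) :: rat ^ 'n)"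
    by (simp add: vec_eq_iff axis_def)
  then show ?thesis by (simp add: xpow_def mult_single)
qed

lemma xpow_zero:
  fixes i :: "'n::finite"
  shows "xpow i 0 = 1"
proof -
  have *: "axis i 0 = (0 :: rat ^ 'n)" by (simp add: vec_eq_iff axis_def)
  show ?thesis unfolding xpow_def * by simp
qed

lemma xpow_power: "xpow i r ^ k = xpow i (of_nat k * r)"
  by (induction k) (simp_all add: xpow_zero xpow_mult distrib_right)

text \<open>A negative power of \<open>x^(1/m)\<close> is a positive one times a power of \<open>x^(-1)\<close>.\<close>

lemma xpow_in_subring:
  assumes T: "subring_set T" and m: "m > 0"
    and mem: "xpow i (1 / of_nat m) \<in> T" "xpow i (- 1) \<in> T" and r: "of_nat m * r \<in> \<int>"
  shows "xpow i r \<in> T"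
proof -
  obtain z where z: "of_nat m * r = of_int z" using r by (auto elim: Ints_cases)
  define a where "a = nat (z + int m * \<bar>z\<bar>)"
  have "z + int m * \<bar>z\<bar> \<ge> 0"
  proof -
    have "\<bar>z\<bar> * 1 \<le> \<bar>z\<bar> * int m" using m by (intro mult_left_mono) auto
    then show ?thesis by (simp add: mult.commute)
  qed
  then have "int a = z + int m * \<bar>z\<bar>" by (simp add: a_def)
  then have "rat_of_int (int a) = of_int z + of_nat m * of_nat (nat \<bar>z\<bar>)"
    by simp
  then have a: "of_nat a = of_nat m * r + (of_nat m * of_nat (nat \<bar>z\<bar>) :: rat)"
    by (simp add: z)
  have "(of_nat m * r + of_nat m * y) * (1 / of_nat m) + y * (- 1) = r" for y :: rat
    using m by (simp add: field_simps)
  then have "of_nat a * (1 / of_nat m) + of_nat (nat \<bar>z\<bar>) * (- 1) = r"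
    unfolding a by blast
  then have "xpow i r = xpow i (1 / of_nat m) ^ a * xpow i (- 1) ^ nat \<bar>z\<bar>"
    by (simp only: xpow_power xpow_mult)
  then show ?thesis
    using T mem by (simp add: subring_set_intros)
qed

lemma const_single_eq:
  "fps_const (Poly_Mapping.single a c) = scalar c * (\<Prod>i\<in>UNIV. xpow i (a $ i))"
proof -
  have "(\<Prod>i\<in>I. xpow i (a $ i)) = fps_const (Poly_Mapping.single (\<Sum>i\<in>I. axis i (a $ i)) 1)"
    if "finite I" for I
    using that by induction (simp_all add: xpow_def mult_single)
  from this[of UNIV] have "(\<Prod>i\<in>UNIV. xpow i (a $ i)) =
      fps_const (Poly_Mapping.single (\<Sum>i\<in>UNIV. axis i (a $ i)) 1)" by simp
  moreover have "(\<Sum>i\<in>UNIV. axis i (a $ i)) = a"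
    by (simp add: vec_eq_iff axis_def)
  ultimately show ?thesis by (simp add: scalar_def mult_single)
qed

lemma laurent_polys_subset:
  fixes T :: "'n::finite xlaurent fps set"
  assumes T: "subring_set T" and scalar: "\<And>c. c \<in> \<O> \<Longrightarrow> scalar c \<in> T"
    and x: "\<And>i r. of_nat m * r \<in> \<int> \<Longrightarrow> xpow i r \<in> T" and X: "fps_X \<in> T"
  shows "laurent_polys \<O> m \<subseteq> T"
proof
  fix P :: "'n xlaurent fps" assume P: "P \<in> laurent_polys \<O> m"
  then obtain d where d: "\<And>n. n \<ge> d \<Longrightarrow> fps_nth P n = 0" by (auto simp: laurent_polys_def)
  have "fps_const f \<in> T" if f: "f \<in> coeff_ring \<O> (fraction_lattice m)" for f
  proof -
    have "fps_const f = (\<Sum>a\<in>Poly_Mapping.keys f.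
        fps_const (Poly_Mapping.single a (Poly_Mapping.lookup f a)))"
      by (subst keysum_single_self[symmetric])
        (simp add: keysum_def ring_hom_fun_sum[OF ring_hom_fun_const])
    also have "\<dots> \<in> T"
      unfolding const_single_eq using f
      by (intro subring_set_sum[OF T] subring_set_mult[OF T] subring_set_prod[OF T] scalar x)
        (auto simp: coeff_ring_def fraction_lattice_def)
    finally show ?thesis .
  qed
  then have "fps_const (fps_nth P n) \<in> T" for n
    using P by (auto simp: laurent_polys_def)
  moreover have "P = (\<Sum>n<d. fps_const (fps_nth P n) * fps_X ^ n)"
  proof (rule fps_ext)
    fix k
    have "fps_nth (\<Sum>n<d. fps_const (fps_nth P n) * fps_X ^ n) k =
        (\<Sum>n<d. if n = k then fps_nth P n else 0)"
      unfolding fps_sum_nth by (intro sum.cong) auto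
    then show "fps_nth P k = fps_nth (\<Sum>n<d. fps_const (fps_nth P n) * fps_X ^ n) k"
      using d[of k] by auto
  qed
  ultimately show "P \<in> T"
    using T X by (metis (no_types, lifting) subring_set_sum subring_set_mult subring_set_power)
qed

lemma xpow_in_laurent_polys:
  assumes "subring_set \<O>" "of_nat m * r \<in> \<int>"
  shows "xpow i r \<in> laurent_polys \<O> m"
  unfolding xpow_def using assms
  by (intro const_in_laurent_polys coeff_ring_single) (auto simp: fraction_lattice_def axis_def subring_set_intros)

lemma scalar_in_laurent_polys:
  assumes "subring_set \<O>" "c \<in> \<O>"
  shows "scalar c \<in> laurent_polys \<O> m"
  unfolding scalar_def using assms
  by (intro const_in_laurent_polys coeff_ring_single) (auto simp: fraction_lattice_def)

text \<open>Explicit descriptions by coefficients replace the descriptions by generators, first for \<open>A\<close> and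
  then, up to denominators, for \<open>R_m\<close>.\<close>

lemma base_ring_eq: "(base_ring :: 'n::finite xlaurent fps set) = laurent_polys \<int> 1"
proof
  show "(base_ring :: 'n xlaurent fps set) \<subseteq> laurent_polys \<int> 1"
    unfolding base_ring_def
    by (intro generated_subset subring_set_laurent_polys subring_set_Ints)
      (auto intro!: xpow_in_laurent_polys X_in_laurent_polys subring_set_Ints)
  have T: "subring_set (base_ring :: 'n xlaurent fps set)" unfolding base_ring_def by (rule subring_set_generated)
  have gens: "xpow i 1 \<in> base_ring" "xpow i (- 1) \<in> base_ring"
    "fps_X \<in> (base_ring :: 'n xlaurent fps set)" for i :: 'n
    unfolding base_ring_def by (auto intro: generated_incl)
  show "laurent_polys \<int> 1 \<subseteq> (base_ring :: 'n xlaurent fps set)"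
  proof (rule laurent_polys_subset[OF T])
    fix c :: complex assume "c \<in> \<int>"
    then obtain z where "c = of_int z" by (auto elim: Ints_cases)
    moreover have "scalar (of_int z) = (of_int z :: 'n xlaurent fps)"
      by (simp add: scalar_def fps_of_int)
    ultimately show "scalar c \<in> (base_ring :: 'n xlaurent fps set)"
      using subring_set_of_int[OF T, of z] by simp
  next
    fix i :: 'n and r :: rat assume "of_nat 1 * r \<in> \<int>"
    then show "xpow i r \<in> base_ring"
      using xpow_in_subring[OF T, of 1 i r] gens by simp
  qed (rule gens(3))
qed

lemma stretch_laurent_polys:
  assumes P: "P \<in> laurent_polys \<O> k" and \<O>: "\<O> \<subseteq> \<O>'" "subring_set \<O>'"
    and k: "k dvd l" and m: "m > 0"
  shows "stretch m P \<in> laurent_polys \<O>' l"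
proof -
  obtain d where d: "\<And>n. n \<ge> d \<Longrightarrow> fps_nth P n = 0" using P by (auto simp: laurent_polys_def)
  obtain j where j: "l = k * j" using k by blast
  have "(of_nat l * r :: rat) \<in> \<int>" if "of_nat k * r \<in> \<int>" for r :: rat
  proof -
    have "of_nat l * r = of_nat j * (of_nat k * r)" by (simp add: j)
    also have "\<dots> \<in> \<int>" by (intro Ints_mult that) auto
    finally show ?thesis .
  qed
  then have "fraction_lattice k \<subseteq> (fraction_lattice l :: (rat ^ 'a) set)"
    by (auto simp: fraction_lattice_def)
  then have "fps_nth P n \<in> coeff_ring \<O>' (fraction_lattice l)" for n
    using P \<O> by (fastforce simp: laurent_polys_def coeff_ring_def)
  then have "fps_nth (stretch m P) n \<in> coeff_ring \<O>' (fraction_lattice l)" for n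
    using coeff_ring_zero[OF \<O>(2)] by (auto simp: stretch_nth)
  moreover have "fps_nth (stretch m P) n = 0" if "n \<ge> m * d" for n
  proof -
    have "n div m \<ge> d" using that m by (simp add: less_eq_div_iff_mult_less_eq mult.commute)
    then show ?thesis using d by (simp add: stretch_nth)
  qed
  ultimately show ?thesis
    unfolding laurent_polys_def by blast
qed

locale habiro_setting =
  fixes \<zeta> :: "nat \<Rightarrow> complex" and h :: "'n::finite xlaurent"
  assumes roots: "compatible_roots \<zeta>"
    and h: "h \<in> coeff_ring \<int> (fraction_lattice 1)"
begin

abbreviation cyclotomic :: "nat \<Rightarrow> complex set" where
  "cyclotomic m \<equiv> generated {\<zeta> m}"

lemma subring_cyclotomic: "subring_set (cyclotomic m)"
  by (rule subring_set_generated)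

lemma Ints_subset_cyclotomic: "\<int> \<subseteq> cyclotomic m"
  by (auto elim!: Ints_cases intro: subring_set_of_int subring_cyclotomic)

text \<open>The function \<open>1 - \<lambda>h\<close> at level \<open>m\<close>, where \<open>\<lambda>\<close> is the m-th power of the formal variable. Its
  inverse is a geometric series.\<close>

definition denominator :: "nat \<Rightarrow> 'n xlaurent fps" where
  "denominator m = 1 - fps_X ^ m * fps_const h"

definition denominator_inverse :: "nat \<Rightarrow> 'n xlaurent fps" where
  "denominator_inverse m = stretch m (Abs_fps (\<lambda>n. h ^ n))"

definition level_one :: "'n xlaurent fps set" where
  "level_one = localisation base_ring (denominator 1)"

abbreviation level :: "nat \<Rightarrow> 'n xlaurent fps set" where
  "level m \<equiv> root_ring \<zeta> level_one m"

lemma stretch_denominator: "m > 0 \<Longrightarrow> stretch m (denominator k) = denominator (m * k)"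
  by (simp add: denominator_def stretch_diff stretch_one stretch_mult stretch_X_power stretch_const)

lemma denominator_mult_inverse:
  assumes "m > 0" shows "denominator m * denominator_inverse m = 1"
proof -
  have "denominator 1 * Abs_fps (\<lambda>n. h ^ n) = 1"
  proof (rule fps_ext)
    fix n
    show "fps_nth (denominator 1 * Abs_fps (\<lambda>n. h ^ n)) n = fps_nth 1 n"
      by (cases n) (simp_all add: denominator_def left_diff_distrib mult.assoc)
  qed
  from arg_cong[OF this, of "stretch m"] assms show ?thesis
    using stretch_denominator[of m 1]
    by (simp add: denominator_inverse_def stretch_mult stretch_one)
qed

lemma denominator_cancel:
  "m > 0 \<Longrightarrow> denominator_inverse m ^ k * (denominator m ^ k * F) = F"
  using denominator_mult_inverse[of m]
  by (simp add: mult.assoc[symmetric] power_mult_distrib[symmetric] mult.commute[of "denominator_inverse m"])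

lemma denominator_in_laurent_polys:
  assumes "subring_set \<O>" "\<int> \<subseteq> \<O>" "m > 0"
  shows "denominator m \<in> laurent_polys \<O> m"
proof -
  have "denominator 1 \<in> laurent_polys \<int> 1"
    unfolding denominator_def using h
    by (intro subring_set_intros subring_set_laurent_polys X_in_laurent_polys const_in_laurent_polys
        subring_set_Ints)
  from stretch_laurent_polys[OF this assms(2,1) one_dvd assms(3)] show ?thesis
    using stretch_denominator[of m 1] assms(3) by simp
qed

lemma denominator_inverse_integral:
  assumes "subring_set \<O>" "\<int> \<subseteq> \<O>"
  shows "denominator_inverse m \<in> integral_series \<O>"
proof -
  have "h ^ n \<in> coeff_ring \<O> UNIV" for n
    by (rule subring_set_power[OF subring_set_coeff_UNIV[OF assms(1)]])
      (use h assms in \<open>auto simp: coeff_ring_def\<close>)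
  then show ?thesis
    using coeff_ring_zero[OF assms(1)]
    by (auto simp: integral_series_def denominator_inverse_def stretch_nth)
qed

lemma subring_level: "subring_set (level m)"
  unfolding root_ring_def by (rule subring_set_generated)

lemma laurent_polys_subset_level:
  assumes "m > 0" shows "laurent_polys (cyclotomic m) m \<subseteq> level m"
proof (rule laurent_polys_subset[OF subring_level])
  show X: "fps_X \<in> level m"
    unfolding root_ring_def by (auto intro: generated_incl)
  have "xpow i (- 1) \<in> level_one" for i
    unfolding level_one_def localisation_def base_ring_def by (auto intro!: exI[of _ 0] generated_incl)
  then have "xpow i (- 1) oo fps_X ^ m \<in> level m" for i
    unfolding root_ring_def by (auto intro: generated_incl)
  then have neg: "xpow i (- 1) \<in> level m" for i
    by (simp add: xpow_def)
  have pos: "xpow i (1 / of_nat m) \<in> level m" for i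
    unfolding root_ring_def by (auto intro: generated_incl)
  show "xpow i r \<in> level m" if "of_nat m * r \<in> \<int>" for i r
    by (rule xpow_in_subring[OF subring_level assms pos neg that])
  have "cyclotomic m \<subseteq> {c. scalar c \<in> level m}"
  proof (rule generated_subset)
    show "subring_set {c. scalar c \<in> level m}"
      using subring_level[of m]
      by (auto simp: subring_set_def ring_hom_fun_one[OF ring_hom_fun_scalar]
          ring_hom_fun_diff[OF ring_hom_fun_scalar] ring_hom_fun_mult[OF ring_hom_fun_scalar])
    show "{\<zeta> m} \<subseteq> {c. scalar c \<in> level m}"
      unfolding root_ring_def by (auto intro: generated_incl)
  qed
  then show "c \<in> cyclotomic m \<Longrightarrow> scalar c \<in> level m" for c by auto
qed

lemma denominator_inverse_in_level:
  assumes "m > 0" shows "denominator_inverse m \<in> level m"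
proof -
  have "denominator_inverse 1 \<in> level_one"
    unfolding level_one_def localisation_def base_ring_eq using denominator_mult_inverse[of 1]
    by (auto intro!: exI[of _ 1] simp: subring_set_one subring_set_laurent_polys subring_set_Ints)
  then have "denominator_inverse 1 oo fps_X ^ m \<in> level m"
    unfolding root_ring_def by (auto intro: generated_incl)
  moreover have "denominator_inverse 1 oo fps_X ^ m = denominator_inverse m"
    using assms by (simp add: compose_X_power denominator_inverse_def stretch_stretch)
  ultimately show ?thesis by simp
qed

text \<open>The fractions with denominator a power of \<open>1 - \<lambda>h\<close> form a ring that contains the generators of
  \<open>R_m\<close>. Conversely, \<open>R_m\<close> contains the Laurent polynomials, and \<open>R\<close> contributes the inverse of
  \<open>1 - \<lambda>h\<close>.\<close>

lemma level_iff:
  assumes m: "m > 0"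
  shows "F \<in> level m \<longleftrightarrow> (\<exists>k. denominator m ^ k * F \<in> laurent_polys (cyclotomic m) m)"
proof
  let ?L = "laurent_polys (cyclotomic m) m :: 'n xlaurent fps set"
  let ?T = "{F. \<exists>k. denominator m ^ k * F \<in> ?L}"
  have L: "subring_set ?L"
    by (rule subring_set_laurent_polys[OF subring_cyclotomic])
  have d: "denominator m \<in> ?L"
    by (rule denominator_in_laurent_polys[OF subring_cyclotomic Ints_subset_cyclotomic m])
  have "subring_set ?T"
    unfolding subring_set_def
  proof (intro conjI ballI)
    show "1 \<in> ?T" using subring_set_one[OF L] by (auto intro!: exI[of _ 0])
    fix F G assume "F \<in> ?T" "G \<in> ?T"
    then obtain k l where F: "denominator m ^ k * F \<in> ?L" and G: "denominator m ^ l * G \<in> ?L"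
      by auto
    have "denominator m ^ l * (denominator m ^ k * F) - denominator m ^ k * (denominator m ^ l * G) \<in> ?L"
      by (intro subring_set_diff[OF L] subring_set_mult[OF L _ G] subring_set_mult[OF L _ F]
          subring_set_power[OF L d])
    then have "denominator m ^ (k + l) * (F - G) \<in> ?L"
      by (simp add: power_add algebra_simps)
    then show "F - G \<in> ?T" by blast
    have "(denominator m ^ k * F) * (denominator m ^ l * G) \<in> ?L"
      using F G by (rule subring_set_mult[OF L])
    then have "denominator m ^ (k + l) * (F * G) \<in> ?L"
      by (simp add: power_add mult_ac)
    then show "F * G \<in> ?T" by blast
  qed
  moreover have "F oo fps_X ^ m \<in> ?T" if F: "F \<in> level_one" for F
  proof -
    obtain k where "denominator 1 ^ k * F \<in> laurent_polys \<int> 1"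
      using F unfolding level_one_def localisation_def base_ring_eq by blast
    from stretch_laurent_polys[OF this Ints_subset_cyclotomic subring_cyclotomic one_dvd m]
    have "denominator m ^ k * (F oo fps_X ^ m) \<in> ?L"
      using m stretch_denominator[of m 1] by (simp add: stretch_mult stretch_power compose_X_power)
    then show ?thesis by blast
  qed
  moreover have "?L \<subseteq> ?T" by (auto intro!: exI[of _ 0])
  moreover have "xpow i (1 / of_nat m) \<in> ?L" "fps_X \<in> ?L" "scalar (\<zeta> m) \<in> ?L" for i
    using m by (auto intro!: xpow_in_laurent_polys X_in_laurent_polys scalar_in_laurent_polys
        subring_cyclotomic generated_incl)
  ultimately have "level m \<subseteq> ?T"
    unfolding root_ring_def by (intro generated_subset) auto
  then show "F \<in> level m \<Longrightarrow> \<exists>k. denominator m ^ k * F \<in> ?L" by auto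
next
  assume "\<exists>k. denominator m ^ k * F \<in> laurent_polys (cyclotomic m) m"
  then obtain k where "denominator m ^ k * F \<in> level m"
    using laurent_polys_subset_level[OF m] by auto
  then have "denominator_inverse m ^ k * (denominator m ^ k * F) \<in> level m"
    by (rule subring_set_mult[OF subring_level
          subring_set_power[OF subring_level denominator_inverse_in_level[OF m]]])
  then show "F \<in> level m" by (simp add: denominator_cancel[OF m])
qed

lemma level_integral:
  assumes m: "m > 0" and F: "F \<in> level m"
  shows "F \<in> integral_series (cyclotomic m)"
proof -
  obtain k where "denominator m ^ k * F \<in> laurent_polys (cyclotomic m) m"
    using iffD1[OF level_iff[OF m] F] ..
  then have "denominator m ^ k * F \<in> integral_series (cyclotomic m)"
    by (rule subsetD[OF laurent_polys_integral])
  then have "denominator_inverse m ^ k * (denominator m ^ k * F) \<in> integral_series (cyclotomic m)"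
    by (rule subring_set_mult[rotated -1])
      (intro subring_set_power subring_set_integral_series
        denominator_inverse_integral subring_cyclotomic Ints_subset_cyclotomic)+
  then show ?thesis by (simp add: denominator_cancel[OF m])
qed

text \<open>After clearing denominators this is a statement about Laurent polynomials: dividing the
  coefficients by \<open>c\<close> does not change the set of monomials.\<close>

lemma level_pure:
  assumes m: "m > 0" and c: "c > 0" and s: "s \<in> integral_series (cyclotomic m)"
    and F: "of_nat c * s \<in> level m"
  shows "s \<in> level m"
proof -
  obtain k where k: "denominator m ^ k * (of_nat c * s) \<in> laurent_polys (cyclotomic m) m"
    using iffD1[OF level_iff[OF m] F] ..
  define P where "P = denominator m ^ k * s"
  have P: "P \<in> integral_series (cyclotomic m)"
    unfolding P_def using denominator_in_laurent_polys[OF subring_cyclotomic Ints_subset_cyclotomic m]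
      laurent_polys_integral[of "cyclotomic m" m] s
    by (intro subring_set_mult subring_set_power subring_set_integral_series subring_cyclotomic) auto
  have cP: "of_nat c * P \<in> laurent_polys (cyclotomic m) m"
    using k by (simp add: P_def mult_ac)
  have nth: "fps_nth (of_nat c * P) n = Poly_Mapping.single 0 (of_nat c) * fps_nth P n" for n
    by (simp add: fps_of_nat[symmetric])
  have lookup: "Poly_Mapping.lookup (fps_nth (of_nat c * P) n) a =
      of_nat c * Poly_Mapping.lookup (fps_nth P n) a" for n a
    unfolding nth mult_map_scale_conv_mult[symmetric]
    by (simp add: map.rep_eq when_def del: single_of_nat)
  have keys: "Poly_Mapping.keys (fps_nth (of_nat c * P) n) = Poly_Mapping.keys (fps_nth P n)" for n
    unfolding set_eq_iff in_keys_iff lookup using c by simp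
  have "fps_nth (of_nat c * P) n = 0 \<longleftrightarrow> fps_nth P n = 0" for n
    using keys[of n] by (metis keys_eq_empty)
  then have "P \<in> laurent_polys (cyclotomic m) m"
    using cP P keys by (auto simp: laurent_polys_def integral_series_def coeff_ring_def)
  then show ?thesis
    unfolding P_def level_iff[OF m] by blast
qed

lemma cong_in_level:
  assumes m: "m > 0" and c: "c > 0" and F: "F \<in> level m" and G: "G \<in> level m"
    and cong: "cong_in (integral_series (cyclotomic m)) (of_nat c) F G"
  shows "cong_in (level m) (of_nat c) F G"
proof -
  obtain s where s: "s \<in> integral_series (cyclotomic m)" "F - G = of_nat c * s"
    using cong by (auto simp: cong_in_def)
  have "of_nat c * s \<in> level m"
    using subring_set_diff[OF subring_level F G] s(2) by simp
  then have "s \<in> level m" by (rule level_pure[OF m c s(1)])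
  then show ?thesis using s(2) by (auto simp: cong_in_def)
qed

end

section \<open>Maps on p-adic completions\<close>

definition residue_class :: "'a::comm_ring_1 set \<Rightarrow> 'a \<Rightarrow> 'a \<Rightarrow> 'a set" where
  "residue_class S c a = {b. cong_in S c b a}"

lemma residue_class_self: "subring_set S \<Longrightarrow> a \<in> residue_class S c a"
  by (simp add: residue_class_def cong_in_refl)

lemma residue_class_eq_iff:
  assumes "subring_set S"
  shows "residue_class S c a = residue_class S c b \<longleftrightarrow> cong_in S c a b"
proof
  assume "residue_class S c a = residue_class S c b"
  then show "cong_in S c a b"
    using residue_class_self[OF assms, of a c] by (simp add: residue_class_def)
next
  assume ab: "cong_in S c a b"
  show "residue_class S c a = residue_class S c b"
    unfolding residue_class_def
    using cong_in_trans[OF assms _ ab] cong_in_trans[OF assms _ cong_in_sym[OF assms ab]] by blast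
qed

lemma residue_class_subset:
  assumes "subring_set S" "c \<in> S" "a \<in> S"
  shows "residue_class S c a \<subseteq> S"
proof
  fix b assume "b \<in> residue_class S c a"
  then obtain s where "s \<in> S" "b - a = c * s" by (auto simp: residue_class_def cong_in_def)
  then have "b = c * s + a" by (simp add: algebra_simps)
  then show "b \<in> S" using assms \<open>s \<in> S\<close> by (simp add: subring_set_intros)
qed

lemma prime_power_ideal_eq:
  assumes "subring_set S"
  shows "prime_power_ideal (subring_on S) p N = {of_nat p ^ N * s | s. s \<in> S}"
proof -
  interpret cring "subring_on S" by (rule cring_subring_on[OF assms])
  have "[k] \<cdot>\<^bsub>subring_on S\<^esub> \<one>\<^bsub>subring_on S\<^esub> = of_nat k" for k :: nat
  proof (induction k)
    case 0
    show ?case using add.nat_pow_0 by (simp add: subring_on_def full_ring_def)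
  next
    case (Suc k)
    then show ?case using add.nat_pow_Suc by (simp add: subring_on_def full_ring_def add.commute)
  qed
  then show ?thesis
    unfolding prime_power_ideal_def cgenideal_def
    by (auto simp: subring_on_def full_ring_def mult.commute)
qed

lemma to_completion_eq:
  assumes "subring_set S"
  shows "to_completion (subring_on S) p a = (\<lambda>N. residue_class S (of_nat p ^ N) a)"
proof
  fix N
  have "b - a = d \<longleftrightarrow> b = d + a" for b d :: 'a by (auto simp: algebra_simps)
  then show "to_completion (subring_on S) p a N = residue_class S (of_nat p ^ N) a"
    unfolding to_completion_def prime_power_ideal_eq[OF assms]
    by (auto simp: a_r_coset_def' residue_class_def cong_in_def subring_on_def full_ring_def)
qed

lemma carrier_completion:
  assumes "subring_set S"
  shows "carrier (padic_completion (subring_on S) p) =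
    {c. \<forall>N. (\<exists>a\<in>S. c N = residue_class S (of_nat p ^ N) a) \<and> c (Suc N) \<subseteq> c N}"
proof -
  have "carrier (subring_on S Quot prime_power_ideal (subring_on S) p N) =
      residue_class S (of_nat p ^ N) ` S" for N
    using to_completion_eq[OF assms, of p, THEN fun_cong, of _ N]
    by (auto simp: FactRing_def A_RCOSETS_def' to_completion_def subring_on_def full_ring_def)
  then show ?thesis
    by (auto simp: padic_completion_def image_iff)
qed

lemma ideal_prime_power_ideal:
  assumes "subring_set S"
  shows "ideal (prime_power_ideal (subring_on S) p N) (subring_on S)"
proof -
  interpret cring "subring_on S" by (rule cring_subring_on[OF assms])
  show ?thesis
    unfolding prime_power_ideal_def by (intro cgenideal_ideal add.nat_pow_closed one_closed)
qed

lemma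
  assumes S: "subring_set S" and a: "a \<in> S" "b \<in> S"
    and c: "c N = residue_class S (of_nat p ^ N) a" and d: "d N = residue_class S (of_nat p ^ N) b"
  shows completion_mult: "(c \<otimes>\<^bsub>padic_completion (subring_on S) p\<^esub> d) N = residue_class S (of_nat p ^ N) (a * b)"
    and completion_add: "(c \<oplus>\<^bsub>padic_completion (subring_on S) p\<^esub> d) N = residue_class S (of_nat p ^ N) (a + b)"
proof -
  interpret ideal "prime_power_ideal (subring_on S) p N" "subring_on S"
    by (rule ideal_prime_power_ideal[OF S])
  have eq: "residue_class S (of_nat p ^ N) x = prime_power_ideal (subring_on S) p N +>\<^bsub>subring_on S\<^esub> x" for x
    using to_completion_eq[OF S, of p x, THEN fun_cong, of N] by (simp add: to_completion_def)
  have carr: "a \<in> carrier (subring_on S)" "b \<in> carrier (subring_on S)"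
    using a by (auto simp: subring_on_def)
  have ops: "a \<otimes>\<^bsub>subring_on S\<^esub> b = a * b" "a \<oplus>\<^bsub>subring_on S\<^esub> b = a + b"
    by (simp_all add: subring_on_def full_ring_def)
  show "(c \<otimes>\<^bsub>padic_completion (subring_on S) p\<^esub> d) N = residue_class S (of_nat p ^ N) (a * b)"
    using rcoset_mult_add[OF carr] by (simp add: padic_completion_def FactRing_def c d eq ops)
  show "(c \<oplus>\<^bsub>padic_completion (subring_on S) p\<^esub> d) N = residue_class S (of_nat p ^ N) (a + b)"
    using a_rcos_sum[OF carr] by (simp add: padic_completion_def FactRing_def c d eq ops)
qed

lemma completion_one:
  assumes "subring_set S"
  shows "\<one>\<^bsub>padic_completion (subring_on S) p\<^esub> = to_completion (subring_on S) p 1"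
  by (simp add: padic_completion_def FactRing_def to_completion_def subring_on_def full_ring_def)

lemma to_completion_in_carrier:
  assumes S: "subring_set S" and a: "a \<in> S"
  shows "to_completion (subring_on S) p a \<in> carrier (padic_completion (subring_on S) p)"
  unfolding carrier_completion[OF S] to_completion_eq[OF S]
proof (intro CollectI allI conjI)
  fix N
  show "\<exists>x\<in>S. residue_class S (of_nat p ^ N) a = residue_class S (of_nat p ^ N) x"
    using a by blast
  show "residue_class S (of_nat p ^ Suc N) a \<subseteq> residue_class S (of_nat p ^ N) a"
    unfolding residue_class_def
    using cong_in_coarser[OF S, of "of_nat (p ^ N)" "of_nat p"] subring_set_of_nat[OF S]
    by (auto simp: mult.commute)
qed

lemma to_completion_mult:
  assumes "subring_set S" "a \<in> S" "b \<in> S"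
  shows "to_completion (subring_on S) p a \<otimes>\<^bsub>padic_completion (subring_on S) p\<^esub> to_completion (subring_on S) p b
    = to_completion (subring_on S) p (a * b)"
  by (rule ext) (simp add: completion_mult[OF assms] to_completion_eq[OF assms(1)])

lemma to_completion_add:
  assumes "subring_set S" "a \<in> S" "b \<in> S"
  shows "to_completion (subring_on S) p a \<oplus>\<^bsub>padic_completion (subring_on S) p\<^esub> to_completion (subring_on S) p b
    = to_completion (subring_on S) p (a + b)"
  by (rule ext) (simp add: completion_add[OF assms] to_completion_eq[OF assms(1)])

text \<open>In the application \<open>S\<close> is \<open>R_{pm}\<close>, \<open>T\<close> is the ring of integral power series around it, and \<open>\<sigma>\<close>
  is the Frobenius substitution, which maps \<open>T\<close> but not \<open>S\<close> into itself.\<close>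

locale completed_subring =
  fixes S T :: "'a::comm_ring_1 set" and p :: nat and \<sigma> :: "'a \<Rightarrow> 'a"
  assumes S: "subring_set S" and T: "subring_set T" and ST: "S \<subseteq> T"
    and \<sigma>: "ring_hom_fun \<sigma>" and \<sigma>_T: "a \<in> T \<Longrightarrow> \<sigma> a \<in> T"
begin

abbreviation "completion \<equiv> padic_completion (subring_on S) p"
abbreviation "\<iota> \<equiv> to_completion (subring_on S) p"
abbreviation "ppow N \<equiv> of_nat p ^ N :: 'a"

lemma ppow_mem: "ppow N \<in> S" "ppow N \<in> T"
  by (intro subring_set_power[OF S] subring_set_of_nat[OF S])
    (intro subring_set_power[OF T] subring_set_of_nat[OF T])

lemma cong_in_mono: "cong_in S c a b \<Longrightarrow> cong_in T c a b"
  using ST by (auto simp: cong_in_def)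

lemma cong_in_\<sigma>:
  assumes "cong_in T (ppow N) a b" shows "cong_in T (ppow N) (\<sigma> a) (\<sigma> b)"
proof -
  obtain s where s: "s \<in> T" "a - b = ppow N * s" using assms by (auto simp: cong_in_def)
  have "\<sigma> a - \<sigma> b = \<sigma> (ppow N * s)"
    unfolding s(2)[symmetric] by (rule ring_hom_fun_diff[OF \<sigma>, symmetric])
  also have "\<dots> = ppow N * \<sigma> s"
    unfolding ring_hom_fun_mult[OF \<sigma>] ring_hom_fun_power[OF \<sigma>] ring_hom_fun_of_nat[OF \<sigma>] ..
  finally show ?thesis using \<sigma>_T[OF s(1)] by (auto simp: cong_in_def)
qed

lemma component_cases:
  assumes "c \<in> carrier completion"
  obtains a where "a \<in> S" "c N = residue_class S (ppow N) a" "a \<in> c N" "c N \<subseteq> S"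
proof -
  obtain a where a: "a \<in> S" "c N = residue_class S (ppow N) a"
    using assms unfolding carrier_completion[OF S] by blast
  then show thesis
    using that[of a] residue_class_self[OF S] residue_class_subset[OF S ppow_mem(1)] by blast
qed

text \<open>The comparison of \<open>\<phi> a\<close> with \<open>\<sigma> a\<close> takes place in the larger ring \<open>T\<close>, because \<open>\<sigma> a\<close> need not lie
  in \<open>S\<close>. For a ring endomorphism \<open>\<phi>\<close> of the completion the elements where both agree form a subring
  that is closed under inverses, which determines \<open>\<phi>\<close> from its values on generators.\<close>

definition tracks :: "((nat \<Rightarrow> 'a set) \<Rightarrow> (nat \<Rightarrow> 'a set)) \<Rightarrow> 'a \<Rightarrow> bool" where
  "tracks \<phi> a \<longleftrightarrow> a \<in> S \<and> (\<forall>N. \<forall>t\<in>\<phi> (\<iota> a) N. cong_in T (ppow N) t (\<sigma> a))"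

lemma tracksI:
  assumes "a \<in> S" "\<phi> (\<iota> a) = \<iota> (\<sigma> a)" shows "tracks \<phi> a"
  unfolding tracks_def
  using assms by (auto simp: to_completion_eq[OF S] residue_class_def cong_in_mono)

context
  fixes \<phi> assumes \<phi>: "\<phi> \<in> ring_hom completion completion"
begin

lemma \<phi>_carrier: "a \<in> S \<Longrightarrow> \<phi> (\<iota> a) \<in> carrier completion"
  by (rule ring_hom_closed[OF \<phi> to_completion_in_carrier[OF S]])

lemma \<phi>_component:
  assumes "a \<in> S" "s \<in> \<phi> (\<iota> a) N"
  shows "s \<in> S" "\<phi> (\<iota> a) N = residue_class S (ppow N) s"
proof -
  obtain v where v: "v \<in> S" "\<phi> (\<iota> a) N = residue_class S (ppow N) v" "\<phi> (\<iota> a) N \<subseteq> S"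
    by (rule component_cases[OF \<phi>_carrier[OF assms(1)], of N])
  show "s \<in> S" using v(3) assms(2) by blast
  have "cong_in S (ppow N) s v" using v assms by (simp add: residue_class_def)
  then show "\<phi> (\<iota> a) N = residue_class S (ppow N) s"
    using v(2) residue_class_eq_iff[OF S, of "ppow N" s v] by simp
qed

lemma \<phi>_mult:
  assumes "a \<in> S" "b \<in> S" "s \<in> \<phi> (\<iota> a) N" "t \<in> \<phi> (\<iota> b) N"
  shows "\<phi> (\<iota> (a * b)) N = residue_class S (ppow N) (s * t)"
proof -
  have "\<phi> (\<iota> (a * b)) = \<phi> (\<iota> a) \<otimes>\<^bsub>completion\<^esub> \<phi> (\<iota> b)"
    using ring_hom_mult[OF \<phi> to_completion_in_carrier[OF S assms(1)] to_completion_in_carrier[OF S assms(2)]]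
    by (simp add: to_completion_mult[OF S assms(1,2)])
  moreover have "(\<phi> (\<iota> a) \<otimes>\<^bsub>completion\<^esub> \<phi> (\<iota> b)) N = residue_class S (ppow N) (s * t)"
    using \<phi>_component[OF assms(1,3)] \<phi>_component[OF assms(2,4)] by (intro completion_mult[OF S]) auto
  ultimately show ?thesis by simp
qed

lemma \<phi>_add:
  assumes "a \<in> S" "b \<in> S" "s \<in> \<phi> (\<iota> a) N" "t \<in> \<phi> (\<iota> b) N"
  shows "\<phi> (\<iota> (a + b)) N = residue_class S (ppow N) (s + t)"
proof -
  have "\<phi> (\<iota> (a + b)) = \<phi> (\<iota> a) \<oplus>\<^bsub>completion\<^esub> \<phi> (\<iota> b)"
    using ring_hom_add[OF \<phi> to_completion_in_carrier[OF S assms(1)] to_completion_in_carrier[OF S assms(2)]]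
    by (simp add: to_completion_add[OF S assms(1,2)])
  moreover have "(\<phi> (\<iota> a) \<oplus>\<^bsub>completion\<^esub> \<phi> (\<iota> b)) N = residue_class S (ppow N) (s + t)"
    using \<phi>_component[OF assms(1,3)] \<phi>_component[OF assms(2,4)] by (intro completion_add[OF S]) auto
  ultimately show ?thesis by simp
qed

lemma \<phi>_component_nonempty:
  assumes "a \<in> S" obtains t where "t \<in> \<phi> (\<iota> a) N" "t \<in> S"
proof -
  obtain v where "v \<in> \<phi> (\<iota> a) N" "\<phi> (\<iota> a) N \<subseteq> S"
    by (rule component_cases[OF \<phi>_carrier[OF assms], of N])
  then show thesis by (auto intro: that)
qed

lemma \<phi>_one: "\<phi> (\<iota> 1) = \<iota> 1"
  using ring_hom_one[OF \<phi>] unfolding completion_one[OF S] .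

lemma \<phi>_one_component: "\<phi> (\<iota> 1) N = residue_class S (ppow N) 1"
  unfolding \<phi>_one by (simp add: to_completion_eq[OF S])

lemma tracks_mult:
  assumes "tracks \<phi> a" "tracks \<phi> b" shows "tracks \<phi> (a * b)"
  unfolding tracks_def
proof (intro conjI allI ballI)
  have ab: "a \<in> S" "b \<in> S" using assms by (auto simp: tracks_def)
  then show "a * b \<in> S" by (rule subring_set_mult[OF S])
  fix N u assume u: "u \<in> \<phi> (\<iota> (a * b)) N"
  obtain s t where s: "s \<in> \<phi> (\<iota> a) N" "s \<in> S" and t: "t \<in> \<phi> (\<iota> b) N" "t \<in> S"
    using \<phi>_component_nonempty[OF ab(1)] \<phi>_component_nonempty[OF ab(2)] by (metis (lifting))
  have "cong_in T (ppow N) u (s * t)"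
    using u \<phi>_mult[OF ab s(1) t(1)] by (simp add: residue_class_def cong_in_mono)
  moreover have "cong_in T (ppow N) (s * t) (\<sigma> a * \<sigma> b)"
    using assms s t ST ab by (intro cong_in_mult[OF T]) (auto simp: tracks_def intro: \<sigma>_T)
  ultimately show "cong_in T (ppow N) u (\<sigma> (a * b))"
    unfolding ring_hom_fun_mult[OF \<sigma>] by (rule cong_in_trans[OF T])
qed

lemma tracks_add:
  assumes "tracks \<phi> a" "tracks \<phi> b" shows "tracks \<phi> (a + b)"
  unfolding tracks_def
proof (intro conjI allI ballI)
  have ab: "a \<in> S" "b \<in> S" using assms by (auto simp: tracks_def)
  then show "a + b \<in> S" by (rule subring_set_add[OF S])
  fix N u assume u: "u \<in> \<phi> (\<iota> (a + b)) N"
  obtain s t where s: "s \<in> \<phi> (\<iota> a) N" "s \<in> S" and t: "t \<in> \<phi> (\<iota> b) N" "t \<in> S"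
    using \<phi>_component_nonempty[OF ab(1)] \<phi>_component_nonempty[OF ab(2)] by (metis (lifting))
  have "cong_in T (ppow N) u (s + t)"
    using u \<phi>_add[OF ab s(1) t(1)] by (simp add: residue_class_def cong_in_mono)
  moreover have "cong_in T (ppow N) (s + t) (\<sigma> a + \<sigma> b)"
    using assms s t by (intro cong_in_add[OF T]) (auto simp: tracks_def)
  ultimately show "cong_in T (ppow N) u (\<sigma> (a + b))"
    unfolding ring_hom_fun_add[OF \<sigma>] by (rule cong_in_trans[OF T])
qed

lemma tracks_one: "tracks \<phi> 1"
  by (rule tracksI) (simp_all add: subring_set_one[OF S] \<phi>_one ring_hom_fun_one[OF \<sigma>])

text \<open>If \<open>t\<close> represents \<open>\<phi> b\<close>, then \<open>\<sigma> a * t\<close> is congruent to \<open>1 = \<sigma> a * \<sigma> b\<close>, and \<open>\<sigma> a\<close> can be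
  cancelled because it is a unit of \<open>T\<close>.\<close>

lemma tracks_inverse:
  assumes a: "tracks \<phi> a" and b: "b \<in> S" "a * b = 1"
  shows "tracks \<phi> b"
  unfolding tracks_def
proof (intro conjI allI ballI)
  show "b \<in> S" by fact
  have aS: "a \<in> S" using a by (auto simp: tracks_def)
  have \<sigma>ab: "\<sigma> a * \<sigma> b = 1"
    using arg_cong[OF b(2), of \<sigma>] by (simp add: ring_hom_fun_mult[OF \<sigma>] ring_hom_fun_one[OF \<sigma>])
  have memT: "\<sigma> a \<in> T" "\<sigma> b \<in> T" using aS b(1) ST by (auto intro: \<sigma>_T)
  fix N t assume t: "t \<in> \<phi> (\<iota> b) N"
  have tT: "t \<in> T"
    using \<phi>_component(1)[OF b(1) t] ST by blast
  obtain s where s: "s \<in> \<phi> (\<iota> a) N" "s \<in> S"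
    using \<phi>_component_nonempty[OF aS] .
  have "residue_class S (ppow N) (s * t) = residue_class S (ppow N) 1"
    using \<phi>_mult[OF aS b(1) s(1) t] by (simp add: b(2) \<phi>_one_component)
  then have st: "cong_in T (ppow N) (s * t) 1"
    by (simp add: residue_class_eq_iff[OF S] cong_in_mono)
  have "cong_in T (ppow N) (s * t) (\<sigma> a * t)"
    using a s(1) tT memT by (intro cong_in_mult[OF T] cong_in_refl[OF T]) (auto simp: tracks_def)
  then have "cong_in T (ppow N) (\<sigma> a * t) 1"
    using st by (meson T cong_in_sym cong_in_trans)
  from cong_in_mult_left[OF T this memT(2)] show "cong_in T (ppow N) t (\<sigma> b)"
    using \<sigma>ab by (simp add: mult.assoc[symmetric] mult.commute[of "\<sigma> b"])
qed

lemma subring_set_tracks: "subring_set {a. tracks \<phi> a}"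
proof -
  have m1: "tracks \<phi> (- 1)"
    unfolding tracks_def
  proof (intro conjI allI ballI)
    show "- 1 \<in> S" by (intro subring_set_uminus[OF S] subring_set_one[OF S])
    fix N t assume t: "t \<in> \<phi> (\<iota> (- 1)) N"
    have one: "1 \<in> \<phi> (\<iota> 1) N"
      unfolding \<phi>_one_component by (rule residue_class_self[OF S])
    obtain z where z: "z \<in> \<phi> (\<iota> 0) N" using \<phi>_component_nonempty[OF subring_set_zero[OF S]] .
    \<comment> \<open>\<open>\<phi>\<close> maps \<open>0\<close> to \<open>0\<close> because it is additive, and then \<open>- 1\<close> to \<open>- 1\<close>.\<close>
    have "residue_class S (ppow N) (1 + z) = \<phi> (\<iota> 1) N"
      using \<phi>_add[OF subring_set_one[OF S] subring_set_zero[OF S] one z] by simp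
    then have "cong_in S (ppow N) (1 + z) 1"
      by (simp add: \<phi>_one_component residue_class_eq_iff[OF S])
    from cong_in_diff[OF S this cong_in_refl[OF S], of 1] have z0: "cong_in S (ppow N) z 0"
      by simp
    have "\<phi> (\<iota> 0) N = residue_class S (ppow N) (t + 1)"
      using \<phi>_add[OF \<open>- 1 \<in> S\<close> subring_set_one[OF S] t one] by simp
    then have "cong_in S (ppow N) z (t + 1)" using z by (simp add: residue_class_def)
    then have "cong_in S (ppow N) (t + 1) 0" using z0 by (meson S cong_in_sym cong_in_trans)
    from cong_in_diff[OF S this cong_in_refl[OF S], of 1] show "cong_in T (ppow N) t (\<sigma> (- 1))"
      by (simp add: ring_hom_fun_uminus[OF \<sigma>] ring_hom_fun_one[OF \<sigma>] cong_in_mono)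
  qed
  have "tracks \<phi> (a - b)" if "tracks \<phi> a" "tracks \<phi> b" for a b
    using tracks_add[OF that(1) tracks_mult[OF m1 that(2)]] by simp
  then show ?thesis
    by (auto simp: subring_set_def tracks_one tracks_mult)
qed

end

end

text \<open>If \<open>p\<^sup>N S\<close> is \<open>S \<inter> p\<^sup>N T\<close> and every \<open>\<sigma> a\<close> is a limit of elements of \<open>S\<close>, then \<open>\<sigma>\<close> itself extends
  to the completion.\<close>

locale completed_lift = completed_subring +
  assumes pure: "\<And>a b N. a \<in> S \<Longrightarrow> b \<in> S \<Longrightarrow> cong_in T (ppow N) a b \<Longrightarrow> cong_in S (ppow N) a b"
    and approx: "\<And>a N. a \<in> S \<Longrightarrow> \<exists>t\<in>S. cong_in T (ppow N) t (\<sigma> a)"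
begin

text \<open>The set does not depend on the representative \<open>s\<close>, because \<open>\<sigma>\<close> respects congruences in \<open>T\<close>. It is
  nonempty by approximation and a single residue class of \<open>S\<close> by purity.\<close>

definition lift :: "(nat \<Rightarrow> 'a set) \<Rightarrow> (nat \<Rightarrow> 'a set)" where
  "lift c = (\<lambda>N. {t\<in>S. \<exists>s\<in>c N. cong_in T (ppow N) t (\<sigma> s)})"

lemma lift_component:
  assumes c: "c N = residue_class S (ppow N) s" and s: "s \<in> S" and t: "t \<in> S"
    and st: "cong_in T (ppow N) t (\<sigma> s)"
  shows "lift c N = residue_class S (ppow N) t"
proof (intro equalityI subsetI)
  fix u assume "u \<in> lift c N"
  then obtain r where u: "u \<in> S" and r: "cong_in S (ppow N) r s" "cong_in T (ppow N) u (\<sigma> r)"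
    by (auto simp: lift_def c residue_class_def)
  have "cong_in T (ppow N) u (\<sigma> s)"
    by (rule cong_in_trans[OF T r(2) cong_in_\<sigma>[OF cong_in_mono[OF r(1)]]])
  then have "cong_in T (ppow N) u t"
    by (rule cong_in_trans[OF T _ cong_in_sym[OF T st]])
  then show "u \<in> residue_class S (ppow N) t"
    using u t by (simp add: residue_class_def pure)
next
  fix u assume u: "u \<in> residue_class S (ppow N) t"
  then have "u \<in> S" using residue_class_subset[OF S ppow_mem(1) t] by blast
  moreover have "cong_in T (ppow N) u (\<sigma> s)"
    by (rule cong_in_trans[OF T _ st]) (use u in \<open>simp add: residue_class_def cong_in_mono\<close>)
  ultimately show "u \<in> lift c N"
    using residue_class_self[OF S] by (auto simp: lift_def c)
qed

lemma lift_to_completion_component: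
  "a \<in> S \<Longrightarrow> t \<in> S \<Longrightarrow> cong_in T (ppow N) t (\<sigma> a) \<Longrightarrow> lift (\<iota> a) N = \<iota> t N"
  using lift_component[of "\<iota> a" N a t] by (simp add: to_completion_eq[OF S])

lemma lift_to_completion: "a \<in> S \<Longrightarrow> \<sigma> a \<in> S \<Longrightarrow> lift (\<iota> a) = \<iota> (\<sigma> a)"
  by (intro ext lift_to_completion_component cong_in_refl[OF T])

lemma lift_cases:
  assumes "c \<in> carrier completion"
  obtains s t where "s \<in> S" "t \<in> S" "c N = residue_class S (ppow N) s"
    "cong_in T (ppow N) t (\<sigma> s)" "lift c N = residue_class S (ppow N) t"
proof -
  obtain s where s: "s \<in> S" "c N = residue_class S (ppow N) s"
    using component_cases[OF assms] .
  obtain t where "t \<in> S" "cong_in T (ppow N) t (\<sigma> s)"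
    using approx[OF s(1)] ..
  then show thesis using that s lift_component[of c N s t] by blast
qed

lemma lift_hom: "lift \<in> ring_hom completion completion"
proof (rule ring_hom_memI)
  fix c assume c: "c \<in> carrier completion"
  show "lift c \<in> carrier completion"
    unfolding carrier_completion[OF S]
  proof (intro CollectI allI conjI)
    fix N
    show "\<exists>a\<in>S. lift c N = residue_class S (ppow N) a"
      using lift_cases[OF c, of N] by metis
    have "c (Suc N) \<subseteq> c N" using c by (simp add: carrier_completion[OF S])
    moreover have "cong_in T (ppow (Suc N)) a b \<Longrightarrow> cong_in T (ppow N) a b" for a b
      using cong_in_coarser[OF T, of "ppow N" "of_nat p" a b] subring_set_of_nat[OF T]
      by (auto simp: mult.commute)
    ultimately show "lift c (Suc N) \<subseteq> lift c N"
      unfolding lift_def by blast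
  qed
next
  fix c d assume c: "c \<in> carrier completion" and d: "d \<in> carrier completion"
  show "lift (c \<otimes>\<^bsub>completion\<^esub> d) = lift c \<otimes>\<^bsub>completion\<^esub> lift d"
  proof
    fix N
    obtain s t where s: "s \<in> S" "t \<in> S" "c N = residue_class S (ppow N) s"
      "cong_in T (ppow N) t (\<sigma> s)" "lift c N = residue_class S (ppow N) t"
      using lift_cases[OF c] .
    obtain s' t' where s': "s' \<in> S" "t' \<in> S" "d N = residue_class S (ppow N) s'"
      "cong_in T (ppow N) t' (\<sigma> s')" "lift d N = residue_class S (ppow N) t'"
      using lift_cases[OF d] .
    have "lift (c \<otimes>\<^bsub>completion\<^esub> d) N = residue_class S (ppow N) (t * t')"
    proof (rule lift_component)
      show "(c \<otimes>\<^bsub>completion\<^esub> d) N = residue_class S (ppow N) (s * s')"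
        by (rule completion_mult[OF S]) fact+
      show "cong_in T (ppow N) (t * t') (\<sigma> (s * s'))"
        unfolding ring_hom_fun_mult[OF \<sigma>] using s s' ST
        by (intro cong_in_mult[OF T]) (auto intro: \<sigma>_T)
    qed (use s s' in \<open>auto intro: subring_set_mult[OF S]\<close>)
    also have "\<dots> = (lift c \<otimes>\<^bsub>completion\<^esub> lift d) N"
      by (rule completion_mult[OF S, symmetric]) fact+
    finally show "lift (c \<otimes>\<^bsub>completion\<^esub> d) N = (lift c \<otimes>\<^bsub>completion\<^esub> lift d) N" .
  qed
  show "lift (c \<oplus>\<^bsub>completion\<^esub> d) = lift c \<oplus>\<^bsub>completion\<^esub> lift d"
  proof
    fix N
    obtain s t where s: "s \<in> S" "t \<in> S" "c N = residue_class S (ppow N) s"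
      "cong_in T (ppow N) t (\<sigma> s)" "lift c N = residue_class S (ppow N) t"
      using lift_cases[OF c] .
    obtain s' t' where s': "s' \<in> S" "t' \<in> S" "d N = residue_class S (ppow N) s'"
      "cong_in T (ppow N) t' (\<sigma> s')" "lift d N = residue_class S (ppow N) t'"
      using lift_cases[OF d] .
    have "lift (c \<oplus>\<^bsub>completion\<^esub> d) N = residue_class S (ppow N) (t + t')"
    proof (rule lift_component)
      show "(c \<oplus>\<^bsub>completion\<^esub> d) N = residue_class S (ppow N) (s + s')"
        by (rule completion_add[OF S]) fact+
      show "cong_in T (ppow N) (t + t') (\<sigma> (s + s'))"
        unfolding ring_hom_fun_add[OF \<sigma>] using s s' by (intro cong_in_add[OF T])
    qed (use s s' in \<open>auto intro: subring_set_add[OF S]\<close>)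
    also have "\<dots> = (lift c \<oplus>\<^bsub>completion\<^esub> lift d) N"
      by (rule completion_add[OF S, symmetric]) fact+
    finally show "lift (c \<oplus>\<^bsub>completion\<^esub> d) N = (lift c \<oplus>\<^bsub>completion\<^esub> lift d) N" .
  qed
next
  show "lift \<one>\<^bsub>completion\<^esub> = \<one>\<^bsub>completion\<^esub>"
    unfolding completion_one[OF S]
    using lift_to_completion[of 1] subring_set_one[OF S] by (simp add: ring_hom_fun_one[OF \<sigma>])
qed

end

section \<open>The Frobenius lift\<close>

lemma scale_exponents_in_coeff_ring:
  assumes "subring_set \<O>" "f \<in> coeff_ring \<O> L" "\<And>a. a \<in> L \<Longrightarrow> of_nat p *s a \<in> L"
  shows "scale_exponents p f \<in> coeff_ring \<O> L"
  unfolding scale_exponents_def keysum_def using assms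
  by (intro coeff_ring_sum coeff_ring_single) (auto simp: coeff_ring_def)

lemma frob_subst_integral:
  assumes "subring_set \<O>" "F \<in> integral_series \<O>"
  shows "frob_subst p F \<in> integral_series \<O>"
  using assms scale_exponents_in_coeff_ring[OF assms(1), of _ UNIV p]
  by (auto simp: integral_series_def frob_subst_def stretch_nth map_coeffs_nth coeff_ring_zero)

lemma frob_subst_laurent_polys:
  assumes \<O>: "subring_set \<O>" and p: "p > 0" and P: "P \<in> laurent_polys \<O> m"
  shows "frob_subst p P \<in> laurent_polys \<O> m"
proof -
  have "of_nat m * (of_nat p * r :: rat) \<in> \<int>" if "of_nat m * r \<in> \<int>" for r
    using Ints_mult[OF Ints_of_nat that, of p] by (simp add: mult_ac)
  then have "map_coeffs (scale_exponents p) P \<in> laurent_polys \<O> m"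
    using P scale_exponents_in_coeff_ring[OF \<O>, of _ "fraction_lattice m" p]
      ring_hom_fun_zero[OF ring_hom_fun_scale_exponents, of p]
    by (fastforce simp: laurent_polys_def map_coeffs_nth fraction_lattice_def)
  then show ?thesis
    unfolding frob_subst_def by (rule stretch_laurent_polys[OF _ order_refl \<O> dvd_refl p])
qed

text \<open>The powers of \<open>z\<close> are already \<open>m\<close> different roots of \<open>x^m = 1\<close>.\<close>

lemma primitive_root_generates:
  assumes z: "primitive_root_of_unity m z" and m: "m > 0" and w: "w ^ m = 1"
  shows "\<exists>k. w = z ^ k"
proof -
  have zm: "z ^ m = 1"
    using z by (simp add: primitive_root_of_unity_def)
  then have z0: "z \<noteq> 0"
    using m by (metis power_0_left less_numeral_extra(3) zero_neq_one)
  have "inj_on (\<lambda>k. z ^ k) {..<m}"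
  proof (rule linorder_inj_onI)
    fix i j assume ij: "i < j" "j \<in> {..<m}"
    have "z ^ (j - i) \<noteq> 1"
      using z ij by (auto simp: primitive_root_of_unity_def)
    moreover have "z ^ j = z ^ i * z ^ (j - i)"
      using ij by (simp flip: power_add)
    ultimately show "z ^ i \<noteq> z ^ j" using z0 by auto
  qed auto
  then have "card ((\<lambda>k. z ^ k) ` {..<m}) = m" by (simp add: card_image)
  moreover have "(\<lambda>k. z ^ k) ` {..<m} \<subseteq> {x. x ^ m = 1}"
    using zm by (auto simp flip: power_mult) (metis mult.commute power_mult power_one)
  moreover have "card {x::complex. x ^ m = 1} = m" "finite {x::complex. x ^ m = 1}"
    using card_roots_unity_eq[OF m] finite_roots_unity[of m] m by auto
  ultimately have "(\<lambda>k. z ^ k) ` {..<m} = {x. x ^ m = 1}"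
    by (metis card_subset_eq)
  then show ?thesis using w by auto
qed

context habiro_setting
begin

lemma primitive: "m > 0 \<Longrightarrow> primitive_root_of_unity m (\<zeta> m)"
  using roots by (simp add: compatible_roots_def)

lemma cyclotomic_mono:
  assumes "m > 0" "p > 0" shows "cyclotomic m \<subseteq> cyclotomic (p * m)"
proof (rule generated_subset[OF subring_cyclotomic])
  have "\<zeta> m ^ m = 1"
    using primitive[OF assms(1)] by (simp add: primitive_root_of_unity_def)
  then have "\<zeta> m ^ (p * m) = 1"
    by (simp add: power_mult mult.commute[of p])
  then obtain k where "\<zeta> m = \<zeta> (p * m) ^ k"
    using primitive_root_generates[OF primitive[of "p * m"]] assms by auto
  moreover have "\<zeta> (p * m) ^ k \<in> cyclotomic (p * m)"
    by (intro subring_set_power subring_cyclotomic generated_incl) auto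
  ultimately show "{\<zeta> m} \<subseteq> cyclotomic (p * m)" by simp
qed

lemma level_stretch:
  assumes m: "m > 0" and p: "p > 0" and F: "F \<in> level m"
  shows "F oo fps_X ^ p \<in> level (p * m)"
proof -
  obtain k where "denominator m ^ k * F \<in> laurent_polys (cyclotomic m) m"
    using iffD1[OF level_iff[OF m] F] ..
  from stretch_laurent_polys[OF this cyclotomic_mono[OF m p] subring_cyclotomic _ p, of "p * m"]
  have "denominator (p * m) ^ k * stretch p F \<in> laurent_polys (cyclotomic (p * m)) (p * m)"
    by (simp add: stretch_mult[OF p] stretch_power[OF p] stretch_denominator[OF p])
  then show ?thesis
    unfolding compose_X_power[OF p] using level_iff[of "p * m"] m p by auto
qed

end

locale frobenius_setting = habiro_setting +
  fixes p m :: nat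
  assumes prime: "prime p" and m: "m > 0"
begin

lemma p: "p > 0" using prime prime_gt_0_nat by blast

lemma M: "p * m > 0" using p m by simp

abbreviation "S \<equiv> level (p * m)"
abbreviation "T \<equiv> (integral_series (cyclotomic (p * m)) :: 'a xlaurent fps set)"
abbreviation "L \<equiv> (laurent_polys (cyclotomic (p * m)) (p * m) :: 'a xlaurent fps set)"
abbreviation "D \<equiv> denominator (p * m)"
abbreviation "D' \<equiv> denominator_inverse (p * m)"
abbreviation "\<sigma> \<equiv> frob_subst p :: 'a xlaurent fps \<Rightarrow> 'a xlaurent fps"

lemma T_subring: "subring_set T"
  by (rule subring_set_integral_series[OF subring_cyclotomic])

lemma S_subset_T: "S \<subseteq> T"
  using level_integral[OF M] by blast

sublocale completed_subring S T p \<sigma>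
  by unfold_locales
    (auto intro: subring_level T_subring ring_hom_fun_frob_subst p frob_subst_integral
      subring_cyclotomic subsetD[OF S_subset_T])

lemma D_mult_D': "D * D' = 1" "\<sigma> D * \<sigma> D' = 1"
  using denominator_mult_inverse[OF M]
  by (simp_all add: ring_hom_fun_one[OF \<sigma>] flip: ring_hom_fun_mult[OF \<sigma>])

lemma D'_mem: "D' \<in> S" "\<sigma> D' \<in> T"
  using denominator_inverse_in_level[OF M] by (auto intro: \<sigma>_T subsetD[OF S_subset_T])

lemma laurent_subset_S: "L \<subseteq> S"
  by (rule laurent_polys_subset_level[OF M])

lemma \<sigma>_laurent:
  "P \<in> L \<Longrightarrow> \<sigma> P \<in> L"
  by (rule frob_subst_laurent_polys[OF subring_cyclotomic p])

lemma D_laurent: "D \<in> L"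
  by (rule denominator_in_laurent_polys[OF subring_cyclotomic Ints_subset_cyclotomic M])

lemma S_cases:
  assumes "F \<in> S"
  obtains k P where "P \<in> L" "D ^ k * F = P" "F = D' ^ k * P"
proof -
  obtain k where k: "D ^ k * F \<in> L"
    using iffD1[OF level_iff[OF M] assms] ..
  then show thesis using that k denominator_cancel[OF M, of k F] by metis
qed

text \<open>On \<open>A\<close> the substitution \<open>\<sigma>\<close> is congruent to the p-th power map modulo \<open>p\<close>, because the set
  where this holds is a subring by the freshman's dream. Since \<open>1 - \<lambda>h\<close> is invertible as a power
  series, this extends to \<open>R\<close>.\<close>

lemma frobenius_congruence_base:
  assumes "P \<in> base_ring"
  shows "cong_in T (of_nat p) (\<sigma> (stretch (p * m) P)) (stretch (p * m) P ^ p)"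
proof -
  let ?s = "stretch (p * m) :: 'a xlaurent fps \<Rightarrow> 'a xlaurent fps"
  let ?H = "{P. ?s P \<in> T \<and> cong_in T (of_nat p) (\<sigma> (?s P)) (?s P ^ p)}"
  have s: "ring_hom_fun ?s" by (rule ring_hom_fun_stretch[OF M])
  have "subring_set ?H"
    unfolding subring_set_def
  proof (intro conjI ballI)
    show "1 \<in> ?H"
      using T by (simp add: ring_hom_fun_one[OF s] ring_hom_fun_one[OF \<sigma>] subring_set_one cong_in_refl)
    fix P Q assume P: "P \<in> ?H" and Q: "Q \<in> ?H"
    have mem: "?s P - ?s Q \<in> T" using P Q subring_set_diff[OF T] by blast
    have "cong_in T (of_nat p) (?s P ^ p) ((?s P - ?s Q) ^ p + ?s Q ^ p)"
      using cong_in_prime_power_add[OF T prime mem, of "?s Q"] Q by simp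
    from cong_in_diff[OF T this cong_in_refl[OF T], of "?s Q ^ p"]
    have "cong_in T (of_nat p) (?s P ^ p - ?s Q ^ p) ((?s P - ?s Q) ^ p)" by simp
    moreover have "cong_in T (of_nat p) (\<sigma> (?s P) - \<sigma> (?s Q)) (?s P ^ p - ?s Q ^ p)"
      using P Q by (intro cong_in_diff[OF T]) auto
    ultimately have "cong_in T (of_nat p) (\<sigma> (?s P) - \<sigma> (?s Q)) ((?s P - ?s Q) ^ p)"
      using cong_in_trans[OF T] by blast
    then show "P - Q \<in> ?H"
      using mem by (simp add: ring_hom_fun_diff[OF s] ring_hom_fun_diff[OF \<sigma>])
    have "cong_in T (of_nat p) (\<sigma> (?s P) * \<sigma> (?s Q)) (?s P ^ p * ?s Q ^ p)"
      using P Q by (intro cong_in_mult[OF T]) (auto intro: \<sigma>_T subring_set_power[OF T])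
    then show "P * Q \<in> ?H"
      using P Q subring_set_mult[OF T]
      by (simp add: ring_hom_fun_mult[OF s] ring_hom_fun_mult[OF \<sigma>] power_mult_distrib)
  qed
  moreover have "xpow i r \<in> ?H" if "r = 1 \<or> r = - 1" for i r
  proof -
    have r: "of_nat (p * m) * r \<in> \<int>" using that by auto
    have "?s (xpow i r) = xpow i r" by (simp add: xpow_def stretch_const)
    moreover have "\<sigma> (xpow i r) = xpow i r ^ p" by (simp add: frob_subst_xpow xpow_power)
    ultimately show ?thesis
      using xpow_in_laurent_polys[OF subring_cyclotomic r] laurent_polys_integral cong_in_refl[OF T]
      by fastforce
  qed
  moreover have "fps_X \<in> ?H"
  proof -
    have "?s fps_X = fps_X ^ (p * m)" using stretch_X_power[OF M, of 1] by simp
    moreover have "\<sigma> (fps_X ^ (p * m)) = (fps_X ^ (p * m)) ^ p"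
      by (simp add: frob_subst_X_power[OF p] mult.commute flip: power_mult)
    moreover have "fps_X ^ (p * m) \<in> T"
      using X_in_laurent_polys[OF subring_cyclotomic] laurent_polys_integral
      by (intro subring_set_power[OF T]) blast
    ultimately show ?thesis using cong_in_refl[OF T] by simp
  qed
  ultimately have "base_ring \<subseteq> ?H"
    unfolding base_ring_def by (intro generated_subset) auto
  then show ?thesis using assms by blast
qed

lemma D_frobenius: "cong_in T (of_nat p) (\<sigma> D) (D ^ p)"
proof -
  have "denominator 1 \<in> base_ring"
    unfolding base_ring_eq by (rule denominator_in_laurent_polys) (auto intro: subring_set_Ints)
  from frobenius_congruence_base[OF this] show ?thesis
    using stretch_denominator[OF M, of 1] by simp
qed

lemma frobenius_congruence:
  assumes "F \<in> level_one"
  shows "cong_in T (of_nat p) (\<sigma> (F oo fps_X ^ (p * m))) ((F oo fps_X ^ (p * m)) ^ p)"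
proof -
  obtain k where k: "denominator 1 ^ k * F \<in> base_ring"
    using assms unfolding level_one_def localisation_def by blast
  define Q where "Q = F oo fps_X ^ (p * m)"
  have Q: "Q = stretch (p * m) F" unfolding Q_def by (rule compose_X_power[OF M])
  have QT: "Q \<in> T"
  proof -
    have "Q \<in> S" unfolding Q_def root_ring_def using assms by (auto intro: generated_incl)
    then show ?thesis using S_subset_T by blast
  qed
  have DT: "D \<in> T" using D_laurent laurent_polys_integral by blast
  have "stretch (p * m) (denominator 1 ^ k * F) = D ^ k * Q"
    using stretch_denominator[OF M, of 1] by (simp add: stretch_mult[OF M] stretch_power[OF M] Q)
  with frobenius_congruence_base[OF k]
  have "cong_in T (of_nat p) (\<sigma> (D ^ k * Q)) ((D ^ k * Q) ^ p)" by simp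
  then have 1: "cong_in T (of_nat p) (\<sigma> D ^ k * \<sigma> Q) ((D ^ p) ^ k * Q ^ p)"
    by (simp add: ring_hom_fun_mult[OF \<sigma>] ring_hom_fun_power[OF \<sigma>] power_mult_distrib mult.commute
        flip: power_mult)
  have "cong_in T (of_nat p) ((D ^ p) ^ k * Q ^ p) (\<sigma> D ^ k * Q ^ p)"
    by (intro cong_in_mult[OF T] cong_in_power[OF T] cong_in_refl[OF T] subring_set_power[OF T]
        cong_in_sym[OF T D_frobenius] \<sigma>_T QT DT)
  with 1 have "cong_in T (of_nat p) (\<sigma> D ^ k * \<sigma> Q) (\<sigma> D ^ k * Q ^ p)"
    by (rule cong_in_trans[OF T])
  from cong_in_mult_left[OF T this subring_set_power[OF T D'_mem(2), of k]]
  have "cong_in T (of_nat p) ((\<sigma> D * \<sigma> D') ^ k * \<sigma> Q) ((\<sigma> D * \<sigma> D') ^ k * Q ^ p)"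
    by (simp add: power_mult_distrib mult_ac)
  then show ?thesis by (simp add: D_mult_D' Q_def)
qed

lemma cong_in_S:
  assumes "a \<in> S" "b \<in> S" "cong_in T (of_nat p ^ N) a b" shows "cong_in S (of_nat p ^ N) a b"
proof -
  have "of_nat p ^ N = (of_nat (p ^ N) :: 'a xlaurent fps)" by simp
  moreover have "p ^ N > 0" using p by simp
  ultimately show ?thesis
    using cong_in_level[OF M _ assms(1,2), of "p ^ N"] assms(3) by metis
qed

text \<open>Modulo \<open>p\<close> the element \<open>\<sigma> D\<close> is the unit \<open>D\<^sup>p\<close>, hence it is a unit modulo every power of
  \<open>p\<close>.\<close>

lemma \<sigma>_D_unit: "\<exists>u\<in>S. cong_in S (of_nat p ^ N) (\<sigma> D * u) 1"
proof (induction N)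
  case 0
  have "\<sigma> D * 0 - 1 = of_nat p ^ 0 * (- 1)" by simp
  moreover have "- 1 \<in> S" "0 \<in> S"
    by (intro subring_set_uminus[OF S] subring_set_one[OF S] subring_set_zero[OF S])+
  ultimately show ?case unfolding cong_in_def by blast
next
  case (Suc N)
  then obtain u s where u: "u \<in> S" "s \<in> S" "\<sigma> D * u - 1 = of_nat p ^ N * s"
    by (auto simp: cong_in_def)
  have \<sigma>D: "\<sigma> D \<in> S" using laurent_subset_S \<sigma>_laurent[OF D_laurent] by blast
  define v where "v = D' ^ p"
  have v: "v \<in> S" unfolding v_def by (rule subring_set_power[OF S D'_mem(1)])
  have "cong_in T (of_nat p) (v * \<sigma> D) (v * D ^ p)"
    by (rule cong_in_mult_left[OF T D_frobenius subsetD[OF S_subset_T v]])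
  then have "cong_in T (of_nat p) (\<sigma> D * v) ((D * D') ^ p)"
    by (simp add: v_def power_mult_distrib mult.commute)
  then have "cong_in S (of_nat p ^ 1) (\<sigma> D * v) 1"
    by (intro cong_in_S subring_set_mult[OF S \<sigma>D v] subring_set_one[OF S]) (simp add: D_mult_D')
  then obtain t where t: "t \<in> S" "\<sigma> D * v - 1 = of_nat p * t"
    by (auto simp: cong_in_def)
  \<comment> \<open>The errors of the approximate inverses \<open>u\<close> and \<open>v\<close> are multiples of \<open>p\<^sup>N\<close> and \<open>p\<close>; the
    error of this combination is their product.\<close>
  have "\<sigma> D * (u + v - \<sigma> D * u * v) - 1 = - ((\<sigma> D * u - 1) * (\<sigma> D * v - 1))"
    by (simp add: algebra_simps)
  also have "\<dots> = of_nat p ^ Suc N * (- (s * t))"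
    unfolding u(3) t(2) by (simp add: algebra_simps)
  finally have "\<sigma> D * (u + v - \<sigma> D * u * v) - 1 = of_nat p ^ Suc N * (- (s * t))" .
  moreover have "u + v - \<sigma> D * u * v \<in> S" "- (s * t) \<in> S"
    using u t v \<sigma>D by (auto intro!: subring_set_uminus[OF S] subring_set_mult[OF S]
        subring_set_diff[OF S] subring_set_add[OF S])
  ultimately show ?case unfolding cong_in_def by blast
qed

text \<open>For \<open>F = P / D\<^sup>k\<close> the element \<open>u\<^sup>k * \<sigma> P\<close> approximates \<open>\<sigma> F\<close>, where \<open>u\<close> is an inverse of
  \<open>\<sigma> D\<close> modulo \<open>p\<^sup>N\<close>.\<close>

sublocale completed_lift S T p \<sigma>
proof unfold_locales
  fix F N assume F: "F \<in> S"
  obtain k P where P: "P \<in> L" "D ^ k * F = P"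
    using S_cases[OF F] by metis
  obtain u where u: "u \<in> S" "cong_in S (of_nat p ^ N) (\<sigma> D * u) 1" using \<sigma>_D_unit by blast
  have \<sigma>D: "\<sigma> D \<in> S" using laurent_subset_S \<sigma>_laurent[OF D_laurent] by blast
  have "u ^ k * \<sigma> P = (\<sigma> D * u) ^ k * \<sigma> F"
    unfolding P(2)[symmetric]
    by (simp add: ring_hom_fun_mult[OF \<sigma>] ring_hom_fun_power[OF \<sigma>] power_mult_distrib mult_ac)
  moreover have "cong_in T (of_nat p ^ N) ((\<sigma> D * u) ^ k * \<sigma> F) (1 ^ k * \<sigma> F)"
  proof (rule cong_in_mult[OF T])
    have "\<sigma> D * u \<in> S" by (rule subring_set_mult[OF S \<sigma>D u(1)])
    then show "cong_in T (of_nat p ^ N) ((\<sigma> D * u) ^ k) (1 ^ k)"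
      using S_subset_T by (intro cong_in_power[OF T cong_in_mono[OF u(2)] _ subring_set_one[OF T]]) blast
    show "\<sigma> F \<in> T" using F S_subset_T by (intro \<sigma>_T) blast
  qed (simp_all add: cong_in_refl[OF T] subring_set_one[OF T])
  ultimately have "cong_in T (of_nat p ^ N) (u ^ k * \<sigma> P) (\<sigma> F)" by simp
  moreover have "u ^ k * \<sigma> P \<in> S"
    using u(1) laurent_subset_S \<sigma>_laurent[OF P(1)]
    by (intro subring_set_mult[OF S] subring_set_power[OF S]) auto
  ultimately show "\<exists>t\<in>S. cong_in T (of_nat p ^ N) t (\<sigma> F)" by blast
qed (rule cong_in_S)

lemma generators_in_S: "xpow i (1 / of_nat (p * m)) \<in> S" "fps_X \<in> S" "scalar (\<zeta> (p * m)) \<in> S"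
  unfolding root_ring_def by (auto intro: generated_incl)

lemma \<sigma>_generators:
  "\<sigma> (xpow i (1 / of_nat (p * m))) = xpow i (1 / of_nat m)" "\<sigma> fps_X = fps_X ^ p"
  "\<sigma> (scalar z) = scalar z"
  using p m frob_subst_X_power[OF p, of 1]
  by (simp_all add: frob_subst_xpow frob_subst_scalar)

lemma is_frobenius_lift: "is_frobenius \<zeta> level_one p m lift"
proof -
  have "xpow i (1 / of_nat m) \<in> S" for i
  proof -
    have "of_nat (p * m) * (1 / of_nat m :: rat) = of_nat p" using m by simp
    then have "of_nat (p * m) * (1 / of_nat m :: rat) \<in> \<int>" by simp
    from xpow_in_laurent_polys[OF subring_cyclotomic this] show ?thesis using laurent_subset_S by blast
  qed
  moreover have "fps_X ^ p \<in> S" by (rule subring_set_power[OF S generators_in_S(2)])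
  moreover have "lift (\<iota> (F oo fps_X ^ (p * m))) 1 = \<iota> ((F oo fps_X ^ (p * m)) ^ p) 1"
    if "F \<in> level_one" for F
  proof (rule lift_to_completion_component)
    show *: "F oo fps_X ^ (p * m) \<in> S"
      unfolding root_ring_def using that by (auto intro: generated_incl)
    show "(F oo fps_X ^ (p * m)) ^ p \<in> S" by (rule subring_set_power[OF S *])
    show "cong_in T (of_nat p ^ 1) ((F oo fps_X ^ (p * m)) ^ p) (\<sigma> (F oo fps_X ^ (p * m)))"
      using cong_in_sym[OF T frobenius_congruence[OF that]] by simp
  qed
  ultimately show ?thesis
    unfolding is_frobenius_def Let_def
    using lift_hom generators_in_S by (simp add: lift_to_completion \<sigma>_generators del: of_nat_mult)
qed

lemma is_frobenius_frobenius: "is_frobenius \<zeta> level_one p m (frobenius \<zeta> level_one p m)"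
  unfolding frobenius_def by (rule someI[of _ lift]) (rule is_frobenius_lift)

text \<open>The elements where a Frobenius lift agrees with \<open>\<sigma>\<close> form a subring closed under inverses. It
  contains \<open>x^(1/(pm))\<close>, \<open>\<lambda>^(1/(pm))\<close> and \<open>\<zeta>_{pm}\<close>, and therefore everything.\<close>

lemma frobenius_tracks:
  assumes "F \<in> S"
  shows "tracks (frobenius \<zeta> level_one p m) F"
proof -
  define \<phi> where "\<phi> = frobenius \<zeta> level_one p m"
  have "is_frobenius \<zeta> level_one p m \<phi>"
    unfolding \<phi>_def by (rule is_frobenius_frobenius)
  then have hom: "\<phi> \<in> ring_hom completion completion"
    and vals: "\<And>i. \<phi> (\<iota> (xpow i (1 / of_nat (p * m)))) = \<iota> (xpow i (1 / of_nat m))"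
      "\<phi> (\<iota> fps_X) = \<iota> (fps_X ^ p)" "\<phi> (\<iota> (scalar (\<zeta> (p * m)))) = \<iota> (scalar (\<zeta> (p * m)))"
    unfolding is_frobenius_def Let_def by blast+
  let ?H = "{a. tracks \<phi> a}"
  have H: "subring_set ?H" by (rule subring_set_tracks[OF hom])
  have gens: "tracks \<phi> (xpow i (1 / of_nat (p * m)))" "tracks \<phi> fps_X" "tracks \<phi> (scalar (\<zeta> (p * m)))" for i
    by (rule tracksI, rule generators_in_S, unfold \<sigma>_generators, rule vals)+
  have "L \<subseteq> ?H"
  proof (rule laurent_polys_subset[OF H])
    have "subring_set {c. scalar c \<in> ?H}"
      using H by (auto simp: subring_set_def ring_hom_fun_one[OF ring_hom_fun_scalar]
          ring_hom_fun_diff[OF ring_hom_fun_scalar] ring_hom_fun_mult[OF ring_hom_fun_scalar])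
    then have "cyclotomic (p * m) \<subseteq> {c. scalar c \<in> ?H}"
      by (rule generated_subset) (use gens in auto)
    then show "\<And>c. c \<in> cyclotomic (p * m) \<Longrightarrow> scalar c \<in> ?H" by blast
    fix i and r :: rat assume r: "of_nat (p * m) * r \<in> \<int>"
    have pos: "xpow i 1 \<in> ?H"
    proof -
      have "xpow i 1 = xpow i (1 / of_nat (p * m)) ^ (p * m)" using M by (simp add: xpow_power)
      also have "\<dots> \<in> ?H" by (intro subring_set_power[OF H]) (use gens in blast)
      finally show ?thesis .
    qed
    have "tracks \<phi> (xpow i (- 1))"
    proof (rule tracks_inverse[OF hom])
      show "tracks \<phi> (xpow i 1)" using pos by blast
      have "of_nat (p * m) * (- 1 :: rat) \<in> \<int>" by simp
      from xpow_in_laurent_polys[OF subring_cyclotomic this] show "xpow i (- 1) \<in> S"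
        using laurent_subset_S by blast
      show "xpow i 1 * xpow i (- 1) = 1" by (simp add: xpow_mult xpow_zero)
    qed
    then show "xpow i r \<in> ?H"
      using gens by (intro xpow_in_subring[OF H M _ _ r]) auto
  qed (use gens in blast)
  moreover have "tracks \<phi> D'"
    by (rule tracks_inverse[OF hom _ D'_mem(1) D_mult_D'(1)])
      (use D_laurent calculation in blast)
  moreover obtain k P where "P \<in> L" "F = D' ^ k * P"
    using S_cases[OF assms] by metis
  ultimately have "F \<in> ?H"
    using subring_set_mult[OF H subring_set_power[OF H]] by blast
  then show ?thesis by (simp add: \<phi>_def)
qed

text \<open>Hence an equality in the p-adic completion of \<open>R_{pm}\<close> may be checked on the coefficients of
  power series.\<close>

lemma tendsto_frobenius:
  assumes F: "F \<in> S" and s: "\<And>K. s K \<in> S"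
    and cong: "\<And>N. \<forall>\<^sub>F K in sequentially. cong_in T (of_nat p ^ N) (s K) (\<sigma> F)"
  shows "padic_tendsto (\<lambda>K. \<iota> (s K)) (frobenius \<zeta> level_one p m (\<iota> F))"
  unfolding padic_tendsto_def
proof
  fix N
  define \<phi> where "\<phi> = frobenius \<zeta> level_one p m"
  have tr: "tracks \<phi> F" unfolding \<phi>_def by (rule frobenius_tracks[OF F])
  have "is_frobenius \<zeta> level_one p m \<phi>"
    unfolding \<phi>_def by (rule is_frobenius_frobenius)
  then have hom: "\<phi> \<in> ring_hom completion completion"
    unfolding is_frobenius_def Let_def by blast
  obtain t where t: "t \<in> \<phi> (\<iota> F) N" "t \<in> S" using \<phi>_component_nonempty[OF hom F] .
  have \<phi>F: "\<phi> (\<iota> F) N = residue_class S (of_nat p ^ N) t"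
    by (rule \<phi>_component(2)[OF hom F t(1)])
  have tF: "cong_in T (of_nat p ^ N) t (\<sigma> F)" using tr t(1) by (auto simp: tracks_def)
  show "\<forall>\<^sub>F K in sequentially. \<iota> (s K) N = frobenius \<zeta> level_one p m (\<iota> F) N"
    using cong[of N]
  proof eventually_elim
    case (elim K)
    have "cong_in S (of_nat p ^ N) (s K) t"
      by (rule cong_in_S[OF s t(2) cong_in_trans[OF T elim cong_in_sym[OF T tF]]])
    moreover have "\<iota> (s K) N = residue_class S (of_nat p ^ N) (s K)"
      by (simp add: to_completion_eq[OF S])
    ultimately show ?case
      unfolding \<phi>_def[symmetric] \<phi>F by (simp add: residue_class_eq_iff[OF S])
  qed
qed

end

section \<open>Recentring Laurent polynomials in \<open>q\<close>\<close>

lemma gbinomial_of_int_Ints: "((of_int e :: complex) gchoose k) \<in> \<int>"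
proof (cases "e \<ge> 0")
  case True
  then have "of_int e = (of_nat (nat e) :: complex)" by simp
  then have "((of_int e :: complex) gchoose k) = of_nat (nat e choose k)"
    by (simp only: binomial_gbinomial)
  then show ?thesis by simp
next
  case False
  then have e: "of_nat k - of_int e - 1 = (of_nat (nat (int k - e - 1)) :: complex)"
    by simp
  have "((of_int e :: complex) gchoose k) = (- 1) ^ k * of_nat (nat (int k - e - 1) choose k)"
    unfolding binomial_gbinomial e[symmetric] by (rule gbinomial_negated_upper)
  then show ?thesis by simp
qed

text \<open>The binomial series of \<open>(z + t)^e\<close>, written with integer powers of \<open>z\<close>.\<close>

definition root_power :: "complex \<Rightarrow> int \<Rightarrow> complex fps" where
  "root_power z e = Abs_fps (\<lambda>i. (of_int e gchoose i) * z powi (e - int i))"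

lemma root_power_nth: "fps_nth (root_power z e) i = (of_int e gchoose i) * z powi (e - int i)"
  by (simp add: root_power_def)

lemma root_power_add:
  assumes "z \<noteq> 0"
  shows "root_power z (a + b) = root_power z a * root_power z b"
proof (rule fps_ext)
  fix n
  have "fps_nth (root_power z a * root_power z b) n =
      (\<Sum>i=0..n. ((of_int a gchoose i) * (of_int b gchoose (n - i))) * z powi (a + b - int n))"
    unfolding fps_mult_nth
  proof (rule sum.cong[OF refl])
    fix i assume "i \<in> {0..n}"
    then have "z powi (a - int i) * z powi (b - int (n - i)) = z powi (a + b - int n)"
      using assms by (simp flip: power_int_add add: of_nat_diff algebra_simps)
    then show "fps_nth (root_power z a) i * fps_nth (root_power z b) (n - i) =
        ((of_int a gchoose i) * (of_int b gchoose (n - i))) * z powi (a + b - int n)"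
      by (simp add: root_power_nth)
  qed
  also have "\<dots> = fps_nth (root_power z (a + b)) n"
    unfolding sum_distrib_right[symmetric] gbinomial_Vandermonde by (simp add: root_power_nth)
  finally show "fps_nth (root_power z (a + b)) n = fps_nth (root_power z a * root_power z b) n" ..
qed

lemma root_power_zero: "root_power z 0 = 1"
  by (rule fps_ext) (simp add: root_power_nth gbinomial_0_left)

lemma root_power_one: "root_power z 1 = fps_const z + fps_X"
proof (rule fps_ext)
  fix n
  consider "n = 0" | "n = 1" | k where "n = Suc (Suc k)"
    by (metis One_nat_def not0_implies_Suc)
  then show "fps_nth (root_power z 1) n = fps_nth (fps_const z + fps_X) n"
  proof cases
    case 3
    have "(1 gchoose Suc (Suc k)) = (0 :: complex)"
      using gbinomial_Suc_Suc[of "0 :: complex" "Suc k"] by (simp add: gbinomial_0_left)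
    then show ?thesis using 3 by (simp add: root_power_nth)
  qed (simp_all add: root_power_nth)
qed

lemma root_power_of_nat: "z \<noteq> 0 \<Longrightarrow> root_power z (int n) = (fps_const z + fps_X) ^ n"
proof (induction n)
  case (Suc n)
  then show ?case
    using root_power_add[of z 1 "int n"] by (simp add: root_power_one)
qed (simp add: root_power_zero)

lemma powi_eq_root_power:
  assumes "z \<noteq> 0"
  shows "(fps_const z + fps_X) powi e = root_power z e"
proof (cases "e \<ge> 0")
  case True
  then show ?thesis
    using root_power_of_nat[OF assms, of "nat e"] by (simp add: power_int_def)
next
  case False
  define n where "n = nat (- e)"
  have e: "e = - int n" using False by (simp add: n_def)
  let ?u = "fps_const z + fps_X"
  have "fps_nth ?u 0 \<noteq> 0" using assms by simp
  then have inv: "inverse ?u * ?u = 1" by (rule inverse_mult_eq_1)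
  have "root_power z e * ?u ^ n = 1"
    using root_power_add[OF assms, of e "int n"] by (simp add: e root_power_zero root_power_of_nat[OF assms])
  then have "root_power z e * (inverse ?u * ?u) ^ n = inverse ?u ^ n"
    by (simp add: power_mult_distrib mult_ac)
  then have "root_power z e = inverse ?u ^ n" by (simp add: inv)
  then show ?thesis using False by (simp add: power_int_def n_def)
qed

lemma expand_q_eq_keysum:
  "z \<noteq> 0 \<Longrightarrow> expand_q z = keysum (\<lambda>e x. of_int x * root_power z e)"
  by (rule ext) (simp add: expand_q_def keysum_def powi_eq_root_power)

lemma coefficient_additive_expand: "coefficient_additive (\<lambda>e x. of_int x * root_power z e)"
  by (simp add: coefficient_additive_def distrib_right)

lemma expand_q_single:
  "z \<noteq> 0 \<Longrightarrow> expand_q z (Poly_Mapping.single e x) = of_int x * root_power z e"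
  by (simp add: expand_q_eq_keysum keysum_single)

lemma ring_hom_fun_expand_q:
  assumes "z \<noteq> 0" shows "ring_hom_fun (expand_q z)"
proof -
  have "expand_q z 1 = 1"
    using expand_q_single[OF assms, of 0 1] by (simp add: root_power_zero)
  moreover have "expand_q z (f * g) = expand_q z f * expand_q z g" for f g
    unfolding expand_q_eq_keysum[OF assms]
    by (rule keysum_mult[OF coefficient_additive_expand])
      (simp add: root_power_add[OF assms] mult_ac)
  ultimately show ?thesis
    by (auto simp: ring_hom_fun_def expand_q_eq_keysum[OF assms] keysum_add[OF coefficient_additive_expand])
qed

lemma powi_in_subring:
  assumes "subring_set \<O>" "z \<in> \<O>" "inverse z \<in> \<O>" shows "z powi e \<in> \<O>"
  using assms by (auto simp: power_int_def subring_set_power)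

lemma gbinomial_in_subring:
  assumes "subring_set \<O>" shows "((of_int e :: complex) gchoose k) \<in> \<O>"
  using gbinomial_of_int_Ints[of e k] subring_set_of_int[OF assms] by (metis Ints_cases)

text \<open>The binomial series of \<open>(z + \<delta>)\<^sup>e\<close>, cut off at \<open>\<delta>\<^sup>K\<close>, is correct modulo \<open>\<delta>\<^sup>K\<close>. Both sides
  are multiplied by \<open>z + \<delta>\<close> when \<open>e\<close> increases by one, so this follows for all integers \<open>e\<close> from
  the case \<open>e = 0\<close>.\<close>

lemma truncated_binomial_series:
  fixes z \<delta> :: complex
  assumes \<O>: "subring_set \<O>" and z: "z \<noteq> 0" "z \<in> \<O>" "inverse z \<in> \<O>"
    and \<delta>: "\<delta> \<in> \<O>" and y: "z + \<delta> \<noteq> 0" "inverse (z + \<delta>) \<in> \<O>" and K: "K > 0"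
  shows "cong_in \<O> (\<delta> ^ K) (\<Sum>k<K. (of_int e gchoose k) * \<delta> ^ k * z powi (e - int k)) ((z + \<delta>) powi e)"
proof -
  define R where "R K e = (\<Sum>k<K. (of_int e gchoose k) * \<delta> ^ k * z powi (e - int k))" for K :: nat and e :: int
  have yO: "z + \<delta> \<in> \<O>" using subring_set_add[OF \<O> z(2) \<delta>] .
  have tail: "cong_in \<O> (\<delta> ^ K) (x + c * ((of_int e gchoose K) * \<delta> ^ K * z powi (e - int K))) x"
    if "c \<in> \<O>" for x c e
  proof -
    have "c * ((of_int e gchoose K) * z powi (e - int K)) \<in> \<O>"
      using that z by (intro subring_set_mult[OF \<O>] gbinomial_in_subring[OF \<O>] powi_in_subring[OF \<O>])
    moreover have "x + c * ((of_int e gchoose K) * \<delta> ^ K * z powi (e - int K)) - x =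
        \<delta> ^ K * (c * ((of_int e gchoose K) * z powi (e - int K)))"
      by simp
    ultimately show ?thesis unfolding cong_in_def by blast
  qed
  have pascal: "((of_int (e + 1) :: complex) gchoose Suc k) = (of_int e gchoose k) + (of_int e gchoose Suc k)"
    for e k
    using gbinomial_Suc_Suc[of "of_int e :: complex" k] by simp
  have step: "cong_in \<O> (\<delta> ^ K) (R K (e + 1)) ((z + \<delta>) * R K e)" for e
  proof -
    \<comment> \<open>By Pascal's rule the truncated series for \<open>e + 1\<close> is \<open>z + \<delta>\<close> times that for \<open>e\<close>, up to a
      term with the factor \<open>\<delta>\<^sup>K\<close>.\<close>
    have "R (Suc K) (e + 1) = z powi (e + 1) +
        (\<Sum>k<K. (of_int (e + 1) gchoose Suc k) * \<delta> ^ Suc k * z powi (e + 1 - int (Suc k)))"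
      unfolding R_def sum.lessThan_Suc_shift by simp
    also have "(\<Sum>k<K. (of_int (e + 1) gchoose Suc k) * \<delta> ^ Suc k * z powi (e + 1 - int (Suc k))) =
        (\<Sum>k<K. (of_int e gchoose Suc k) * \<delta> ^ Suc k * z powi (e + 1 - int (Suc k))) + \<delta> * R K e"
      unfolding R_def sum_distrib_left sum.distrib[symmetric]
      unfolding pascal by (rule sum.cong) (simp_all add: algebra_simps)
    also have "z powi (e + 1) +
        ((\<Sum>k<K. (of_int e gchoose Suc k) * \<delta> ^ Suc k * z powi (e + 1 - int (Suc k))) + \<delta> * R K e) =
        (\<Sum>k<Suc K. (of_int e gchoose k) * \<delta> ^ k * z powi (e + 1 - int k)) + \<delta> * R K e"
      unfolding sum.lessThan_Suc_shift by simp
    also have "(\<Sum>k<Suc K. (of_int e gchoose k) * \<delta> ^ k * z powi (e + 1 - int k)) = z * R (Suc K) e"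
      unfolding R_def sum_distrib_left
      using z(1) by (intro sum.cong) (simp_all add: power_int_add_1' [symmetric] algebra_simps flip: power_int_add_1)
    finally have eq: "R (Suc K) (e + 1) = (z + \<delta>) * R K e + z * ((of_int e gchoose K) * \<delta> ^ K * z powi (e - int K))"
      by (simp add: R_def algebra_simps)
    have eq': "R (Suc K) (e + 1) = R K (e + 1) + 1 * ((of_int (e + 1) gchoose K) * \<delta> ^ K * z powi (e + 1 - int K))"
      by (simp add: R_def)
    have "cong_in \<O> (\<delta> ^ K) (R (Suc K) (e + 1)) (R K (e + 1))"
      unfolding eq' by (rule tail[OF subring_set_one[OF \<O>]])
    moreover have "cong_in \<O> (\<delta> ^ K) (R (Suc K) (e + 1)) ((z + \<delta>) * R K e)"
      unfolding eq by (rule tail[OF z(2)])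
    ultimately show ?thesis by (meson \<O> cong_in_sym cong_in_trans)
  qed
  have "cong_in \<O> (\<delta> ^ K) (R K e) ((z + \<delta>) powi e)"
  proof (induction e rule: int_induct[of _ 0])
    case base
    have "R K 0 = (\<Sum>k<K. if k = 0 then 1 else 0)"
      unfolding R_def by (intro sum.cong) (auto simp: gbinomial_0_left)
    also have "\<dots> = 1" using K by simp
    finally show ?case by (simp add: cong_in_refl[OF \<O>])
  next
    case (step1 e)
    have "cong_in \<O> (\<delta> ^ K) (R K (e + 1)) ((z + \<delta>) * (z + \<delta>) powi e)"
      by (rule cong_in_trans[OF \<O> step cong_in_mult_left[OF \<O> step1(2) yO]])
    then show ?case using y(1) by (simp add: power_int_add_1')
  next
    case (step2 e)
    have "cong_in \<O> (\<delta> ^ K) ((z + \<delta>) * R K (e - 1)) ((z + \<delta>) powi e)"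
      using cong_in_trans[OF \<O> cong_in_sym[OF \<O> step[of "e - 1"]]] step2(2) by simp
    from cong_in_mult_left[OF \<O> this y(2)]
    have "cong_in \<O> (\<delta> ^ K) (inverse (z + \<delta>) * (z + \<delta>) * R K (e - 1)) (inverse (z + \<delta>) * (z + \<delta>) powi e)"
      by (simp only: mult.assoc)
    moreover have "inverse (z + \<delta>) * (z + \<delta>) = 1" using y(1) by (rule left_inverse)
    moreover have "inverse (z + \<delta>) * (z + \<delta>) powi e = (z + \<delta>) powi (e - 1)"
      using y(1) by (simp add: power_int_diff divide_inverse mult.commute)
    ultimately show ?case by simp
  qed
  then show ?thesis by (simp add: R_def)
qed

text \<open>The coefficients of the Taylor expansion of a Laurent polynomial at \<open>z + \<delta>\<close> are obtained from
  those at \<open>z\<close> by Taylor's formula, with an error that depends on the number of terms only.\<close>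

lemma recentre_expand_q:
  assumes \<O>: "subring_set \<O>" and z: "z \<noteq> 0" "z \<in> \<O>" "inverse z \<in> \<O>"
    and \<delta>: "\<delta> \<in> \<O>" and y: "z + \<delta> \<noteq> 0" "inverse (z + \<delta>) \<in> \<O>" and K: "K > 0"
  shows "cong_in \<O> (\<delta> ^ K)
    (\<Sum>k<K. of_nat ((j + k) choose j) * \<delta> ^ k * fps_nth (expand_q z w) (j + k))
    (fps_nth (expand_q (z + \<delta>) w) j)"
proof -
  have yO: "z + \<delta> \<in> \<O>" using subring_set_add[OF \<O> z(2) \<delta>] .
  have monomial: "cong_in \<O> (\<delta> ^ K)
    (\<Sum>k<K. of_nat ((j + k) choose j) * \<delta> ^ k * fps_nth (root_power z e) (j + k))
    (fps_nth (root_power (z + \<delta>) e) j)" for e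
  proof -
    have "(\<Sum>k<K. of_nat ((j + k) choose j) * \<delta> ^ k * fps_nth (root_power z e) (j + k)) =
       (of_int e gchoose j) * (\<Sum>k<K. (of_int (e - int j) gchoose k) * \<delta> ^ k * z powi (e - int j - int k))"
      unfolding sum_distrib_left
    proof (rule sum.cong[OF refl])
      fix k
      have "of_nat ((j + k) choose j) * (of_int e gchoose (j + k)) =
          (of_int e gchoose j) * ((of_int (e - int j) :: complex) gchoose k)"
        using gbinomial_trinomial_revision[of j "j + k" "of_int e :: complex"]
        unfolding binomial_gbinomial[symmetric] by (simp add: mult.commute)
      then show "of_nat ((j + k) choose j) * \<delta> ^ k * fps_nth (root_power z e) (j + k) =
          (of_int e gchoose j) * ((of_int (e - int j) gchoose k) * \<delta> ^ k * z powi (e - int j - int k))"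
        unfolding root_power_nth by (simp add: algebra_simps)
    qed
    then show ?thesis
      unfolding root_power_nth
      using cong_in_mult_left[OF \<O> truncated_binomial_series[OF assms, of "e - int j"]
          gbinomial_in_subring[OF \<O>]] by simp
  qed
  have nth: "fps_nth (expand_q x w) i = (\<Sum>e\<in>Poly_Mapping.keys w.
      of_int (Poly_Mapping.lookup w e) * fps_nth (root_power x e) i)" if "x \<noteq> 0" for x i
    unfolding expand_q_eq_keysum[OF that] keysum_def fps_sum_nth by (simp flip: fps_of_int)
  have "(\<Sum>k<K. of_nat ((j + k) choose j) * \<delta> ^ k * fps_nth (expand_q z w) (j + k)) =
      (\<Sum>e\<in>Poly_Mapping.keys w. of_int (Poly_Mapping.lookup w e) *
        (\<Sum>k<K. of_nat ((j + k) choose j) * \<delta> ^ k * fps_nth (root_power z e) (j + k)))"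
    unfolding nth[OF z(1)] sum_distrib_left by (subst sum.swap) (simp add: mult_ac)
  then show ?thesis
    unfolding nth[OF y(1)]
    using cong_in_sum[OF \<O> cong_in_mult_left[OF \<O> monomial subring_set_of_int[OF \<O>]]] by simp
qed

section \<open>Gluing of expansions\<close>

lemma lookup_scalar_mult:
  "Poly_Mapping.lookup (fps_nth (scalar z * F) n) a = z * Poly_Mapping.lookup (fps_nth F n) a"
  unfolding scalar_def fps_mult_left_const_nth mult_map_scale_conv_mult[symmetric]
  by (simp add: map.rep_eq when_def)

lemma of_nat_eq_scalar: "of_nat n = scalar (of_nat n)"
  by (simp add: ring_hom_fun_of_nat[OF ring_hom_fun_scalar])

lemma cong_in_integral_seriesI:
  assumes "c > 0"
    and "\<And>n a. cong_in \<O> (of_nat c) (Poly_Mapping.lookup (fps_nth F n) a) (Poly_Mapping.lookup (fps_nth G n) a)"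
  shows "cong_in (integral_series \<O>) (of_nat c) F G"
proof -
  define s where "s = scalar (1 / of_nat c) * (F - G)"
  have "Poly_Mapping.lookup (fps_nth s n) a \<in> \<O>" for n a
  proof -
    obtain x where "x \<in> \<O>" "Poly_Mapping.lookup (fps_nth (F - G) n) a = of_nat c * x"
      using assms(2)[of n a] by (auto simp: cong_in_def lookup_minus)
    then show ?thesis using assms(1) by (simp add: s_def lookup_scalar_mult)
  qed
  then have "s \<in> integral_series \<O>"
    by (auto simp: integral_series_def coeff_ring_def)
  moreover have "F - G = of_nat c * s"
    using assms(1) unfolding s_def of_nat_eq_scalar mult.assoc[symmetric]
    by (simp flip: ring_hom_fun_mult[OF ring_hom_fun_scalar] add: ring_hom_fun_one[OF ring_hom_fun_scalar])
  ultimately show ?thesis unfolding cong_in_def by blast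
qed

lemma expansion_nth:
  "fps_nth (fps_nth (expansion \<zeta> f m) j) N = (\<Sum>a\<in>Poly_Mapping.keys (fps_nth f N).
     Poly_Mapping.single (\<chi> i. of_int (a $ i) / of_nat m)
       (fps_nth (expand_q (\<zeta> m) (Poly_Mapping.lookup (fps_nth f N) a)) j))"
  by (simp add: expansion_def)

context habiro_setting
begin

lemma inverse_root:
  assumes "n > 0" "\<zeta> n \<in> cyclotomic l"
  shows "\<zeta> n \<noteq> 0" "inverse (\<zeta> n) \<in> cyclotomic l"
proof -
  have 1: "\<zeta> n ^ n = 1" using primitive[OF assms(1)] by (simp add: primitive_root_of_unity_def)
  then show "\<zeta> n \<noteq> 0" using assms(1) by (metis power_0_left less_numeral_extra(3) zero_neq_one)
  have "\<zeta> n * \<zeta> n ^ (n - 1) = 1"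
    using 1 assms(1) by (simp flip: power_Suc)
  then have "inverse (\<zeta> n) = \<zeta> n ^ (n - 1)" by (rule inverse_unique)
  then show "inverse (\<zeta> n) \<in> cyclotomic l"
    using subring_set_power[OF subring_cyclotomic assms(2)] by simp
qed

end

context frobenius_setting
begin

abbreviation "\<delta> \<equiv> \<zeta> (p * m) - \<zeta> m"

lemma root_in_cyclotomic: "\<zeta> (p * m) \<in> cyclotomic (p * m)" "\<zeta> m \<in> cyclotomic (p * m)"
  using cyclotomic_mono[OF m p] by (auto intro: generated_incl)

text \<open>If \<open>p\<^sup>r\<close> is the largest power of \<open>p\<close> that divides \<open>m\<close>, then \<open>\<zeta>_{pm}\<close> and \<open>\<zeta>_m\<close> have the same
  power with exponent \<open>p\<^sup>r\<^sup>+\<^sup>1\<close>. By the freshman's dream this power of their difference vanishes modulo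
  \<open>p\<close>.\<close>

lemma difference_nilpotent: "\<exists>n. cong_in (cyclotomic (p * m)) (of_nat p) (\<delta> ^ n) 0"
proof -
  define r where "r = multiplicity p m"
  have np: "\<not> is_unit p" using prime by (metis not_prime_unit)
  then obtain m' where m': "m = p ^ r * m'" "\<not> p dvd m'"
    using multiplicity_decompose'[of m p] m by (auto simp: r_def)
  have m'0: "m' \<ge> 1" using m m' by (cases m') auto
  have cop: "coprime (p ^ k) m'" for k
    using prime m'(2) by (simp add: prime_imp_coprime)
  have mult: "\<zeta> (p ^ k * m') = \<zeta> (p ^ k) * \<zeta> m'" for k
    using roots cop[of k] m'0 p by (auto simp: compatible_roots_def)
  have one: "\<zeta> (p ^ k) ^ (p ^ k) = 1" for k
    using primitive[of "p ^ k"] p by (simp add: primitive_root_of_unity_def)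
  have "\<zeta> m ^ p ^ Suc r = \<zeta> m' ^ p ^ Suc r"
    using one[of r] unfolding m'(1) mult power_mult_distrib by (simp add: power_mult mult.commute[of p])
  moreover have "\<zeta> (p * m) ^ p ^ Suc r = \<zeta> m' ^ p ^ Suc r"
    using one[of "Suc r"] mult[of "Suc r"] unfolding m'(1) by (simp add: power_mult_distrib mult_ac)
  ultimately have eq: "\<zeta> (p * m) ^ p ^ Suc r = \<zeta> m ^ p ^ Suc r" by simp
  have \<delta>: "\<delta> \<in> cyclotomic (p * m)"
    using root_in_cyclotomic by (intro subring_set_diff[OF subring_cyclotomic])
  have "cong_in (cyclotomic (p * m)) (of_nat p) ((\<delta> + \<zeta> m) ^ p ^ Suc r) (\<delta> ^ p ^ Suc r + \<zeta> m ^ p ^ Suc r)"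
    by (rule cong_in_prime_power_power_add[OF subring_cyclotomic prime \<delta> root_in_cyclotomic(2)])
  then have "cong_in (cyclotomic (p * m)) (of_nat p) (\<zeta> m ^ p ^ Suc r) (\<delta> ^ p ^ Suc r + \<zeta> m ^ p ^ Suc r)"
    by (simp only: diff_add_cancel eq)
  from cong_in_diff[OF subring_cyclotomic cong_in_sym[OF subring_cyclotomic this]
      cong_in_refl[OF subring_cyclotomic], of "\<zeta> m ^ p ^ Suc r"]
  show ?thesis by (auto simp only: add_diff_cancel_right' diff_self)
qed

lemma difference_power_divisible:
  obtains K\<^sub>0 where "K\<^sub>0 > 0"
    "\<And>K. K \<ge> K\<^sub>0 \<Longrightarrow> \<exists>s\<in>cyclotomic (p * m). \<delta> ^ K = of_nat p ^ N * s"
proof -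
  obtain n s where s: "s \<in> cyclotomic (p * m)" "\<delta> ^ n = of_nat p * s"
    using difference_nilpotent by (auto simp: cong_in_def)
  have \<delta>: "\<delta> \<in> cyclotomic (p * m)"
    using root_in_cyclotomic by (intro subring_set_diff[OF subring_cyclotomic])
  have "\<exists>s\<in>cyclotomic (p * m). \<delta> ^ K = of_nat p ^ N * s" if "K \<ge> n * N + 1" for K
  proof (intro bexI)
    have "\<delta> ^ K = (\<delta> ^ n) ^ N * \<delta> ^ (K - n * N)"
      using that by (simp flip: power_mult power_add)
    then show "\<delta> ^ K = of_nat p ^ N * (s ^ N * \<delta> ^ (K - n * N))"
      by (simp add: s(2) power_mult_distrib)
    show "s ^ N * \<delta> ^ (K - n * N) \<in> cyclotomic (p * m)"
      using s(1) \<delta> by (intro subring_set_mult[OF subring_cyclotomic] subring_set_power[OF subring_cyclotomic])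
  qed
  then show thesis using that[of "n * N + 1"] by simp
qed

text \<open>Both sides have the same monomials \<open>x^(a/m) \<lambda>^(n/m)\<close>, and the number of terms that Taylor's formula
  needs for precision \<open>p\<^sup>N\<close> is the same for all of them.\<close>

lemma recentre_expansion:
  "\<forall>\<^sub>F K in sequentially. cong_in T (of_nat p ^ N)
     (recentre_partial \<zeta> p m (expansion \<zeta> f m) j K) (\<sigma> (fps_nth (expansion \<zeta> f (p * m)) j))"
proof -
  let ?O = "cyclotomic (p * m)"
  obtain K\<^sub>0 where K\<^sub>0: "K\<^sub>0 > 0" "\<And>K. K \<ge> K\<^sub>0 \<Longrightarrow> \<exists>s\<in>?O. \<delta> ^ K = of_nat p ^ N * s"
    by (rule difference_power_divisible[of N]) blast
  have \<delta>: "\<delta> \<in> ?O"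
    using root_in_cyclotomic by (intro subring_set_diff[OF subring_cyclotomic])
  have "cong_in T (of_nat (p ^ N)) (recentre_partial \<zeta> p m (expansion \<zeta> f m) j K)
      (\<sigma> (fps_nth (expansion \<zeta> f (p * m)) j))" if K: "K \<ge> K\<^sub>0" for K
  proof (rule cong_in_integral_seriesI)
    show "p ^ N > 0" using p by simp
    fix n and b :: "rat ^ 'a"
    obtain s where s: "s \<in> ?O" "\<delta> ^ K = of_nat (p ^ N) * s" using K\<^sub>0(2)[OF K] by auto
    define e :: "int ^ 'a \<Rightarrow> rat ^ 'a" where "e a = (\<chi> i. of_int (a $ i) / of_nat m)" for a :: "int ^ 'a"
    show "cong_in ?O (of_nat (p ^ N))
      (Poly_Mapping.lookup (fps_nth (recentre_partial \<zeta> p m (expansion \<zeta> f m) j K) n) b)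
      (Poly_Mapping.lookup (fps_nth (\<sigma> (fps_nth (expansion \<zeta> f (p * m)) j)) n) b)"
    proof (cases "p dvd n")
      case False
      then have "fps_nth (recentre_partial \<zeta> p m (expansion \<zeta> f m) j K) n = 0"
        by (auto simp: recentre_partial_def fps_sum_nth compose_X_power[OF p] of_nat_eq_scalar
            ring_hom_fun_power[OF ring_hom_fun_scalar, symmetric] scalar_def stretch_nth
            intro!: sum.neutral)
      moreover have "fps_nth (\<sigma> (fps_nth (expansion \<zeta> f (p * m)) j)) n = 0"
        using False by (simp add: frob_subst_def stretch_nth)
      ultimately show ?thesis by (simp add: cong_in_refl[OF subring_cyclotomic])
    next
      case True
      define g where "g = fps_nth f (n div p)"
      let ?w = "\<lambda>a. Poly_Mapping.lookup g a"
      have "Poly_Mapping.lookup (fps_nth (recentre_partial \<zeta> p m (expansion \<zeta> f m) j K) n) b =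
          (\<Sum>k<K. of_nat ((j + k) choose j) * \<delta> ^ k *
            Poly_Mapping.lookup (fps_nth (stretch p (fps_nth (expansion \<zeta> f m) (j + k))) n) b)"
        unfolding recentre_partial_def fps_sum_nth lookup_sum compose_X_power[OF p] of_nat_eq_scalar
          ring_hom_fun_power[OF ring_hom_fun_scalar, symmetric] mult.assoc lookup_scalar_mult ..
      also have "\<dots> = (\<Sum>k<K. of_nat ((j + k) choose j) * \<delta> ^ k *
          (\<Sum>a\<in>Poly_Mapping.keys g. if e a = b then fps_nth (expand_q (\<zeta> m) (?w a)) (j + k) else 0))"
        unfolding stretch_nth expansion_nth g_def e_def
        using True by (simp add: lookup_sum lookup_single when_def)
      also have "\<dots> = (\<Sum>a\<in>Poly_Mapping.keys g. if e a = b then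
          (\<Sum>k<K. of_nat ((j + k) choose j) * \<delta> ^ k * fps_nth (expand_q (\<zeta> m) (?w a)) (j + k)) else 0)"
        unfolding sum_distrib_left by (subst sum.swap) (intro sum.cong refl, auto)
      finally have lhs: "Poly_Mapping.lookup (fps_nth (recentre_partial \<zeta> p m (expansion \<zeta> f m) j K) n) b = \<dots>" .
      have scale: "of_nat p *s (\<chi> i. of_int (a $ i) / of_nat (p * m)) = e a" for a :: "int ^ 'a"
        using p by (simp add: vec_eq_iff e_def)
      have "fps_nth (\<sigma> (fps_nth (expansion \<zeta> f (p * m)) j)) n = (\<Sum>a\<in>Poly_Mapping.keys g.
          Poly_Mapping.single (e a) (fps_nth (expand_q (\<zeta> (p * m)) (?w a)) j))"
        using True unfolding frob_subst_def stretch_nth map_coeffs_nth expansion_nth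
          ring_hom_fun_sum[OF ring_hom_fun_scale_exponents] scale_exponents_single scale
        by (simp add: g_def)
      then have rhs: "Poly_Mapping.lookup (fps_nth (\<sigma> (fps_nth (expansion \<zeta> f (p * m)) j)) n) b =
          (\<Sum>a\<in>Poly_Mapping.keys g. if e a = b then fps_nth (expand_q (\<zeta> (p * m)) (?w a)) j else 0)"
        by (simp add: lookup_sum lookup_single when_def)
      have "cong_in ?O (of_nat (p ^ N))
          (\<Sum>k<K. of_nat ((j + k) choose j) * \<delta> ^ k * fps_nth (expand_q (\<zeta> m) w) (j + k))
          (fps_nth (expand_q (\<zeta> (p * m)) w) j)" for w
      proof (rule cong_in_coarser[OF subring_cyclotomic _ s(1)])
        have "K > 0" using K\<^sub>0(1) K by simp
        from recentre_expand_q[OF subring_cyclotomic _ root_in_cyclotomic(2) _ \<delta> _ _ this, where j = j and w = w]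
        show "cong_in ?O (of_nat (p ^ N) * s)
          (\<Sum>k<K. of_nat ((j + k) choose j) * \<delta> ^ k * fps_nth (expand_q (\<zeta> m) w) (j + k))
          (fps_nth (expand_q (\<zeta> (p * m)) w) j)"
          using inverse_root[OF m root_in_cyclotomic(2)] inverse_root[OF M root_in_cyclotomic(1)]
          unfolding s(2)[symmetric] by simp
      qed
      then show ?thesis
        unfolding lhs rhs
        by (intro cong_in_sum[OF subring_cyclotomic]) (auto simp: cong_in_refl[OF subring_cyclotomic])
    qed
  qed
  then show ?thesis
    unfolding eventually_sequentially by auto
qed

lemma recentre_partial_in_level:
  assumes "\<And>j. fps_nth F j \<in> level m"
  shows "recentre_partial \<zeta> p m F j K \<in> S"
proof -
  have "scalar \<delta> \<in> L"
    by (intro scalar_in_laurent_polys subring_cyclotomic subring_set_diff[OF subring_cyclotomic]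
        root_in_cyclotomic)
  then have "scalar \<delta> \<in> S" using laurent_subset_S by blast
  then show ?thesis
    unfolding recentre_partial_def
    by (intro subring_set_sum[OF S] subring_set_mult[OF S] subring_set_power[OF S]
        subring_set_of_nat[OF S] level_stretch[OF m p] assms)
qed

end

text \<open>The gluing conditions hold for the expansions of every series in \<open>\<int>[q\<^sup>\<plusminus>\<^sup>1, x\<^sup>\<plusminus>\<^sup>1][[\<lambda>]]\<close>. What
  singles out the elements of the Habiro ring is that the coefficients lie in the rings \<open>R_m\<close>.\<close>

lemma (in habiro_setting) expansion_in_habiro_ring:
  assumes "\<And>m j. m > 0 \<Longrightarrow> fps_nth (expansion \<zeta> f m) j \<in> level m"
  shows "expansion \<zeta> f \<in> habiro_ring \<zeta> level_one"
proof -
  have "padic_tendsto (\<lambda>K. to_completion (subring_on (level (p * m))) p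
          (recentre_partial \<zeta> p m (expansion \<zeta> f m) j K))
        (frobenius \<zeta> level_one p m (to_completion (subring_on (level (p * m))) p
          (fps_nth (expansion \<zeta> f (p * m)) j)))" if "prime p" "m > 0" for p m j
  proof -
    interpret frobenius_setting \<zeta> h p m by unfold_locales fact+
    show ?thesis
      by (intro tendsto_frobenius recentre_partial_in_level recentre_expansion assms M m)
  qed
  then show ?thesis
    unfolding habiro_ring_def Let_def using assms by auto
qed

section \<open>Convolution of the coefficients\<close>

definition vectors :: "'a set \<Rightarrow> ('a \<Rightarrow> nat) set" where
  "vectors A = {k. \<forall>\<alpha>. \<alpha> \<notin> A \<longrightarrow> k \<alpha> = 0}"

definition unit_vector :: "'a \<Rightarrow> nat \<Rightarrow> 'a \<Rightarrow> nat" where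
  "unit_vector \<alpha> n = (\<lambda>x. if x = \<alpha> then n else 0)"

lemma unit_vector_le_iff: "unit_vector \<alpha> n \<le> k \<longleftrightarrow> n \<le> k \<alpha>"
  by (auto simp: unit_vector_def le_fun_def)

lemma unit_vector_in_vectors: "\<alpha> \<in> A \<Longrightarrow> unit_vector \<alpha> n \<in> vectors A"
  by (auto simp: unit_vector_def vectors_def)

lemma sum_unit_vector: "finite A \<Longrightarrow> \<alpha> \<in> A \<Longrightarrow> sum (unit_vector \<alpha> n) A = n"
  by (simp add: unit_vector_def)

lemma diff_in_vectors: "k \<in> vectors A \<Longrightarrow> k - \<beta> \<in> vectors A"
  by (auto simp: vectors_def)

lemma sum_diff_vector:
  fixes k \<beta> :: "'a \<Rightarrow> nat"
  assumes "\<beta> \<le> k" shows "sum (k - \<beta>) A = sum k A - sum \<beta> A"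
  using assms by (simp add: sum_subtractf_nat le_fun_def)

lemma sum_diff_unit_vector:
  fixes k :: "'a \<Rightarrow> nat"
  assumes "finite A" "\<alpha> \<in> A" "k \<alpha> > 0" shows "sum (k - unit_vector \<alpha> 1) A = sum k A - 1"
proof -
  have "unit_vector \<alpha> 1 \<le> k" using assms by (simp add: unit_vector_le_iff)
  then show ?thesis
    unfolding sum_diff_vector[OF \<open>unit_vector \<alpha> 1 \<le> k\<close>] sum_unit_vector[OF assms(1,2)] by simp
qed

lemma finite_bounded_vectors:
  assumes "finite A" shows "finite {k \<in> vectors A. sum k A \<le> n}"
proof (rule finite_subset)
  show "{k \<in> vectors A. sum k A \<le> n} \<subseteq> {k. k \<in> (A \<rightarrow> {..n}) \<and> (\<forall>\<alpha>. \<alpha> \<notin> A \<longrightarrow> k \<alpha> = 0)}"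
    using assms by (auto simp: vectors_def intro: order_trans[OF member_le_sum])
  have "{k. k \<in> (A \<rightarrow> {..n}) \<and> (\<forall>\<alpha>. \<alpha> \<notin> A \<longrightarrow> k \<alpha> = 0)} =
      {k. \<forall>\<alpha>. (\<alpha> \<in> A \<longrightarrow> k \<alpha> \<in> {..n}) \<and> (\<alpha> \<notin> A \<longrightarrow> k \<alpha> = 0)}"
    by auto
  also have "finite \<dots>" using assms by (intro finite_set_of_finite_funs) auto
  finally show "finite {k. k \<in> (A \<rightarrow> {..n}) \<and> (\<forall>\<alpha>. \<alpha> \<notin> A \<longrightarrow> k \<alpha> = 0)}" .
qed

lemma finite_vectors_sum:
  assumes "finite A" shows "finite {k \<in> vectors A. sum k A = n}"
  by (rule finite_subset[OF _ finite_bounded_vectors[OF assms, of n]]) auto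

text \<open>The \<open>q\<close>-analogue of the multinomial recursion: with respect to a linear order of the index set,
  \<open>1 - q\<^sup>N\<close> telescopes into multiples of the factors \<open>1 - q\<^bsup>k \<alpha>\<^esup>\<close>.\<close>

lemma telescope_one_minus_monom:
  fixes r :: "'a \<Rightarrow> nat" and k :: "'a \<Rightarrow> nat"
  assumes "finite A" "inj_on r A"
  shows "(\<Sum>\<alpha>\<in>A. Polynomial.monom 1 (\<Sum>\<beta>\<in>{\<beta>\<in>A. r \<beta> < r \<alpha>}. k \<beta>) * (1 - Polynomial.monom 1 (k \<alpha>)))
    = 1 - (Polynomial.monom 1 (sum k A) :: int poly)"
  using assms
proof (induction A rule: finite_ranking_induct[where f = r])
  case empty
  show ?case by (simp add: monom_0)
next
  case (insert x S)
  show ?case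
  proof (cases "x \<in> S")
    case True
    then show ?thesis using insert by (simp add: insert_absorb)
  next
    case False
    have lt: "r \<beta> < r x" if "\<beta> \<in> S" for \<beta>
      using insert.prems insert.hyps(2)[OF that] that False
      by (metis inj_on_insert image_eqI le_neq_implies_less Diff_iff Diff_insert_absorb)
    have "{\<beta> \<in> insert x S. r \<beta> < r x} = S" using lt by auto
    moreover have "{\<beta> \<in> insert x S. r \<beta> < r \<alpha>} = {\<beta> \<in> S. r \<beta> < r \<alpha>}" if "\<alpha> \<in> S" for \<alpha>
      using lt[OF that] by auto
    ultimately show ?thesis
      using insert False by (simp add: algebra_simps mult_monom)
  qed
qed

lemma q_pochhammer_nonzero: "q_pochhammer n \<noteq> 0"
proof (induction n)
  case (Suc n)
  have "1 - Polynomial.monom 1 (Suc n) \<noteq> (0 :: int poly)"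
  proof
    assume "1 - Polynomial.monom 1 (Suc n) = (0 :: int poly)"
    then have "Polynomial.coeff (1 - Polynomial.monom 1 (Suc n) :: int poly) 0 = 0" by simp
    then show False by simp
  qed
  with Suc show ?case by (simp add: q_pochhammer_Suc)
qed (simp add: q_pochhammer_def)

lemma q_multinomial_mult:
  "finite A \<Longrightarrow> q_multinomial A k * (\<Prod>\<alpha>\<in>A. q_pochhammer (k \<alpha>)) = q_pochhammer (sum k A)"
  unfolding q_multinomial_def using prod_q_pochhammer_dvd by (rule dvd_div_mult_self)

lemma q_multinomial_pascal:
  fixes r :: "'a \<Rightarrow> nat"
  assumes A: "finite A" and r: "inj_on r A" and k: "sum k A > 0"
  shows "q_multinomial A k = (\<Sum>\<alpha>\<in>{\<alpha>\<in>A. k \<alpha> > 0}.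
    Polynomial.monom 1 (\<Sum>\<beta>\<in>{\<beta>\<in>A. r \<beta> < r \<alpha>}. k \<beta>) * q_multinomial A (k - unit_vector \<alpha> 1))"
    (is "_ = sum ?t _")
proof -
  let ?P = "\<Prod>\<alpha>\<in>A. q_pochhammer (k \<alpha>)"
  obtain N where N: "sum k A = Suc N" using k by (cases "sum k A") auto
  have summand: "?t \<alpha> * ?P = q_pochhammer N *
      (Polynomial.monom 1 (\<Sum>\<beta>\<in>{\<beta>\<in>A. r \<beta> < r \<alpha>}. k \<beta>) * (1 - Polynomial.monom 1 (k \<alpha>)))"
    if \<alpha>: "\<alpha> \<in> A" "k \<alpha> > 0" for \<alpha>
  proof -
    let ?k = "k - unit_vector \<alpha> 1"
    have s: "sum ?k A = N"
      unfolding sum_diff_unit_vector[of A \<alpha> k, OF A \<alpha>] by (simp add: N)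
    have "q_pochhammer (k \<alpha>) = q_pochhammer (?k \<alpha>) * (1 - Polynomial.monom 1 (k \<alpha>))"
      using q_pochhammer_Suc[of "k \<alpha> - 1"] \<alpha> by (simp add: unit_vector_def)
    moreover have "(\<Prod>\<beta>\<in>A - {\<alpha>}. q_pochhammer (?k \<beta>)) = (\<Prod>\<beta>\<in>A - {\<alpha>}. q_pochhammer (k \<beta>))"
      by (rule prod.cong) (auto simp: unit_vector_def)
    ultimately have "?P = (\<Prod>\<beta>\<in>A. q_pochhammer (?k \<beta>)) * (1 - Polynomial.monom 1 (k \<alpha>))"
      using prod.remove[OF A \<alpha>(1), of "\<lambda>\<beta>. q_pochhammer (k \<beta>)"]
        prod.remove[OF A \<alpha>(1), of "\<lambda>\<beta>. q_pochhammer (?k \<beta>)"] by (simp only: mult_ac)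
    then have "?t \<alpha> * ?P = Polynomial.monom 1 (\<Sum>\<beta>\<in>{\<beta>\<in>A. r \<beta> < r \<alpha>}. k \<beta>) *
        (q_multinomial A ?k * (\<Prod>\<beta>\<in>A. q_pochhammer (?k \<beta>))) * (1 - Polynomial.monom 1 (k \<alpha>))"
      by (simp only: mult_ac)
    then show ?thesis
      unfolding q_multinomial_mult[OF A] s by (simp only: mult_ac)
  qed
  have "sum ?t {\<alpha>\<in>A. k \<alpha> > 0} * ?P = (\<Sum>\<alpha>\<in>{\<alpha>\<in>A. k \<alpha> > 0}. q_pochhammer N *
      (Polynomial.monom 1 (\<Sum>\<beta>\<in>{\<beta>\<in>A. r \<beta> < r \<alpha>}. k \<beta>) * (1 - Polynomial.monom 1 (k \<alpha>))))"
    unfolding sum_distrib_right by (rule sum.cong[OF refl], rule summand) auto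
  also have "\<dots> = (\<Sum>\<alpha>\<in>A. q_pochhammer N *
      (Polynomial.monom 1 (\<Sum>\<beta>\<in>{\<beta>\<in>A. r \<beta> < r \<alpha>}. k \<beta>) * (1 - Polynomial.monom 1 (k \<alpha>))))"
    by (rule sum.mono_neutral_left) (use A in \<open>auto simp: monom_0\<close>)
  also have "\<dots> = q_pochhammer (sum k A)"
    unfolding sum_distrib_left[symmetric] telescope_one_minus_monom[OF A r]
    by (simp add: N q_pochhammer_Suc)
  also have "\<dots> = q_multinomial A k * ?P" by (rule q_multinomial_mult[OF A, symmetric])
  finally show ?thesis
    using A q_pochhammer_nonzero by (simp add: prod_zero_iff)
qed

lemma qlaurent_of_poly_extend:
  assumes "Polynomial.degree P \<le> n"
  shows "qlaurent_of_poly P = (\<Sum>i\<le>n. Poly_Mapping.single (int i) (Polynomial.coeff P i))"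
  unfolding qlaurent_of_poly_def
  by (rule sum.mono_neutral_left) (use assms in \<open>auto simp: coeff_eq_0\<close>)

lemma qlaurent_of_poly_add: "qlaurent_of_poly (P + R) = qlaurent_of_poly P + qlaurent_of_poly R"
proof -
  define n where "n = max (Polynomial.degree P) (Polynomial.degree R)"
  have "Polynomial.degree P \<le> n" "Polynomial.degree R \<le> n" "Polynomial.degree (P + R) \<le> n"
    using degree_add_le_max[of P R] by (auto simp: n_def)
  then show ?thesis
    by (simp add: qlaurent_of_poly_extend single_add sum.distrib)
qed

lemma qlaurent_of_poly_pCons:
  "qlaurent_of_poly (pCons a P) = Poly_Mapping.single 0 a + Poly_Mapping.single 1 1 * qlaurent_of_poly P"
proof -
  have "Polynomial.degree (pCons a P) \<le> Suc (Polynomial.degree P)" by (rule degree_pCons_le)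
  then show ?thesis
    by (simp add: qlaurent_of_poly_extend sum.atMost_Suc_shift del: sum.atMost_Suc)
      (simp add: qlaurent_of_poly_def sum_distrib_left mult_single add.commute)
qed

lemma qlaurent_of_poly_smult:
  "qlaurent_of_poly (Polynomial.smult a P) = Poly_Mapping.single 0 a * qlaurent_of_poly P"
proof -
  have "Polynomial.degree (Polynomial.smult a P) \<le> Polynomial.degree P" by (rule degree_smult_le)
  then show ?thesis
    by (simp add: qlaurent_of_poly_extend) (simp add: qlaurent_of_poly_def sum_distrib_left mult_single)
qed

lemma qlaurent_of_poly_monom: "qlaurent_of_poly (Polynomial.monom a n) = Poly_Mapping.single (int n) a"
proof (induction n)
  case 0
  show ?case by (simp add: qlaurent_of_poly_def monom_0)
next
  case (Suc n)
  then show ?case by (simp add: monom_Suc qlaurent_of_poly_pCons mult_single)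
qed

lemma ring_hom_fun_qlaurent_of_poly: "ring_hom_fun qlaurent_of_poly"
proof -
  have one: "qlaurent_of_poly 1 = 1"
    using qlaurent_of_poly_monom[of 1 0] by simp
  have zero: "qlaurent_of_poly 0 = 0"
    using qlaurent_of_poly_monom[of 0 0] by simp
  have "qlaurent_of_poly (P * R) = qlaurent_of_poly P * qlaurent_of_poly R" for P R
  proof (induction P)
    case (pCons a P)
    then show ?case
      by (simp add: qlaurent_of_poly_add qlaurent_of_poly_smult qlaurent_of_poly_pCons algebra_simps)
  qed (simp add: zero)
  then show ?thesis
    by (auto simp: ring_hom_fun_def one qlaurent_of_poly_add)
qed

lemma minus_one_pow_add: "minus_one_pow (a + b) = minus_one_pow a * minus_one_pow b"
  by (simp add: minus_one_pow_def)

text \<open>The recursion for q-multinomial coefficients depends on a linear order of the index set, which is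
  given by the ranks \<open>r\<close>.\<close>

locale f_coefficients =
  fixes A :: "'a set" and Q :: "'a \<Rightarrow> 'a \<Rightarrow> int" and r :: "'a \<Rightarrow> nat"
  assumes A: "finite A" and sym: "\<And>\<alpha> \<beta>. \<alpha> \<in> A \<Longrightarrow> \<beta> \<in> A \<Longrightarrow> Q \<alpha> \<beta> = Q \<beta> \<alpha>"
    and r: "inj_on r A"
begin

definition exponent :: "('a \<Rightarrow> nat) \<Rightarrow> int" where
  "exponent k = (quadratic_form A Q k + diag_form A Q k) div 2"

definition coefficient :: "('a \<Rightarrow> nat) \<Rightarrow> qlaurent" where
  "coefficient k = Poly_Mapping.single (exponent k) (minus_one_pow (diag_form A Q k))
     * qlaurent_of_poly (q_multinomial A k)"

text \<open>The exponent of \<open>q\<close> in the convolution formula. It is bilinear; the indicator comes from the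
  recursion for q-multinomial coefficients, \<open>Q\<close> from the quadratic form.\<close>

definition linear_part :: "('a \<Rightarrow> nat) \<Rightarrow> 'a \<Rightarrow> int" where
  "linear_part \<beta> a = (\<Sum>b\<in>A. ((if r a < r b then 1 else 0) + Q a b) * int (\<beta> b))"

definition pairing :: "('a \<Rightarrow> nat) \<Rightarrow> ('a \<Rightarrow> nat) \<Rightarrow> int" where
  "pairing \<gamma> \<beta> = (\<Sum>a\<in>A. int (\<gamma> a) * linear_part \<beta> a)"

lemma diag_form_add: "diag_form A Q (\<gamma> + \<beta>) = diag_form A Q \<gamma> + diag_form A Q \<beta>"
  by (simp add: diag_form_def algebra_simps sum.distrib)

lemma quadratic_form_add:
  "quadratic_form A Q (\<gamma> + \<beta>) = quadratic_form A Q \<gamma> + quadratic_form A Q \<beta> +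
     2 * (\<Sum>a\<in>A. \<Sum>b\<in>A. int (\<gamma> a) * Q a b * int (\<beta> b))"
proof -
  have "(\<Sum>a\<in>A. \<Sum>b\<in>A. int (\<beta> a) * Q a b * int (\<gamma> b)) = (\<Sum>a\<in>A. \<Sum>b\<in>A. int (\<gamma> a) * Q a b * int (\<beta> b))"
    by (subst sum.swap) (intro sum.cong refl, simp add: sym)
  then show ?thesis
    by (simp add: quadratic_form_def algebra_simps sum.distrib)
qed

lemma sum_unit_vector_mult:
  "\<alpha> \<in> A \<Longrightarrow> (\<Sum>b\<in>A. f b * int (unit_vector \<alpha> n b)) = f \<alpha> * int n"
  "\<alpha> \<in> A \<Longrightarrow> (\<Sum>b\<in>A. int (unit_vector \<alpha> n b) * f b) = int n * f \<alpha>"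
proof -
  have *: "(\<Sum>b\<in>A. f b * int (unit_vector \<alpha> n b)) = (\<Sum>b\<in>A. if b = \<alpha> then f \<alpha> * int n else 0)"
    by (rule sum.cong) (auto simp: unit_vector_def)
  then show "\<alpha> \<in> A \<Longrightarrow> (\<Sum>b\<in>A. f b * int (unit_vector \<alpha> n b)) = f \<alpha> * int n"
    using A by simp
  then show "\<alpha> \<in> A \<Longrightarrow> (\<Sum>b\<in>A. int (unit_vector \<alpha> n b) * f b) = int n * f \<alpha>"
    by (simp add: mult.commute)
qed

lemma
  assumes "\<alpha> \<in> A"
  shows quadratic_form_unit: "quadratic_form A Q (unit_vector \<alpha> n) = int n * Q \<alpha> \<alpha> * int n"
    and diag_form_unit: "diag_form A Q (unit_vector \<alpha> n) = Q \<alpha> \<alpha> * int n"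
  unfolding quadratic_form_def diag_form_def
  using assms by (simp_all add: sum_unit_vector_mult mult.assoc flip: sum_distrib_left)

lemma vector_cases:
  assumes "k \<in> vectors A" "sum k A > 0"
  obtains \<alpha> where "\<alpha> \<in> A" "k \<alpha> > 0"
  using assms A by (metis sum_pos2 sum.neutral neq0_conv)

lemma vector_diff_add:
  fixes k \<beta> :: "'a \<Rightarrow> nat"
  assumes "\<beta> \<le> k" shows "(k - \<beta>) + \<beta> = k"
  using assms by (auto simp: le_fun_def)

text \<open>The symmetry of \<open>Q\<close> makes the mixed terms of the quadratic form even.\<close>

lemma even_forms:
  "k \<in> vectors A \<Longrightarrow> even (quadratic_form A Q k + diag_form A Q k)"
proof (induction "sum k A" arbitrary: k)
  case 0
  then have "k = (\<lambda>_. 0)" using A by (auto simp: vectors_def fun_eq_iff)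
  then show ?case by (simp add: quadratic_form_def diag_form_def)
next
  case (Suc N)
  obtain \<alpha> where \<alpha>: "\<alpha> \<in> A" "k \<alpha> > 0"
    using vector_cases[OF Suc.prems] Suc.hyps(2) by auto
  let ?u = "unit_vector \<alpha> 1"
  have le: "?u \<le> k" using \<alpha> by (simp add: unit_vector_le_iff)
  have "N = sum (k - ?u) A"
    unfolding sum_diff_unit_vector[of A \<alpha> k, OF A \<alpha>] using Suc.hyps(2) by simp
  then have "even (quadratic_form A Q (k - ?u) + diag_form A Q (k - ?u))"
    using Suc.hyps(1) diff_in_vectors[OF Suc.prems] by blast
  moreover have "quadratic_form A Q k + diag_form A Q k =
      quadratic_form A Q (k - ?u) + diag_form A Q (k - ?u) + 2 * (Q \<alpha> \<alpha> +
        (\<Sum>a\<in>A. \<Sum>b\<in>A. int ((k - ?u) a) * Q a b * int (?u b)))"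
    using quadratic_form_add[of "k - ?u" ?u] diag_form_add[of "k - ?u" ?u]
      quadratic_form_unit[OF \<alpha>(1), of 1] diag_form_unit[OF \<alpha>(1), of 1]
    unfolding vector_diff_add[OF le] by simp
  ultimately show ?case by simp
qed

lemma exponent_add:
  assumes "\<gamma> \<in> vectors A" "\<beta> \<in> vectors A"
  shows "exponent (\<gamma> + \<beta>) = exponent \<gamma> + exponent \<beta> + (\<Sum>a\<in>A. \<Sum>b\<in>A. int (\<gamma> a) * Q a b * int (\<beta> b))"
proof -
  obtain x where x: "quadratic_form A Q \<gamma> + diag_form A Q \<gamma> = 2 * x"
    by (rule evenE[OF even_forms[OF assms(1)]])
  obtain y where y: "quadratic_form A Q \<beta> + diag_form A Q \<beta> = 2 * y"
    by (rule evenE[OF even_forms[OF assms(2)]])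
  from x y have "quadratic_form A Q (\<gamma> + \<beta>) + diag_form A Q (\<gamma> + \<beta>) =
      2 * (x + y + (\<Sum>a\<in>A. \<Sum>b\<in>A. int (\<gamma> a) * Q a b * int (\<beta> b)))"
    unfolding quadratic_form_add diag_form_add by simp
  then show ?thesis by (simp add: exponent_def x y)
qed

lemma q_multinomial_unit:
  assumes "\<alpha> \<in> A" shows "q_multinomial A (unit_vector \<alpha> n) = 1"
proof -
  have "(\<Prod>\<beta>\<in>A. q_pochhammer (unit_vector \<alpha> n \<beta>)) = (\<Prod>\<beta>\<in>A. if \<beta> = \<alpha> then q_pochhammer n else 1)"
    by (rule prod.cong) (auto simp: unit_vector_def q_pochhammer_def)
  then have "q_multinomial A (unit_vector \<alpha> n) * q_pochhammer n = q_pochhammer n"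
    using q_multinomial_mult[OF A, of "unit_vector \<alpha> n"] assms A by (simp add: sum_unit_vector)
  then show ?thesis using q_pochhammer_nonzero[of n] by simp
qed

lemma coefficient_unit:
  assumes "\<alpha> \<in> A"
  shows "coefficient (unit_vector \<alpha> n) =
    Poly_Mapping.single ((int n * Q \<alpha> \<alpha> * int n + Q \<alpha> \<alpha> * int n) div 2) (minus_one_pow (Q \<alpha> \<alpha> * int n))"
  using assms by (simp add: coefficient_def exponent_def quadratic_form_unit diag_form_unit
      q_multinomial_unit ring_hom_fun_one[OF ring_hom_fun_qlaurent_of_poly])

lemma coefficient_zero: "coefficient (\<lambda>_. 0) = 1"
  using q_multinomial_mult[OF A, of "\<lambda>_. 0"]
  by (simp add: coefficient_def exponent_def quadratic_form_def diag_form_def minus_one_pow_def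
      q_pochhammer_def ring_hom_fun_one[OF ring_hom_fun_qlaurent_of_poly])

lemma linear_part_add: "linear_part (\<beta> + \<beta>') a = linear_part \<beta> a + linear_part \<beta>' a"
  by (simp add: linear_part_def algebra_simps sum.distrib)

lemma pairing_add_right: "pairing \<gamma> (\<beta> + \<beta>') = pairing \<gamma> \<beta> + pairing \<gamma> \<beta>'"
  by (simp add: pairing_def linear_part_add algebra_simps sum.distrib)

lemma pairing_add_left: "pairing (\<gamma> + \<gamma>') \<beta> = pairing \<gamma> \<beta> + pairing \<gamma>' \<beta>"
  by (simp add: pairing_def algebra_simps sum.distrib)

lemma linear_part_unit: "\<alpha> \<in> A \<Longrightarrow> linear_part (unit_vector \<alpha> n) a = ((if r a < r \<alpha> then 1 else 0) + Q a \<alpha>) * int n"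
  unfolding linear_part_def by (simp add: sum_unit_vector_mult)

lemma coefficient_pascal:
  assumes k: "k \<in> vectors A" "sum k A > 0"
  shows "coefficient k = (\<Sum>\<alpha>\<in>{\<alpha>\<in>A. k \<alpha> > 0}.
    Poly_Mapping.single (pairing (k - unit_vector \<alpha> 1) (unit_vector \<alpha> 1)) 1 *
      coefficient (unit_vector \<alpha> 1) * coefficient (k - unit_vector \<alpha> 1))"
proof -
  let ?s = "\<lambda>\<alpha>. \<Sum>\<beta>\<in>{\<beta>\<in>A. r \<beta> < r \<alpha>}. k \<beta>"
  have "coefficient k = Poly_Mapping.single (exponent k) (minus_one_pow (diag_form A Q k)) *
      (\<Sum>\<alpha>\<in>{\<alpha>\<in>A. k \<alpha> > 0}. Poly_Mapping.single (int (?s \<alpha>)) 1 *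
        qlaurent_of_poly (q_multinomial A (k - unit_vector \<alpha> 1)))"
    unfolding coefficient_def q_multinomial_pascal[OF A r k(2)]
      ring_hom_fun_sum[OF ring_hom_fun_qlaurent_of_poly] ring_hom_fun_mult[OF ring_hom_fun_qlaurent_of_poly]
      qlaurent_of_poly_monom ..
  also have "\<dots> = (\<Sum>\<alpha>\<in>{\<alpha>\<in>A. k \<alpha> > 0}.
    Poly_Mapping.single (pairing (k - unit_vector \<alpha> 1) (unit_vector \<alpha> 1)) 1 *
      coefficient (unit_vector \<alpha> 1) * coefficient (k - unit_vector \<alpha> 1))"
    unfolding sum_distrib_left
  proof (rule sum.cong[OF refl])
    fix \<alpha> assume "\<alpha> \<in> {\<alpha>\<in>A. k \<alpha> > 0}"
    then have \<alpha>: "\<alpha> \<in> A" "k \<alpha> > 0" by auto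
    let ?u = "unit_vector \<alpha> 1" and ?k = "k - unit_vector \<alpha> 1"
    have le: "?u \<le> k" using \<alpha> by (simp add: unit_vector_le_iff)
    have ku: "?k + ?u = k" by (rule vector_diff_add[OF le])
    have eu: "exponent ?u = Q \<alpha> \<alpha>"
      using \<alpha> by (simp add: exponent_def quadratic_form_unit diag_form_unit)
    have "int (?s \<alpha>) = (\<Sum>a\<in>A. int (?k a) * (if r a < r \<alpha> then 1 else 0))"
    proof -
      have "int (?s \<alpha>) = (\<Sum>a\<in>A. if r a < r \<alpha> then int (k a) else 0)"
        using A by (simp add: sum.inter_filter if_distrib[of int] cong: if_cong)
      also have "\<dots> = (\<Sum>a\<in>A. int (?k a) * (if r a < r \<alpha> then 1 else 0))"
        by (rule sum.cong) (auto simp: unit_vector_def)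
      finally show ?thesis .
    qed
    moreover have "(\<Sum>a\<in>A. \<Sum>b\<in>A. int (?k a) * Q a b * int (?u b)) = (\<Sum>a\<in>A. int (?k a) * Q a \<alpha>)"
      using \<alpha> by (simp add: sum_unit_vector_mult)
    ultimately have "exponent k + int (?s \<alpha>) = pairing ?k ?u + Q \<alpha> \<alpha> + exponent ?k"
      using exponent_add[OF diff_in_vectors[OF k(1)] unit_vector_in_vectors[OF \<alpha>(1)], of ?u 1]
      unfolding ku eu pairing_def linear_part_unit[OF \<alpha>(1)]
      by (simp add: algebra_simps sum.distrib)
    moreover have "diag_form A Q k = Q \<alpha> \<alpha> + diag_form A Q ?k"
      using diag_form_add[of ?k ?u] diag_form_unit[OF \<alpha>(1), of 1] unfolding ku by simp
    moreover have "coefficient ?u = Poly_Mapping.single (Q \<alpha> \<alpha>) (minus_one_pow (Q \<alpha> \<alpha>))"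
      using coefficient_unit[OF \<alpha>(1), of 1] by simp
    ultimately show "Poly_Mapping.single (exponent k) (minus_one_pow (diag_form A Q k)) *
        (Poly_Mapping.single (int (?s \<alpha>)) 1 * qlaurent_of_poly (q_multinomial A ?k)) =
      Poly_Mapping.single (pairing ?k ?u) 1 * coefficient ?u * coefficient ?k"
      by (simp add: coefficient_def mult_single minus_one_pow_add flip: mult.assoc)
  qed
  finally show ?thesis .
qed

text \<open>Iterating the recursion gives a q-analogue of Vandermonde's identity. The bilinearity of the
  pairing accounts for the powers of \<open>q\<close>.\<close>

lemma coefficient_convolution:
  assumes "k \<in> vectors A" "sum k A \<ge> m"
  shows "coefficient k = (\<Sum>\<beta>\<in>{\<beta>\<in>vectors A. \<beta> \<le> k \<and> sum \<beta> A = m}.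
    Poly_Mapping.single (pairing (k - \<beta>) \<beta>) 1 * coefficient \<beta> * coefficient (k - \<beta>))"
  using assms
proof (induction m arbitrary: k)
  case 0
  have "{\<beta>\<in>vectors A. \<beta> \<le> k \<and> sum \<beta> A = 0} = {\<lambda>_. 0}"
    using A by (auto simp: vectors_def fun_eq_iff le_fun_def)
  moreover have "k - (\<lambda>_. 0) = k" by auto
  moreover have "pairing k (\<lambda>_. 0) = 0" by (simp add: pairing_def linear_part_def)
  ultimately show ?case by (simp add: coefficient_zero)
next
  case (Suc m)
  let ?V = "\<lambda>m k. {\<beta>\<in>vectors A. \<beta> \<le> k \<and> sum \<beta> A = m}"
  let ?u = "\<lambda>\<alpha>. unit_vector \<alpha> (1::nat)"
  let ?t = "\<lambda>\<gamma> \<beta>. Poly_Mapping.single (pairing \<gamma> \<beta>) 1 * coefficient \<beta>"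
  have fin: "finite (?V m k)" for m k
    by (rule finite_subset[OF _ finite_vectors_sum[OF A, of m]]) auto
  have "coefficient k = (\<Sum>\<alpha>\<in>{\<alpha>\<in>A. k \<alpha> > 0}. ?t (k - ?u \<alpha>) (?u \<alpha>) * coefficient (k - ?u \<alpha>))"
    by (rule coefficient_pascal) (use Suc.prems in auto)
  also have "\<dots> = (\<Sum>\<alpha>\<in>{\<alpha>\<in>A. k \<alpha> > 0}. \<Sum>\<beta>\<in>?V m (k - ?u \<alpha>).
      ?t (k - ?u \<alpha>) (?u \<alpha>) * (?t (k - ?u \<alpha> - \<beta>) \<beta> * coefficient (k - ?u \<alpha> - \<beta>)))"
  proof (rule sum.cong[OF refl])
    fix \<alpha> assume "\<alpha> \<in> {\<alpha>\<in>A. k \<alpha> > 0}"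
    then have \<alpha>: "\<alpha> \<in> A" "k \<alpha> > 0" by auto
    have "sum (k - ?u \<alpha>) A \<ge> m"
      unfolding sum_diff_unit_vector[of A \<alpha> k, OF A \<alpha>] using Suc.prems(2) by simp
    from Suc.IH[OF diff_in_vectors[OF Suc.prems(1)] this]
    show "?t (k - ?u \<alpha>) (?u \<alpha>) * coefficient (k - ?u \<alpha>) = (\<Sum>\<beta>\<in>?V m (k - ?u \<alpha>).
      ?t (k - ?u \<alpha>) (?u \<alpha>) * (?t (k - ?u \<alpha> - \<beta>) \<beta> * coefficient (k - ?u \<alpha> - \<beta>)))"
      unfolding sum_distrib_left[symmetric] by (rule arg_cong)
  qed
  also have "\<dots> = (\<Sum>(\<alpha>, \<beta>)\<in>Sigma {\<alpha>\<in>A. k \<alpha> > 0} (\<lambda>\<alpha>. ?V m (k - ?u \<alpha>)).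
      ?t (k - ?u \<alpha>) (?u \<alpha>) * (?t (k - ?u \<alpha> - \<beta>) \<beta> * coefficient (k - ?u \<alpha> - \<beta>)))"
    using A fin by (subst sum.Sigma) auto
  also have "\<dots> = (\<Sum>(\<beta>, \<alpha>)\<in>Sigma (?V (Suc m) k) (\<lambda>\<beta>. {\<alpha>\<in>A. \<beta> \<alpha> > 0}).
      Poly_Mapping.single (pairing (k - \<beta>) \<beta>) 1 *
      (?t (\<beta> - ?u \<alpha>) (?u \<alpha>) * coefficient (\<beta> - ?u \<alpha>)) * coefficient (k - \<beta>))"
  proof (rule sum.reindex_bij_witness[of _ "\<lambda>(\<beta>, \<alpha>). (\<alpha>, \<beta> - ?u \<alpha>)" "\<lambda>(\<alpha>, \<beta>). (\<beta> + ?u \<alpha>, \<alpha>)"])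
    fix x assume "x \<in> Sigma {\<alpha>\<in>A. k \<alpha> > 0} (\<lambda>\<alpha>. ?V m (k - ?u \<alpha>))"
    then obtain \<alpha> \<beta> where x: "x = (\<alpha>, \<beta>)" and \<alpha>: "\<alpha> \<in> A" "k \<alpha> > 0"
      and \<beta>: "\<beta> \<in> vectors A" "\<beta> \<le> k - ?u \<alpha>" "sum \<beta> A = m" by auto
    have cancel: "\<beta> + ?u \<alpha> - ?u \<alpha> = \<beta>" by auto
    then show "(case case x of (\<alpha>, \<beta>) \<Rightarrow> (\<beta> + ?u \<alpha>, \<alpha>) of (\<beta>, \<alpha>) \<Rightarrow> (\<alpha>, \<beta> - ?u \<alpha>)) = x"
      by (simp add: x)
    have "\<beta> a + ?u \<alpha> a \<le> k a" for a
      using \<alpha>(2) le_funD[OF \<beta>(2), of a] by (auto simp: unit_vector_def split: if_splits)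
    then have "\<beta> + ?u \<alpha> \<le> k" by (simp add: le_fun_def)
    moreover have "\<beta> + ?u \<alpha> \<in> vectors A"
      using \<beta>(1) unit_vector_in_vectors[OF \<alpha>(1), of 1] by (simp add: vectors_def)
    moreover have "sum (\<beta> + ?u \<alpha>) A = Suc m"
      using \<beta>(3) \<alpha> A sum_unit_vector[of A \<alpha> 1] by (simp add: sum.distrib)
    moreover have "(\<beta> + ?u \<alpha>) \<alpha> > 0" by (simp add: unit_vector_def)
    ultimately show "(case x of (\<alpha>, \<beta>) \<Rightarrow> (\<beta> + ?u \<alpha>, \<alpha>)) \<in>
        Sigma (?V (Suc m) k) (\<lambda>\<beta>. {\<alpha>\<in>A. \<beta> \<alpha> > 0})"
      using \<alpha>(1) unfolding x by (simp only: prod.case mem_Sigma_iff mem_Collect_eq simp_thms)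
    define \<gamma> where "\<gamma> = k - ?u \<alpha> - \<beta>"
    have \<gamma>: "k - (\<beta> + ?u \<alpha>) = \<gamma>" "k - ?u \<alpha> = \<gamma> + \<beta>" "\<gamma> + \<beta> - \<beta> = \<gamma>"
      using vector_diff_add[OF \<beta>(2)] by (auto simp: \<gamma>_def)
    have single: "Poly_Mapping.single (a + b) 1 = Poly_Mapping.single a 1 * (Poly_Mapping.single b 1 :: qlaurent)"
      for a b by (simp add: mult_single)
    show "(case case x of (\<alpha>, \<beta>) \<Rightarrow> (\<beta> + ?u \<alpha>, \<alpha>) of (\<beta>, \<alpha>) \<Rightarrow>
        Poly_Mapping.single (pairing (k - \<beta>) \<beta>) 1 *
        (?t (\<beta> - ?u \<alpha>) (?u \<alpha>) * coefficient (\<beta> - ?u \<alpha>)) * coefficient (k - \<beta>)) =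
      (case x of (\<alpha>, \<beta>) \<Rightarrow>
        ?t (k - ?u \<alpha>) (?u \<alpha>) * (?t (k - ?u \<alpha> - \<beta>) \<beta> * coefficient (k - ?u \<alpha> - \<beta>)))"
      unfolding x prod.case cancel \<gamma>(1) \<gamma>_def[symmetric] \<gamma>(2,3) pairing_add_right pairing_add_left single
      by (simp only: mult_ac)
  next
    fix x assume "x \<in> Sigma (?V (Suc m) k) (\<lambda>\<beta>. {\<alpha>\<in>A. \<beta> \<alpha> > 0})"
    then obtain \<alpha> \<beta> where x: "x = (\<beta>, \<alpha>)" and \<alpha>: "\<alpha> \<in> A" "\<beta> \<alpha> > 0"
      and \<beta>: "\<beta> \<in> vectors A" "\<beta> \<le> k" "sum \<beta> A = Suc m" by auto
    have le: "?u \<alpha> \<le> \<beta>" using \<alpha> by (simp add: unit_vector_le_iff)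
    show "(case case x of (\<beta>, \<alpha>) \<Rightarrow> (\<alpha>, \<beta> - ?u \<alpha>) of (\<alpha>, \<beta>) \<Rightarrow> (\<beta> + ?u \<alpha>, \<alpha>)) = x"
      unfolding x prod.case vector_diff_add[OF le] ..
    have "k \<alpha> > 0" using \<alpha>(2) le_funD[OF \<beta>(2), of \<alpha>] by simp
    moreover have "\<beta> - ?u \<alpha> \<le> k - ?u \<alpha>"
      using \<beta>(2) by (auto simp: le_fun_def intro: diff_le_mono)
    moreover have "sum (\<beta> - ?u \<alpha>) A = m"
      unfolding sum_diff_unit_vector[of A \<alpha> \<beta>, OF A \<alpha>] using \<beta>(3) by simp
    ultimately show "(case x of (\<beta>, \<alpha>) \<Rightarrow> (\<alpha>, \<beta> - ?u \<alpha>)) \<in> Sigma {\<alpha>\<in>A. k \<alpha> > 0} (\<lambda>\<alpha>. ?V m (k - ?u \<alpha>))"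
      using \<alpha>(1) diff_in_vectors[OF \<beta>(1)] unfolding x
      by (simp only: prod.case mem_Sigma_iff mem_Collect_eq simp_thms)
  qed
  also have "\<dots> = (\<Sum>\<beta>\<in>?V (Suc m) k. \<Sum>\<alpha>\<in>{\<alpha>\<in>A. \<beta> \<alpha> > 0}. Poly_Mapping.single (pairing (k - \<beta>) \<beta>) 1 *
      (?t (\<beta> - ?u \<alpha>) (?u \<alpha>) * coefficient (\<beta> - ?u \<alpha>)) * coefficient (k - \<beta>))"
    using A fin by (subst sum.Sigma) auto
  also have "\<dots> = (\<Sum>\<beta>\<in>?V (Suc m) k. ?t (k - \<beta>) \<beta> * coefficient (k - \<beta>))"
    unfolding sum_distrib_left[symmetric] sum_distrib_right[symmetric]
    by (intro sum.cong refl, subst (2) coefficient_pascal) auto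
  finally show ?case .
qed

end

section \<open>Rational generating functions\<close>

text \<open>A function \<open>c\<close> on vectors stands for the power series with coefficients \<open>c k\<close> in variables \<open>y_\<alpha>\<close>.
  Shifting by \<open>\<beta>\<close> is multiplication by \<open>y^\<beta>\<close>.\<close>

definition shift :: "('a \<Rightarrow> nat) \<Rightarrow> (('a \<Rightarrow> nat) \<Rightarrow> complex) \<Rightarrow> ('a \<Rightarrow> nat) \<Rightarrow> complex" where
  "shift \<beta> c k = (if \<beta> \<le> k then c (k - \<beta>) else 0)"

lemma shift_add: "shift \<beta> (\<lambda>k. c k + d k) k = shift \<beta> c k + shift \<beta> d k"
  by (simp add: shift_def)

lemma shift_shift: "shift \<beta> (shift \<gamma> c) = shift (\<gamma> + \<beta>) c"
proof
  fix k
  have 1: "\<gamma> + \<beta> \<le> k \<longleftrightarrow> \<beta> \<le> k \<and> \<gamma> \<le> k - \<beta>"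
  proof -
    have "\<gamma> x + \<beta> x \<le> k x \<longleftrightarrow> \<beta> x \<le> k x \<and> \<gamma> x \<le> k x - \<beta> x" for x by arith
    then show ?thesis by (auto simp: le_fun_def)
  qed
  have 2: "k - \<beta> - \<gamma> = k - (\<gamma> + \<beta>)" by (rule ext) simp
  show "shift \<beta> (shift \<gamma> c) k = shift (\<gamma> + \<beta>) c k"
    unfolding shift_def 1 2 by simp
qed

locale rational_functions =
  fixes A :: "'a set" and \<epsilon> :: "'a \<Rightarrow> complex" and m :: nat
  assumes A: "finite A"
begin

text \<open>Multiplication by \<open>1 - \<Sum> \<epsilon> \<alpha> * y_\<alpha>^m\<close>.\<close>

definition \<Delta> :: "(('a \<Rightarrow> nat) \<Rightarrow> complex) \<Rightarrow> ('a \<Rightarrow> nat) \<Rightarrow> complex" where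
  "\<Delta> c k = c k - (\<Sum>\<alpha>\<in>A. \<epsilon> \<alpha> * shift (unit_vector \<alpha> m) c k)"

definition finite_support :: "(('a \<Rightarrow> nat) \<Rightarrow> complex) \<Rightarrow> bool" where
  "finite_support c \<longleftrightarrow> finite {k \<in> vectors A. c k \<noteq> 0}"

text \<open>The power series \<open>P / (1 - \<Sum> \<epsilon> \<alpha> * y_\<alpha>^m)^s\<close> with \<open>P\<close> a polynomial over
  the complex numbers.\<close>

inductive_set rational :: "(('a \<Rightarrow> nat) \<Rightarrow> complex) set" where
  finite_support: "finite_support c \<Longrightarrow> c \<in> rational"
| divide: "\<Delta> c \<in> rational \<Longrightarrow> c \<in> rational"

lemma finite_support_add:
  assumes "finite_support c" "finite_support d" shows "finite_support (\<lambda>k. c k + d k)"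
  unfolding finite_support_def
  by (rule finite_subset[OF _ finite_UnI[OF assms[unfolded finite_support_def]]]) auto

lemma finite_support_mult: "finite_support c \<Longrightarrow> finite_support (\<lambda>k. f k * c k)"
  unfolding finite_support_def by (rule finite_subset[rotated]) auto

lemma finite_support_sum:
  "(\<And>i. i \<in> I \<Longrightarrow> finite_support (c i)) \<Longrightarrow> finite_support (\<lambda>k. \<Sum>i\<in>I. c i k)"
proof (induction I rule: infinite_finite_induct)
  case (insert x F)
  then show ?case using finite_support_add[of "c x" "\<lambda>k. \<Sum>i\<in>F. c i k"] by simp
qed (simp_all add: finite_support_def)

lemma finite_support_shift:
  assumes "finite_support c" shows "finite_support (shift \<beta> c)"
proof -
  have "{k \<in> vectors A. shift \<beta> c k \<noteq> 0} \<subseteq> (\<lambda>k. k + \<beta>) ` {k \<in> vectors A. c k \<noteq> 0}"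
  proof
    fix k assume "k \<in> {k \<in> vectors A. shift \<beta> c k \<noteq> 0}"
    then have k: "k \<in> vectors A" "\<beta> \<le> k" "c (k - \<beta>) \<noteq> 0"
      by (auto simp: shift_def split: if_splits)
    then have "k = (k - \<beta>) + \<beta>" by (auto simp: le_fun_def)
    then show "k \<in> (\<lambda>k. k + \<beta>) ` {k \<in> vectors A. c k \<noteq> 0}"
      using k diff_in_vectors[OF k(1), of \<beta>] by blast
  qed
  then show ?thesis
    using assms unfolding finite_support_def by (auto intro: finite_subset)
qed

lemma finite_support_\<Delta>:
  assumes "finite_support c" shows "finite_support (\<Delta> c)"
proof -
  have eq: "\<Delta> c = (\<lambda>k. c k + (- 1) * (\<Sum>\<alpha>\<in>A. \<epsilon> \<alpha> * shift (unit_vector \<alpha> m) c k))"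
    by (rule ext) (simp add: \<Delta>_def)
  show ?thesis
    unfolding eq by (intro finite_support_add[OF assms] finite_support_mult finite_support_sum
        finite_support_shift[OF assms])
qed

lemma \<Delta>_add: "\<Delta> (\<lambda>k. c k + d k) = (\<lambda>k. \<Delta> c k + \<Delta> d k)"
  by (rule ext) (simp add: \<Delta>_def shift_add algebra_simps sum.distrib)

lemma \<Delta>_shift: "\<Delta> (shift \<beta> c) = shift \<beta> (\<Delta> c)"
proof
  fix k
  have "shift (unit_vector \<alpha> m) (shift \<beta> c) = shift \<beta> (shift (unit_vector \<alpha> m) c)" for \<alpha>
    unfolding shift_shift by (simp add: add.commute)
  then show "\<Delta> (shift \<beta> c) k = shift \<beta> (\<Delta> c) k"
    by (simp add: \<Delta>_def) (simp add: shift_def[of \<beta>] \<Delta>_def)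
qed

lemma rational_\<Delta>: "c \<in> rational \<Longrightarrow> \<Delta> c \<in> rational"
  by (erule rational.cases) (auto intro: rational.finite_support finite_support_\<Delta>)

lemma rational_add:
  assumes "c \<in> rational" "d \<in> rational" shows "(\<lambda>k. c k + d k) \<in> rational"
  using assms
proof (induction c arbitrary: d)
  case (finite_support c)
  from finite_support(2,1) show ?case
  proof (induction d arbitrary: c)
    case (finite_support d)
    then show ?case by (intro rational.finite_support finite_support_add)
  next
    case (divide d)
    show ?case
      by (rule rational.divide) (use divide.IH[OF finite_support_\<Delta>[OF divide.prems]] in \<open>simp add: \<Delta>_add\<close>)
  qed
next
  case (divide c)
  show ?case
    by (rule rational.divide) (use divide.IH[OF rational_\<Delta>[OF divide.prems]] in \<open>simp add: \<Delta>_add\<close>)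
qed

lemma rational_sum:
  "(\<And>i. i \<in> I \<Longrightarrow> c i \<in> rational) \<Longrightarrow> (\<lambda>k. \<Sum>i\<in>I. c i k) \<in> rational"
proof (induction I rule: infinite_finite_induct)
  case (insert x F)
  then show ?case using rational_add[of "c x" "\<lambda>k. \<Sum>i\<in>F. c i k"] by simp
qed (auto intro!: rational.finite_support simp: finite_support_def)

lemma rational_shift: "c \<in> rational \<Longrightarrow> shift \<beta> c \<in> rational"
proof (induction rule: rational.induct)
  case (divide c)
  show ?case by (rule rational.divide) (simp add: \<Delta>_shift divide.IH)
qed (intro rational.finite_support finite_support_shift)

text \<open>Multiplication by a function that is invariant under the translations in \<open>\<Delta>\<close> commutes with
  \<open>\<Delta>\<close>; for a character of the exponents this is the substitution of roots of unity times the
  variables.\<close>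

lemma rational_mult_invariant:
  assumes "c \<in> rational"
    and \<psi>: "\<And>\<alpha> k. \<alpha> \<in> A \<Longrightarrow> unit_vector \<alpha> m \<le> k \<Longrightarrow> \<psi> (k - unit_vector \<alpha> m) = \<psi> k"
  shows "(\<lambda>k. \<psi> k * c k) \<in> rational"
  using assms(1)
proof (induction rule: rational.induct)
  case (divide c)
  have "\<Delta> (\<lambda>k. \<psi> k * c k) = (\<lambda>k. \<psi> k * \<Delta> c k)"
    by (rule ext) (auto simp: \<Delta>_def shift_def right_diff_distrib sum_distrib_left \<psi> intro!: sum.cong)
  then have "\<Delta> (\<lambda>k. \<psi> k * c k) \<in> rational" using divide.IH by simp
  then show ?case by (rule rational.divide)
qed (intro rational.finite_support finite_support_mult)

lemma rational_scale: "c \<in> rational \<Longrightarrow> (\<lambda>k. x * c k) \<in> rational"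
  by (rule rational_mult_invariant[of c "\<lambda>_. x"]) auto

text \<open>Multiplication by a coordinate is a derivation of generating functions, hence preserves
  rational functions.\<close>

lemma rational_coordinate:
  assumes "c \<in> rational" "\<alpha> \<in> A" shows "(\<lambda>k. of_nat (k \<alpha>) * c k) \<in> rational"
  using assms(1)
proof (induction rule: rational.induct)
  case (divide c)
  let ?u = "\<lambda>\<alpha>. unit_vector \<alpha> m"
  have "\<Delta> (\<lambda>k. of_nat (k \<alpha>) * c k) = (\<lambda>k. of_nat (k \<alpha>) * \<Delta> c k + \<epsilon> \<alpha> * of_nat m * shift (?u \<alpha>) c k)"
  proof
    fix k
    have s: "shift (?u \<beta>) (\<lambda>k. of_nat (k \<alpha>) * c k) k =
        of_nat (k \<alpha>) * shift (?u \<beta>) c k - (if \<beta> = \<alpha> then of_nat m * shift (?u \<beta>) c k else 0)" for \<beta>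
    proof (cases "?u \<beta> \<le> k")
      case True
      then have "of_nat ((k - ?u \<beta>) \<alpha>) = (of_nat (k \<alpha>) - (if \<beta> = \<alpha> then of_nat m else 0) :: complex)"
        unfolding unit_vector_le_iff by (simp add: unit_vector_def of_nat_diff)
      with True show ?thesis by (auto simp: shift_def left_diff_distrib)
    qed (auto simp: shift_def)
    have "(\<Sum>\<beta>\<in>A. \<epsilon> \<beta> * shift (?u \<beta>) (\<lambda>k. of_nat (k \<alpha>) * c k) k) =
        (\<Sum>\<beta>\<in>A. of_nat (k \<alpha>) * (\<epsilon> \<beta> * shift (?u \<beta>) c k) -
          (if \<beta> = \<alpha> then \<epsilon> \<beta> * of_nat m * shift (?u \<beta>) c k else 0))"
      unfolding s by (rule sum.cong) (auto simp: algebra_simps)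
    also have "\<dots> = of_nat (k \<alpha>) * (\<Sum>\<beta>\<in>A. \<epsilon> \<beta> * shift (?u \<beta>) c k) - \<epsilon> \<alpha> * of_nat m * shift (?u \<alpha>) c k"
      using A assms(2) by (simp add: sum_subtractf sum_distrib_left)
    finally show "\<Delta> (\<lambda>k. of_nat (k \<alpha>) * c k) k =
        of_nat (k \<alpha>) * \<Delta> c k + \<epsilon> \<alpha> * of_nat m * shift (?u \<alpha>) c k"
      by (simp add: \<Delta>_def algebra_simps)
  qed
  also have "\<dots> \<in> rational"
    by (intro rational_add divide.IH rational_scale rational_shift rational.divide[OF divide.hyps])
  finally show ?case by (rule rational.divide)
qed (intro rational.finite_support finite_support_mult)

lemma rational_linear:
  assumes "c \<in> rational"
  shows "(\<lambda>k. of_int (\<Sum>\<alpha>\<in>A. int (k \<alpha>) * l \<alpha>) * c k) \<in> rational"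
proof -
  have "(\<lambda>k. \<Sum>\<alpha>\<in>A. of_int (l \<alpha>) * (of_nat (k \<alpha>) * c k)) \<in> rational"
    by (intro rational_sum rational_scale rational_coordinate assms)
  also have "(\<lambda>k. \<Sum>\<alpha>\<in>A. of_int (l \<alpha>) * (of_nat (k \<alpha>) * c k)) =
      (\<lambda>k. of_int (\<Sum>\<alpha>\<in>A. int (k \<alpha>) * l \<alpha>) * c k)"
    by (rule ext) (simp add: sum_distrib_left sum_distrib_right mult_ac)
  finally show ?thesis .
qed

lemma rational_gbinomial:
  assumes "c \<in> rational"
  shows "(\<lambda>k. (of_int (\<Sum>\<alpha>\<in>A. int (k \<alpha>) * l \<alpha>) gchoose n) * c k) \<in> rational"
proof (induction n)
  case 0
  then show ?case using assms by simp
next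
  case (Suc n)
  let ?l = "\<lambda>k. of_int (\<Sum>\<alpha>\<in>A. int (k \<alpha>) * l \<alpha>) :: complex"
  have rec: "(x gchoose Suc n) = (1 / of_nat (Suc n)) * (x * (x gchoose n) + (- of_nat n) * (x gchoose n))"
    for x :: complex
    using gbinomial_mult_1[of x n] by (simp add: field_simps del: of_nat_Suc)
  have "(\<lambda>k. (1 / of_nat (Suc n)) * (?l k * ((?l k gchoose n) * c k) + (- of_nat n) * ((?l k gchoose n) * c k))) \<in> rational"
    by (intro rational_scale rational_add rational_linear Suc)
  also have "(\<lambda>k. (1 / of_nat (Suc n)) * (?l k * ((?l k gchoose n) * c k) + (- of_nat n) * ((?l k gchoose n) * c k))) =
      (\<lambda>k. (?l k gchoose Suc n) * c k)"
    unfolding rec by (simp add: algebra_simps)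
  finally show ?case .
qed

end

section \<open>Expansion of the coefficients at a root of unity\<close>

lemma of_int_minus_one_pow: "of_int (minus_one_pow e) = minus_one_pow e"
  by (simp add: minus_one_pow_def)

lemma minus_one_powi: "(- 1 :: complex) powi e = minus_one_pow e"
  by (cases "even e") (simp_all add: minus_one_pow_def power_int_minus_one_minus)

locale root_expansion = f_coefficients +
  fixes z :: complex and m :: nat
  assumes z: "primitive_root_of_unity m z" and m: "m > 0"
begin

lemma z_power: "z ^ m = 1"
  using z by (simp add: primitive_root_of_unity_def)

lemma z_nonzero: "z \<noteq> 0"
  using z_power m by (metis power_0_left less_numeral_extra(3) zero_neq_one)

lemma z_powi_mult: "z powi (int m * e) = 1"
  using z_power by (simp add: power_int_mult)

definition \<epsilon> :: "'a \<Rightarrow> complex" where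
  "\<epsilon> \<alpha> = minus_one_pow (Q \<alpha> \<alpha>)"

sublocale rational_functions A \<epsilon> m
  by unfold_locales (rule A)

definition w :: "('a \<Rightarrow> nat) \<Rightarrow> complex fps" where
  "w k = expand_q z (coefficient k)"

lemma expand_hom: "ring_hom_fun (expand_q z)"
  by (rule ring_hom_fun_expand_q[OF z_nonzero])

lemma w_convolution:
  assumes "k \<in> vectors A" "sum k A \<ge> m"
  shows "w k = (\<Sum>\<beta>\<in>{\<beta>\<in>vectors A. \<beta> \<le> k \<and> sum \<beta> A = m}.
    root_power z (pairing (k - \<beta>) \<beta>) * w \<beta> * w (k - \<beta>))"
  unfolding w_def using coefficient_convolution[OF assms]
  by (simp add: ring_hom_fun_sum[OF expand_hom] ring_hom_fun_mult[OF expand_hom] expand_q_single[OF z_nonzero])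

lemma nth_zero_hom: "ring_hom_fun (\<lambda>x. fps_nth (expand_q z x) 0)"
  using expand_hom by (auto simp: ring_hom_fun_def)

text \<open>The sign in \<open>h\<close>: the power of \<open>q\<close> in \<open>c(m e_\<alpha>)\<close> has exponent \<open>Q_\<alpha>\<alpha> m (m + 1) / 2\<close>. For odd \<open>m\<close> it
  contributes \<open>1\<close>. For even \<open>m\<close> it contributes \<open>(-1)^Q_\<alpha>\<alpha>\<close>, since \<open>z^(m/2) = -1\<close>, while the sign
  \<open>(-1)^(m Q_\<alpha>\<alpha>)\<close> is \<open>1\<close>.\<close>

lemma w_unit_vector:
  assumes "\<alpha> \<in> A" shows "fps_nth (w (unit_vector \<alpha> m)) 0 = \<epsilon> \<alpha>"
proof -
  let ?e = "(int m * Q \<alpha> \<alpha> * int m + Q \<alpha> \<alpha> * int m) div 2"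
  have "fps_nth (w (unit_vector \<alpha> m)) 0 = minus_one_pow (Q \<alpha> \<alpha> * int m) * z powi ?e"
    unfolding w_def coefficient_unit[OF assms] expand_q_single[OF z_nonzero]
    by (simp add: root_power_nth of_int_minus_one_pow flip: fps_of_int)
  also have "\<dots> = \<epsilon> \<alpha>"
  proof (cases "even m")
    case True
    then obtain n where n: "m = 2 * n" by blast
    have "(z ^ n) ^ 2 = 1" using z_power by (simp add: n mult.commute flip: power_mult)
    moreover have "z ^ n \<noteq> 1"
      using z m by (simp add: primitive_root_of_unity_def n)
    ultimately have zn: "z ^ n = - 1" by (simp add: power2_eq_1_iff)
    have "?e = int n * (Q \<alpha> \<alpha> * (2 * int n + 1))"
    proof -
      have "int m * Q \<alpha> \<alpha> * int m + Q \<alpha> \<alpha> * int m = 2 * (int n * (Q \<alpha> \<alpha> * (2 * int n + 1)))"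
        by (simp add: n algebra_simps)
      then show ?thesis by simp
    qed
    then have "z powi ?e = (z powi int n) powi (Q \<alpha> \<alpha> * (2 * int n + 1))"
      by (simp only: power_int_mult[of z "int n"])
    then have "z powi ?e = minus_one_pow (Q \<alpha> \<alpha> * (2 * int n + 1))"
      by (simp only: power_int_of_nat zn minus_one_powi)
    then show ?thesis by (simp add: \<epsilon>_def minus_one_pow_def n)
  next
    case False
    then obtain n where n: "m + 1 = 2 * n" by (metis even_plus_one_iff evenE)
    have "?e = int m * (Q \<alpha> \<alpha> * int n)"
    proof -
      have "int m + 1 = 2 * int n" using n by presburger
      then have "int m * Q \<alpha> \<alpha> * int m + Q \<alpha> \<alpha> * int m = int m * Q \<alpha> \<alpha> * (2 * int n)"
        by (simp only: flip: \<open>int m + 1 = 2 * int n\<close>) (simp add: algebra_simps)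
      also have "\<dots> = 2 * (int m * (Q \<alpha> \<alpha> * int n))" by simp
      finally show ?thesis by simp
    qed
    then show ?thesis using False by (simp add: z_powi_mult \<epsilon>_def minus_one_pow_def)
  qed
  finally show ?thesis .
qed

text \<open>At a primitive m-th root of unity the q-multinomial coefficients of degree \<open>m\<close> vanish, except
  for those with a single nonzero entry: the factor \<open>1 - q^m\<close> of the numerator vanishes, and the
  factors \<open>1 - q^i\<close> of the denominator have \<open>i < m\<close>.\<close>

lemma w_vanishes:
  assumes \<beta>: "\<beta> \<in> vectors A" "sum \<beta> A = m" "\<And>\<alpha>. \<alpha> \<in> A \<Longrightarrow> \<beta> \<noteq> unit_vector \<alpha> m"
  shows "fps_nth (w \<beta>) 0 = 0"
proof -
  have lt: "\<beta> \<alpha> < m" if \<alpha>: "\<alpha> \<in> A" for \<alpha>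
  proof (rule ccontr)
    assume "\<not> \<beta> \<alpha> < m"
    moreover have s: "sum \<beta> A = \<beta> \<alpha> + sum \<beta> (A - {\<alpha>})" using A \<alpha> by (rule sum.remove)
    ultimately have "\<beta> \<alpha> = m" "sum \<beta> (A - {\<alpha>}) = 0" using \<beta>(2) by auto
    then have "\<beta> = unit_vector \<alpha> m"
      using A \<beta>(1) by (auto simp: unit_vector_def vectors_def fun_eq_iff)
    then show False using \<beta>(3)[OF \<alpha>] by blast
  qed
  define E where "E P = fps_nth (expand_q z (qlaurent_of_poly P)) 0" for P
  have E: "ring_hom_fun E"
    unfolding E_def using ring_hom_fun_comp[OF nth_zero_hom ring_hom_fun_qlaurent_of_poly] .
  have "E (Polynomial.monom 1 i) = z ^ i" for i
    by (simp add: E_def qlaurent_of_poly_monom expand_q_single[OF z_nonzero] root_power_nth)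
  then have poch: "E (q_pochhammer n) = (\<Prod>i=1..n. 1 - z ^ i)" for n
    unfolding q_pochhammer_def ring_hom_fun_prod[OF E] ring_hom_fun_diff[OF E] ring_hom_fun_one[OF E] by simp
  have "E (q_multinomial A \<beta>) * (\<Prod>\<alpha>\<in>A. E (q_pochhammer (\<beta> \<alpha>))) = E (q_pochhammer m)"
    using q_multinomial_mult[OF A, of \<beta>]
    by (simp add: \<beta>(2) flip: ring_hom_fun_prod[OF E] ring_hom_fun_mult[OF E])
  also have "E (q_pochhammer m) = 0"
    unfolding poch using m z_power by (intro prod_zero) auto
  finally have "E (q_multinomial A \<beta>) = 0 \<or> (\<exists>\<alpha>\<in>A. E (q_pochhammer (\<beta> \<alpha>)) = 0)"
    using A by auto
  moreover have "E (q_pochhammer (\<beta> \<alpha>)) \<noteq> 0" if "\<alpha> \<in> A" for \<alpha>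
    unfolding poch using lt[OF that] z by (auto simp: primitive_root_of_unity_def) 
  ultimately have "E (q_multinomial A \<beta>) = 0" by blast
  then show ?thesis
    unfolding w_def coefficient_def ring_hom_fun_mult[OF nth_zero_hom] E_def by simp
qed

lemma pairing_unit_vector: "\<alpha> \<in> A \<Longrightarrow> pairing (unit_vector \<alpha> n) \<beta> = int n * linear_part \<beta> \<alpha>"
  unfolding pairing_def by (rule sum_unit_vector_mult)

lemma pairing_unit_vector_right: "\<alpha> \<in> A \<Longrightarrow> \<exists>x. pairing \<gamma> (unit_vector \<alpha> n) = int n * x"
  unfolding pairing_def by (simp add: linear_part_unit)
    (auto simp: sum_distrib_left intro!: exI[of _ "\<Sum>a\<in>A. int (\<gamma> a) * ((if r a < r \<alpha> then 1 else 0) + Q a \<alpha>)"] sum.cong)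

text \<open>A coefficient of \<open>(z + t)^B(\<gamma>,\<beta>)\<close> is a polynomial in \<open>\<gamma>\<close> times the character \<open>z^B(\<gamma>,\<beta>)\<close>, which is
  invariant under \<open>\<Delta>\<close> because \<open>z^m = 1\<close>.\<close>

lemma rational_root_power:
  assumes "c \<in> rational" shows "(\<lambda>\<gamma>. fps_nth (root_power z (pairing \<gamma> \<beta>) * v) n * c \<gamma>) \<in> rational"
proof -
  have "(\<lambda>\<gamma>. z powi pairing \<gamma> \<beta> * c \<gamma>) \<in> rational"
  proof (rule rational_mult_invariant[OF assms])
    fix \<alpha> and k :: "'a \<Rightarrow> nat" assume \<alpha>: "\<alpha> \<in> A" "unit_vector \<alpha> m \<le> k"
    have "pairing k \<beta> = pairing (k - unit_vector \<alpha> m) \<beta> + int m * linear_part \<beta> \<alpha>"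
      using pairing_add_left[of "k - unit_vector \<alpha> m" "unit_vector \<alpha> m" \<beta>]
      unfolding vector_diff_add[OF \<alpha>(2)] pairing_unit_vector[OF \<alpha>(1)] .
    then show "z powi pairing (k - unit_vector \<alpha> m) \<beta> = z powi pairing k \<beta>"
      using z_nonzero by (simp add: power_int_add z_powi_mult)
  qed
  then have "(\<lambda>\<gamma>. \<Sum>i=0..n. z powi (- int i) * fps_nth v (n - i) *
      ((of_int (pairing \<gamma> \<beta>) gchoose i) * (z powi pairing \<gamma> \<beta> * c \<gamma>))) \<in> rational"
    unfolding pairing_def by (intro rational_sum rational_scale rational_gbinomial)
  also have "(\<lambda>\<gamma>. \<Sum>i=0..n. z powi (- int i) * fps_nth v (n - i) *
      ((of_int (pairing \<gamma> \<beta>) gchoose i) * (z powi pairing \<gamma> \<beta> * c \<gamma>))) =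
      (\<lambda>\<gamma>. fps_nth (root_power z (pairing \<gamma> \<beta>) * v) n * c \<gamma>)"
  proof
    fix \<gamma>
    have "z powi (pairing \<gamma> \<beta> - int i) = z powi pairing \<gamma> \<beta> * z powi (- int i)" for i
      using power_int_add[of z "pairing \<gamma> \<beta>" "- int i"] z_nonzero by simp
    then show "(\<Sum>i=0..n. z powi (- int i) * fps_nth v (n - i) *
      ((of_int (pairing \<gamma> \<beta>) gchoose i) * (z powi pairing \<gamma> \<beta> * c \<gamma>))) =
      fps_nth (root_power z (pairing \<gamma> \<beta>) * v) n * c \<gamma>"
      unfolding fps_mult_nth root_power_nth sum_distrib_right
      by (intro sum.cong refl) (simp only: mult_ac)
  qed
  finally show ?thesis .
qed

text \<open>By the convolution formula, \<open>\<Delta>\<close> of the coefficient of \<open>(q - z)^j\<close> is, on vectors of degree at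
  least \<open>m\<close>, a combination \<open>G\<close> of coefficients of lower powers of \<open>q - z\<close>.\<close>

lemma rational_w: "(\<lambda>k. fps_nth (w k) j) \<in> rational"
proof (induction j rule: less_induct)
  case (less j)
  define V where "V = {\<beta> \<in> vectors A. sum \<beta> A = m}"
  have V: "finite V" unfolding V_def by (rule finite_vectors_sum[OF A])
  define e where "e \<beta> \<gamma> = root_power z (pairing \<gamma> \<beta>) * w \<beta>" for \<beta> \<gamma>
  define c where "c i k = fps_nth (w k) i" for i k
  define G where "G k = (\<Sum>\<beta>\<in>V. shift \<beta> (\<lambda>\<gamma>. \<Sum>i<j. fps_nth (e \<beta> \<gamma>) (j - i) * c i \<gamma>) k)" for k
  have G: "G \<in> rational"
    unfolding G_def e_def
    by (intro rational_sum rational_shift rational_root_power) (simp add: c_def less)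
  \<comment> \<open>The terms with the coefficient of \<open>(q - z)^j\<close> itself carry the value of \<open>w \<beta>\<close> at \<open>q = z\<close>;
    they are exactly those that \<open>\<Delta>\<close> removes.\<close>
  have lead: "(\<Sum>\<beta>\<in>V. shift \<beta> (\<lambda>\<gamma>. fps_nth (e \<beta> \<gamma>) 0 * c j \<gamma>) k) =
      (\<Sum>\<alpha>\<in>A. \<epsilon> \<alpha> * shift (unit_vector \<alpha> m) (c j) k)" for k
  proof -
    have inj: "inj_on (\<lambda>\<alpha>. unit_vector \<alpha> m) A"
    proof (rule inj_onI)
      fix x y assume "unit_vector x m = unit_vector y m"
      then have "unit_vector x m x = unit_vector y m x" by simp
      then show "x = y" using m by (auto simp: unit_vector_def split: if_splits)
    qed
    have sub: "(\<lambda>\<alpha>. unit_vector \<alpha> m) ` A \<subseteq> V"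
      using A by (auto simp: V_def unit_vector_in_vectors sum_unit_vector)
    have "(\<Sum>\<beta>\<in>V. shift \<beta> (\<lambda>\<gamma>. fps_nth (e \<beta> \<gamma>) 0 * c j \<gamma>) k) =
        (\<Sum>\<beta>\<in>(\<lambda>\<alpha>. unit_vector \<alpha> m) ` A. shift \<beta> (\<lambda>\<gamma>. fps_nth (e \<beta> \<gamma>) 0 * c j \<gamma>) k)"
    proof (rule sum.mono_neutral_right[OF V sub], rule ballI)
      fix \<beta> assume "\<beta> \<in> V - (\<lambda>\<alpha>. unit_vector \<alpha> m) ` A"
      then have "fps_nth (w \<beta>) 0 = 0" by (intro w_vanishes) (auto simp: V_def)
      then show "shift \<beta> (\<lambda>\<gamma>. fps_nth (e \<beta> \<gamma>) 0 * c j \<gamma>) k = 0"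
        by (simp add: shift_def e_def)
    qed
    also have "\<dots> = (\<Sum>\<alpha>\<in>A. shift (unit_vector \<alpha> m) (\<lambda>\<gamma>. fps_nth (e (unit_vector \<alpha> m) \<gamma>) 0 * c j \<gamma>) k)"
      by (simp add: sum.reindex[OF inj])
    also have "\<dots> = (\<Sum>\<alpha>\<in>A. \<epsilon> \<alpha> * shift (unit_vector \<alpha> m) (c j) k)"
    proof (rule sum.cong[OF refl])
      fix \<alpha> assume \<alpha>: "\<alpha> \<in> A"
      have "fps_nth (e (unit_vector \<alpha> m) \<gamma>) 0 = \<epsilon> \<alpha>" for \<gamma>
        using pairing_unit_vector_right[OF \<alpha>, of \<gamma> m] w_unit_vector[OF \<alpha>]
        by (auto simp: e_def root_power_nth z_powi_mult)
      then show "shift (unit_vector \<alpha> m) (\<lambda>\<gamma>. fps_nth (e (unit_vector \<alpha> m) \<gamma>) 0 * c j \<gamma>) k =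
          \<epsilon> \<alpha> * shift (unit_vector \<alpha> m) (c j) k"
        by (simp add: shift_def)
    qed
    finally show ?thesis .
  qed
  have eq: "\<Delta> (c j) k = G k" if k: "k \<in> vectors A" "sum k A \<ge> m" for k
  proof -
    have "c j k = (\<Sum>\<beta>\<in>{\<beta>\<in>vectors A. \<beta> \<le> k \<and> sum \<beta> A = m}. fps_nth (e \<beta> (k - \<beta>) * w (k - \<beta>)) j)"
      unfolding c_def w_convolution[OF k] fps_sum_nth e_def ..
    also have "\<dots> = (\<Sum>\<beta>\<in>V. shift \<beta> (\<lambda>\<gamma>. fps_nth (e \<beta> \<gamma> * w \<gamma>) j) k)"
      by (rule sum.mono_neutral_cong_left) (use V in \<open>auto simp: V_def shift_def\<close>)
    also have "(\<lambda>\<beta> \<gamma>. fps_nth (e \<beta> \<gamma> * w \<gamma>) j) =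
        (\<lambda>\<beta> \<gamma>. (\<Sum>i<j. fps_nth (e \<beta> \<gamma>) (j - i) * c i \<gamma>) + fps_nth (e \<beta> \<gamma>) 0 * c j \<gamma>)"
    proof (intro ext)
      fix \<beta> \<gamma>
      have "fps_nth (e \<beta> \<gamma> * w \<gamma>) j = (\<Sum>i=0..j. c i \<gamma> * fps_nth (e \<beta> \<gamma>) (j - i))"
        unfolding mult.commute[of "e \<beta> \<gamma>"] fps_mult_nth c_def ..
      also have "{0..j} = insert j {..<j}" by auto
      finally show "fps_nth (e \<beta> \<gamma> * w \<gamma>) j =
          (\<Sum>i<j. fps_nth (e \<beta> \<gamma>) (j - i) * c i \<gamma>) + fps_nth (e \<beta> \<gamma>) 0 * c j \<gamma>"
        by (simp add: mult.commute add.commute)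
    qed
    finally show ?thesis
      unfolding \<Delta>_def lead[symmetric] G_def by (simp add: shift_add sum.distrib)
  qed
  have "finite_support (\<lambda>k. \<Delta> (c j) k + (- 1) * G k)"
    unfolding finite_support_def
  proof (rule finite_subset[OF _ finite_bounded_vectors[OF A]])
    show "{k \<in> vectors A. \<Delta> (c j) k + (- 1) * G k \<noteq> 0} \<subseteq> {k \<in> vectors A. sum k A \<le> m}"
      using eq by force
  qed
  from rational_add[OF rational.finite_support[OF this] G] have "\<Delta> (c j) \<in> rational" by simp
  then have "c j \<in> rational" by (rule rational.divide)
  then show ?case by (simp add: c_def[abs_def])
qed

end

section \<open>Specialisation\<close>

definition exponent_vector :: "nat \<Rightarrow> (int ^ 'n) set \<Rightarrow> (int ^ 'n \<Rightarrow> nat) \<Rightarrow> rat ^ 'n::finite" where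
  "exponent_vector m A k = (\<chi> i. of_int (\<Sum>\<alpha>\<in>A. int (k \<alpha>) * \<alpha> $ i) / of_nat m)"

lemma single_sum: "Poly_Mapping.single a (sum f I) = (\<Sum>i\<in>I. Poly_Mapping.single a (f i))"
  by (induction I rule: infinite_finite_induct) (simp_all add: single_add)

text \<open>The substitution \<open>y_\<alpha> = x^(\<alpha>/m) \<lambda>^(1/m)\<close>. Different \<open>k\<close> may yield the same monomial, which is why the
  operators above act before this substitution.\<close>

definition specialise :: "nat \<Rightarrow> (int ^ 'n) set \<Rightarrow> ((int ^ 'n \<Rightarrow> nat) \<Rightarrow> complex) \<Rightarrow> 'n::finite xlaurent fps" where
  "specialise m A c = Abs_fps (\<lambda>N. \<Sum>k\<in>{k\<in>vectors A. sum k A = N}.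
     Poly_Mapping.single (exponent_vector m A k) (c k))"

lemma specialise_nth: "fps_nth (specialise m A c) N =
    (\<Sum>k\<in>{k\<in>vectors A. sum k A = N}. Poly_Mapping.single (exponent_vector m A k) (c k))"
  by (simp add: specialise_def)

lemma exponent_vector_add_unit:
  assumes "finite A" "\<alpha> \<in> A" "m > 0"
  shows "exponent_vector m A (k + unit_vector \<alpha> m) = exponent_vector m A k + (\<chi> i. of_int (\<alpha> $ i))"
proof -
  have "(\<Sum>\<beta>\<in>A. int (unit_vector \<alpha> m \<beta>) * \<beta> $ i) = int m * \<alpha> $ i" for i
  proof -
    have "(\<Sum>\<beta>\<in>A. int (unit_vector \<alpha> m \<beta>) * \<beta> $ i) = (\<Sum>\<beta>\<in>A. if \<beta> = \<alpha> then int m * \<alpha> $ i else 0)"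
      by (rule sum.cong) (auto simp: unit_vector_def)
    then show ?thesis using assms by simp
  qed
  then have "(\<Sum>\<beta>\<in>A. int ((k + unit_vector \<alpha> m) \<beta>) * \<beta> $ i) =
      (\<Sum>\<beta>\<in>A. int (k \<beta>) * \<beta> $ i) + int m * \<alpha> $ i" for i
    by (simp add: distrib_right sum.distrib)
  then show ?thesis
    using assms(3) by (simp add: exponent_vector_def vec_eq_iff add_divide_distrib)
qed

locale specialisation = habiro_setting \<zeta> "h_poly A Q" + root_expansion A Q r "\<zeta> m" m
  for \<zeta> and A :: "(int ^ 'n::finite) set" and Q r m
begin

text \<open>Under the substitution, \<open>y_\<alpha>^m\<close> becomes \<open>x^\<alpha> \<lambda>\<close> and therefore \<open>1 - \<Sum> \<epsilon> \<alpha> * y_\<alpha>^m\<close> becomes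
  \<open>1 - \<lambda>h\<close>.\<close>

lemma specialise_\<Delta>: "specialise m A (\<Delta> c) = denominator m * specialise m A c"
proof (rule fps_ext)
  fix N
  let ?V = "\<lambda>N. {k\<in>vectors A. sum k A = N}"
  let ?v = "exponent_vector m A"
  let ?u = "\<lambda>\<alpha>. unit_vector \<alpha> m"
  let ?x = "\<lambda>\<alpha>::int^'n. (\<chi> i. of_int (\<alpha> $ i)) :: rat^'n"
  have shifted: "(\<Sum>k\<in>?V N. Poly_Mapping.single (?v k) (\<epsilon> \<alpha> * shift (?u \<alpha>) c k)) =
      (if N < m then 0 else Poly_Mapping.single (?x \<alpha>) (\<epsilon> \<alpha>) * fps_nth (specialise m A c) (N - m))"
    if \<alpha>: "\<alpha> \<in> A" for \<alpha>
  proof -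
    have "(\<Sum>k\<in>?V N. Poly_Mapping.single (?v k) (\<epsilon> \<alpha> * shift (?u \<alpha>) c k)) =
        (\<Sum>k\<in>{k\<in>?V N. ?u \<alpha> \<le> k}. Poly_Mapping.single (?v k) (\<epsilon> \<alpha> * c (k - ?u \<alpha>)))"
      by (rule sum.mono_neutral_cong_right) (auto simp: finite_vectors_sum[OF A] shift_def)
    also have "\<dots> = (if N < m then 0 else Poly_Mapping.single (?x \<alpha>) (\<epsilon> \<alpha>) * fps_nth (specialise m A c) (N - m))"
    proof (cases "N < m")
      case True
      have "sum k A \<ge> m" if "?u \<alpha> \<le> k" for k
        using sum_mono[of A "?u \<alpha>" k] le_funD[OF that] sum_unit_vector[OF A \<alpha>, of m] by simp
      then have "{k\<in>?V N. ?u \<alpha> \<le> k} = {}" using True by fastforce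
      then show ?thesis using True by (simp only: sum.empty if_True)
    next
      case False
      have "(\<Sum>k\<in>{k\<in>?V N. ?u \<alpha> \<le> k}. Poly_Mapping.single (?v k) (\<epsilon> \<alpha> * c (k - ?u \<alpha>))) =
          (\<Sum>k\<in>?V (N - m). Poly_Mapping.single (?x \<alpha>) (\<epsilon> \<alpha>) * Poly_Mapping.single (?v k) (c k))"
      proof (rule sum.reindex_bij_witness[of _ "\<lambda>k. k + ?u \<alpha>" "\<lambda>k. k - ?u \<alpha>"])
        fix k assume "k \<in> {k\<in>?V N. ?u \<alpha> \<le> k}"
        then have k: "k \<in> vectors A" "sum k A = N" "?u \<alpha> \<le> k" by auto
        show "k - ?u \<alpha> + ?u \<alpha> = k" by (rule vector_diff_add[OF k(3)])
        have "sum (k - ?u \<alpha>) A = N - m"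
          unfolding sum_diff_vector[OF k(3)] sum_unit_vector[OF A \<alpha>] k(2) ..
        then show "k - ?u \<alpha> \<in> ?V (N - m)" using diff_in_vectors[OF k(1)] by blast
        have "?v k = ?v (k - ?u \<alpha>) + ?x \<alpha>"
          using exponent_vector_add_unit[OF A \<alpha> m, of "k - ?u \<alpha>"] unfolding vector_diff_add[OF k(3)] .
        then show "Poly_Mapping.single (?x \<alpha>) (\<epsilon> \<alpha>) * Poly_Mapping.single (?v (k - ?u \<alpha>)) (c (k - ?u \<alpha>)) =
            Poly_Mapping.single (?v k) (\<epsilon> \<alpha> * c (k - ?u \<alpha>))"
          by (simp add: mult_single add.commute)
      next
        fix k assume "k \<in> ?V (N - m)"
        then have k: "k \<in> vectors A" "sum k A = N - m" by auto
        show "k + ?u \<alpha> - ?u \<alpha> = k" by auto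
        have "sum (k + ?u \<alpha>) A = N"
          using k(2) False sum_unit_vector[OF A \<alpha>, of m] by (simp add: sum.distrib)
        moreover have "k + ?u \<alpha> \<in> vectors A"
          using k(1) unit_vector_in_vectors[OF \<alpha>, of m] by (simp add: vectors_def)
        moreover have "?u \<alpha> \<le> k + ?u \<alpha>" by (simp add: le_fun_def)
        ultimately show "k + ?u \<alpha> \<in> {k\<in>?V N. ?u \<alpha> \<le> k}" by blast
      qed
      then show ?thesis using False by (simp add: specialise_nth sum_distrib_left)
    qed
    finally show ?thesis .
  qed
  have h: "h_poly A Q = (\<Sum>\<alpha>\<in>A. Poly_Mapping.single (?x \<alpha>) (\<epsilon> \<alpha>))"
    by (simp add: h_poly_def \<epsilon>_def)
  have "fps_nth (specialise m A (\<Delta> c)) N = fps_nth (specialise m A c) N -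
      (\<Sum>k\<in>?V N. \<Sum>\<alpha>\<in>A. Poly_Mapping.single (?v k) (\<epsilon> \<alpha> * shift (?u \<alpha>) c k))"
    unfolding specialise_nth \<Delta>_def single_diff sum_subtractf
    by (simp only: single_sum)
  also have "(\<Sum>k\<in>?V N. \<Sum>\<alpha>\<in>A. Poly_Mapping.single (?v k) (\<epsilon> \<alpha> * shift (?u \<alpha>) c k)) =
      (\<Sum>\<alpha>\<in>A. if N < m then 0 else Poly_Mapping.single (?x \<alpha>) (\<epsilon> \<alpha>) * fps_nth (specialise m A c) (N - m))"
    by (subst sum.swap) (rule sum.cong[OF refl shifted])
  also have "\<dots> = (if N < m then 0 else h_poly A Q * fps_nth (specialise m A c) (N - m))"
    by (simp add: h sum_distrib_right)
  finally show "fps_nth (specialise m A (\<Delta> c)) N = fps_nth (denominator m * specialise m A c) N"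
    by (simp add: denominator_def left_diff_distrib mult.assoc fps_X_power_mult_nth)
qed

lemma exponent_vector_in_lattice: "exponent_vector m A k \<in> fraction_lattice m"
  using m by (auto simp: exponent_vector_def fraction_lattice_def)

lemma specialise_finite_support:
  assumes fs: "finite_support c" and c: "\<And>k. c k \<in> cyclotomic m"
  shows "specialise m A c \<in> laurent_polys (cyclotomic m) m"
proof -
  define d where "d = Suc (Max ((\<lambda>k. sum k A) ` {k \<in> vectors A. c k \<noteq> 0}))"
  have fin: "finite {k \<in> vectors A. c k \<noteq> 0}" using fs by (simp add: finite_support_def)
  have "fps_nth (specialise m A c) N = 0" if "N \<ge> d" for N
    unfolding specialise_nth
  proof (rule sum.neutral, rule ballI)
    fix k assume k: "k \<in> {k\<in>vectors A. sum k A = N}"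
    have "c k = 0"
    proof (rule ccontr)
      assume "c k \<noteq> 0"
      then have "sum k A \<le> Max ((\<lambda>k. sum k A) ` {k \<in> vectors A. c k \<noteq> 0})"
        using k fin by (intro Max_ge) auto
      then show False using k that by (auto simp: d_def)
    qed
    then show "Poly_Mapping.single (exponent_vector m A k) (c k) = 0" by simp
  qed
  moreover have "fps_nth (specialise m A c) N \<in> coeff_ring (cyclotomic m) (fraction_lattice m)" for N
    unfolding specialise_nth
    by (intro coeff_ring_sum coeff_ring_single subring_cyclotomic c exponent_vector_in_lattice)
  ultimately show ?thesis
    unfolding laurent_polys_def by blast
qed

text \<open>The operator \<open>\<Delta>\<close> preserves integrality of the coefficients, so the numerator is a Laurent
  polynomial over \<open>\<int>[\<zeta>_m]\<close>.\<close>

lemma specialise_rational: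
  assumes "c \<in> rational" "\<And>k. c k \<in> cyclotomic m"
  shows "specialise m A c \<in> level m"
proof -
  have "\<exists>s. denominator m ^ s * specialise m A c \<in> laurent_polys (cyclotomic m) m"
    using assms
  proof (induction rule: rational.induct)
    case (finite_support c)
    then show ?case using specialise_finite_support[of c] by (intro exI[of _ 0]) simp
  next
    case (divide c)
    have "\<Delta> c k \<in> cyclotomic m" for k
    proof -
      have "shift \<beta> c k \<in> cyclotomic m" for \<beta>
        using divide.prems by (simp add: shift_def subring_set_zero[OF subring_cyclotomic])
      moreover have "\<epsilon> \<alpha> \<in> cyclotomic m" for \<alpha>
        unfolding \<epsilon>_def minus_one_pow_def
        using subring_set_one[OF subring_cyclotomic] subring_set_uminus[OF subring_cyclotomic] by simp
      ultimately show ?thesis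
        unfolding \<Delta>_def using divide.prems
        by (intro subring_set_diff[OF subring_cyclotomic] subring_set_sum[OF subring_cyclotomic]
            subring_set_mult[OF subring_cyclotomic])
    qed
    then obtain s where "denominator m ^ s * specialise m A (\<Delta> c) \<in> laurent_polys (cyclotomic m) m"
      using divide.IH by blast
    then have "denominator m ^ Suc s * specialise m A c \<in> laurent_polys (cyclotomic m) m"
      unfolding specialise_\<Delta> by (simp add: mult_ac)
    then show ?case by blast
  qed
  then show ?thesis unfolding level_iff[OF m] .
qed

lemma w_integral: "fps_nth (w k) j \<in> cyclotomic m"
proof -
  have z: "\<zeta> m \<in> cyclotomic m" by (auto intro: generated_incl)
  have inv: "inverse (\<zeta> m) \<in> cyclotomic m"
    by (rule inverse_root(2)[OF m z])
  have "fps_nth (w k) j = (\<Sum>e\<in>Poly_Mapping.keys (coefficient k).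
      of_int (Poly_Mapping.lookup (coefficient k) e) * fps_nth (root_power (\<zeta> m) e) j)"
    unfolding w_def expand_q_eq_keysum[OF z_nonzero] keysum_def fps_sum_nth by (simp flip: fps_of_int)
  also have "\<dots> \<in> cyclotomic m"
    unfolding root_power_nth
    by (intro subring_set_sum[OF subring_cyclotomic] subring_set_mult[OF subring_cyclotomic]
        subring_set_of_int[OF subring_cyclotomic] gbinomial_in_subring[OF subring_cyclotomic]
        powi_in_subring[OF subring_cyclotomic z inv])
  finally show ?thesis .
qed

lemma expansion_f_series:
  "fps_nth (expansion \<zeta> (f_series A Q) m) j = specialise m A (\<lambda>k. fps_nth (w k) j)"
proof (rule fps_ext)
  fix N
  define G where "G a x = Poly_Mapping.single (\<chi> i. of_int (a $ i) / of_nat m :: rat ^ 'n)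
      (fps_nth (expand_q (\<zeta> m) x) j)" for a :: "int ^ 'n" and x
  have G: "coefficient_additive G"
    using expand_hom by (simp add: coefficient_additive_def G_def ring_hom_fun_def
        ring_hom_fun_zero[OF expand_hom] single_add)
  have V: "{k. (\<forall>\<alpha>. \<alpha> \<notin> A \<longrightarrow> k \<alpha> = 0) \<and> sum k A = N} = {k\<in>vectors A. sum k A = N}"
    by (auto simp: vectors_def)
  have f: "fps_nth (f_series A Q) N = (\<Sum>k\<in>{k\<in>vectors A. sum k A = N}.
      Poly_Mapping.single (\<chi> i. \<Sum>\<alpha>\<in>A. int (k \<alpha>) * \<alpha> $ i) (coefficient k))"
    unfolding f_series_def coefficient_def exponent_def V[symmetric] by simp
  have "fps_nth (fps_nth (expansion \<zeta> (f_series A Q) m) j) N = keysum G (fps_nth (f_series A Q) N)"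
    unfolding expansion_nth keysum_def G_def ..
  also have "\<dots> = (\<Sum>k\<in>{k\<in>vectors A. sum k A = N}. G (\<chi> i. \<Sum>\<alpha>\<in>A. int (k \<alpha>) * \<alpha> $ i) (coefficient k))"
    unfolding f keysum_sum[OF G] using G by (intro sum.cong refl keysum_single) (simp add: coefficient_additive_def)
  also have "\<dots> = fps_nth (specialise m A (\<lambda>k. fps_nth (w k) j)) N"
    unfolding specialise_nth by (intro sum.cong refl) (simp add: G_def exponent_vector_def w_def)
  finally show "fps_nth (fps_nth (expansion \<zeta> (f_series A Q) m) j) N =
      fps_nth (specialise m A (\<lambda>k. fps_nth (w k) j)) N" .
qed

end

lemma h_poly_integral: "h_poly A Q \<in> coeff_ring \<int> (fraction_lattice 1)"
  unfolding h_poly_def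
  by (intro coeff_ring_sum coeff_ring_single subring_set_Ints) (auto simp: minus_one_pow_def fraction_lattice_def)

theorem theorem1p12:
  fixes \<A> :: "(int ^ 'n::finite) set"
    and Q :: "int ^ 'n \<Rightarrow> int ^ 'n \<Rightarrow> int"
    and \<zeta> :: "nat \<Rightarrow> complex"
  assumes "compatible_roots \<zeta>"
    and "finite \<A>"
    and "\<forall>\<alpha>\<in>\<A>. \<forall>\<beta>\<in>\<A>. Q \<alpha> \<beta> = Q \<beta> \<alpha>"
  shows "expansion \<zeta> (f_series \<A> Q)
           \<in> habiro_ring \<zeta> (localisation base_ring (1 - fps_X * fps_const (h_poly \<A> Q)))"
proof -
  interpret habiro_setting \<zeta> "h_poly \<A> Q"
    by unfold_locales (rule assms(1), rule h_poly_integral)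
  obtain r :: "int ^ 'n \<Rightarrow> nat" where r: "inj_on r \<A>"
    using finite_imp_inj_to_nat_seg[OF assms(2)] by blast
  have "fps_nth (expansion \<zeta> (f_series \<A> Q) m) j \<in> level m" if "m > 0" for m j
  proof -
    interpret specialisation \<zeta> \<A> Q r m
      by unfold_locales (use assms r that primitive in auto)
    show ?thesis
      unfolding expansion_f_series by (intro specialise_rational rational_w w_integral)
  qed
  then have "expansion \<zeta> (f_series \<A> Q) \<in> habiro_ring \<zeta> level_one"
    by (rule expansion_in_habiro_ring)
  then show ?thesis by (simp add: level_one_def denominator_def)
qed

end
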